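(* Let $\Lambda\subset\mathbb Z^D$ be finite and consider on the bosonic Fock space over $\Lambda$ the Hamiltonian $$H=\sum_{i,j\in\Lambda}\mathcal J_{ij}a_i^\dagger a_j+\frac12\sum_{i,j\in\Lambda}V_{ij}a_i^\dagger a_j^\dagger a_ja_i,$$ with $\mathcal J$ Hermitian, $V$ real symmetric, $|\mathcal J_{ij}|\le C_{\mathcal J,\alpha}|i-j|^{-\alpha}$ and $|V_{ij}|\le C_{V,\alpha}|i-j|^{-\alpha}$. Assume $\alpha>3D+1$ and set $\beta=\lfloor\alpha-3D-1\rfloor$. Let $X\subset\Lambda$, let $O$ be a bounded observable supported on $X$ with $\|O\|\le1$, let $R\ge\max(2,\operatorname{diam}X)$, and let $\psi_0$ be a normalized initial state satisfying: (C1) for some $\lambda>0$, $\langle\psi_0|N_{B}^p|\psi_0\rangle\le(\lambda r^D)^p$ for $p=1,2$ and every ball $B\subset\Lambda$ of radius $r\ge1$; (C2) $N_{X_{2R}\setminus X}\psi_0=0$. Let $v_{\rm LR}>2\sup_{x\in\Lambda}\sum_{y\in\Lambda}|\mathcal J_{xy}||x-y|$. Then for $R\ge v_{\rm LR}T$, $$\big|J_H(O)-J_{H_R}(O)\big|\le C\,\frac{T^2}{R^\beta},$$ with a constant $C$ depending only on $D,\alpha,C_{\mathcal J,\alpha},C_{V,\alpha},\lambda,v_{\rm LR}$ and $X$. Moreover (when $\beta\ge1$), to achieve $|J_H(O)-J_{H_R}(O)|\le\epsilon$ it suffices to take $$R_\epsilon(T)=\Theta\!\left(v_{\rm LR}T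+\Big(\frac{T^2}{\epsilon}\Big)^{1/\beta}\right).$$
   Context: $a_i,a_i^\dagger$ are bosonic operators, $[a_i,a_j^\dagger]=\delta_{ij}$; $N_S=\sum_{i\in S}a_i^\dagger a_i$ for $S\subset\Lambda$. For $i=j$ the expression $|i-j|^{-\alpha}$ is read as $1$. $X_r=\{i\in\Lambda:d(i,X)\le r\}$. $H_R$ is obtained from $H$ by keeping only the terms with both $i,j\in X_R$. $J_H(O)=\int_0^T\langle\psi_0|e^{itH}Oe^{-itH}|\psi_0\rangle dt$ and $J_{H_R}(O)=\int_0^T\langle\psi_0|e^{itH_R}Oe^{-itH_R}|\psi_0\rangle dt$. *)

theory Defs
  imports "HOL-Analysis.Analysis" "HOL-Library.Landau_Symbols"
begin

text \<open>
  The lattice is the set of integer points of \<open>real ^ 'd\<close>, with the Euclidean metric; its dimension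
  is \<open>CARD('d)\<close>. The Fock space over a finite set \<open>L\<close> of sites is
  \<open>\<ell>\<^sup>2\<close> of the occupation numbers: a state vector is its family of coefficients in the occupation
  number basis, which vanish outside the configurations with all particles in \<open>L\<close>. Operators act on
  arbitrary coefficient families, so that unbounded operators are total functions here; membership
  of a result in the Fock space is stated where it matters.
\<close>

definition int_lattice :: "(real ^ 'd) set" where
  "int_lattice = {x. \<forall>k. x $ k \<in> \<int>}"

type_synonym 's conf = "'s \<Rightarrow> nat"
type_synonym 's wave = "'s conf \<Rightarrow> complex"
type_synonym 's oper = "'s wave \<Rightarrow> 's wave"

definition configs :: "'s set \<Rightarrow> 's conf set" where
  "configs L = {n. \<forall>x. x \<notin> L \<longrightarrow> n x = 0}"

definition fock :: "'s set \<Rightarrow> 's wave set" where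
  "fock L = {\<psi>. (\<forall>n. n \<notin> configs L \<longrightarrow> \<psi> n = 0) \<and> (\<lambda>n. (cmod (\<psi> n))\<^sup>2) summable_on UNIV}"

definition fock_inner :: "'s wave \<Rightarrow> 's wave \<Rightarrow> complex" where
  "fock_inner \<phi> \<psi> = (\<Sum>\<^sub>\<infinity>n. cnj (\<phi> n) * \<psi> n)"

definition fock_norm :: "'s wave \<Rightarrow> real" where
  "fock_norm \<psi> = sqrt (\<Sum>\<^sub>\<infinity>n. (cmod (\<psi> n))\<^sup>2)"

definition ann :: "'s \<Rightarrow> 's oper" where
  "ann i \<psi> = (\<lambda>n. complex_of_real (sqrt (real (n i + 1))) * \<psi> (n(i := n i + 1)))"

text \<open>The factor \<open>sqrt 0\<close> takes care of the truncated subtraction.\<close>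

definition cre :: "'s \<Rightarrow> 's oper" where
  "cre i \<psi> = (\<lambda>n. complex_of_real (sqrt (real (n i))) * \<psi> (n(i := n i - 1)))"

definition number_op :: "'s set \<Rightarrow> 's oper" where
  "number_op S \<psi> = (\<lambda>n. \<Sum>i\<in>S. cre i (ann i \<psi>) n)"

definition hamiltonian :: "('s \<Rightarrow> 's \<Rightarrow> complex) \<Rightarrow> ('s \<Rightarrow> 's \<Rightarrow> real) \<Rightarrow> 's set \<Rightarrow> 's oper" where
  "hamiltonian J V S \<psi> = (\<lambda>n.
     (\<Sum>i\<in>S. \<Sum>j\<in>S. J i j * cre i (ann j \<psi>) n)
     + 1/2 * (\<Sum>i\<in>S. \<Sum>j\<in>S. complex_of_real (V i j) * cre i (cre j (ann j (ann i \<psi>))) n))"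

lemma ccr: "ann i (cre j \<psi>) n - cre j (ann i \<psi>) n = (if i = j then \<psi> n else 0)"
proof (cases "i = j")
  case True
  have *: "complex_of_real (sqrt (1 + real k)) * (complex_of_real (sqrt (1 + real k)) * z) = (1 + of_nat k) * z"
    for k z
    by (metis (no_types) mult.assoc of_nat_0_le_iff of_nat_Suc of_real_mult of_real_of_nat_eq
        real_sqrt_mult_self abs_of_nonneg)
  show ?thesis
  proof (cases "n j")
    case 0
    then show ?thesis using True * [of 0] by (simp add: ann_def cre_def)
  next
    case (Suc k)
    then have "n(j := Suc k) = n" by auto
    then show ?thesis
      using True Suc * [of k] * [of "Suc k"] by (simp add: ann_def cre_def algebra_simps)
  qed
next
  case False
  then show ?thesis by (simp add: ann_def cre_def fun_upd_twist)
qed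

lemma cre_ann: "cre i (ann i \<psi>) n = of_nat (n i) * \<psi> n"
proof (cases "n i")
  case 0
  then show ?thesis by (simp add: cre_def)
next
  case (Suc k)
  then have "n(i := Suc k) = n" by auto
  moreover have "complex_of_real (sqrt (1 + real k)) * (complex_of_real (sqrt (1 + real k)) * z) = (1 + of_nat k) * z"
    for z
    by (metis (no_types) mult.assoc of_nat_0_le_iff of_nat_Suc of_real_mult of_real_of_nat_eq
        real_sqrt_mult_self abs_of_nonneg)
  ultimately show ?thesis using Suc by (simp add: ann_def cre_def)
qed

lemma number_op_eq: "number_op S \<psi> n = of_nat (\<Sum>i\<in>S. n i) * \<psi> n"
  by (simp add: number_op_def cre_ann sum_distrib_right)

text \<open>
  The Hamiltonian preserves the particle number, and for finite \<open>S\<close> it is therefore the direct sum of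
  operators on finite-dimensional spaces. Hence the exponential series converges in every
  coefficient, and it gives the unitary group \<open>e\<^bsup>-itH\<^esup>\<close> on the whole Fock space (see
  \<open>hamiltonian_exp_summable\<close> and \<open>schroedinger_equation\<close> below).
\<close>

definition time_evol :: "'s oper \<Rightarrow> real \<Rightarrow> 's oper" where
  "time_evol H t \<psi> = (\<lambda>n. \<Sum>k. (- \<i> * complex_of_real t) ^ k / fact k * (H ^^ k) \<psi> n)"

definition shell :: "'s set \<Rightarrow> 's conf \<Rightarrow> 's conf set" where
  "shell S n = {m. (\<forall>x. x \<notin> S \<longrightarrow> m x = n x) \<and> sum m S = sum n S}"

definition matrix_on :: "'s conf set \<Rightarrow> 's oper \<Rightarrow> ('s conf \<Rightarrow> 's conf \<Rightarrow> complex) \<Rightarrow> bool" where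
  "matrix_on F A h \<longleftrightarrow> (\<forall>\<psi>. \<forall>m\<in>F. A \<psi> m = (\<Sum>m'\<in>F. h m m' * \<psi> m'))"

lemma finite_shell:
  assumes "finite S"
  shows "finite (shell S n)"
proof (rule finite_subset)
  let ?B = "(\<lambda>f x. if x \<in> S then f x else n x) ` (PiE S (\<lambda>_. {..sum n S}))"
  show "finite ?B" using assms by (intro finite_imageI finite_PiE) auto
  show "shell S n \<subseteq> ?B"
  proof
    fix m assume m: "m \<in> shell S n"
    have "m x \<le> sum n S" if "x \<in> S" for x
      using member_le_sum [of x S m] that assms m by (auto simp: shell_def)
    then have "restrict m S \<in> PiE S (\<lambda>_. {..sum n S})" by auto
    moreover have "m = (\<lambda>x. if x \<in> S then restrict m S x else n x)"
      using m by (auto simp: shell_def)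
    ultimately show "m \<in> ?B" by (rule_tac image_eqI)
  qed
qed

lemma matrix_on_sum:
  assumes "\<And>i. i \<in> I \<Longrightarrow> \<exists>h. matrix_on F (A i) h"
  shows "\<exists>h. matrix_on F (\<lambda>\<psi> n. \<Sum>i\<in>I. A i \<psi> n) h"
proof -
  obtain h where h: "\<And>i. i \<in> I \<Longrightarrow> matrix_on F (A i) (h i)" using assms by metis
  have "matrix_on F (\<lambda>\<psi> n. \<Sum>i\<in>I. A i \<psi> n) (\<lambda>m m'. \<Sum>i\<in>I. h i m m')"
    unfolding matrix_on_def
  proof (intro allI ballI)
    fix \<psi> m assume "m \<in> F"
    then have "(\<Sum>i\<in>I. A i \<psi> m) = (\<Sum>i\<in>I. \<Sum>m'\<in>F. h i m m' * \<psi> m')"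
      using h by (intro sum.cong) (auto simp: matrix_on_def)
    also have "\<dots> = (\<Sum>m'\<in>F. (\<Sum>i\<in>I. h i m m') * \<psi> m')"
      by (subst sum.swap) (simp add: sum_distrib_right)
    finally show "(\<Sum>i\<in>I. A i \<psi> m) = (\<Sum>m'\<in>F. (\<Sum>i\<in>I. h i m m') * \<psi> m')" .
  qed
  then show ?thesis by blast
qed

lemma matrix_on_add:
  assumes "\<exists>h. matrix_on F A h" "\<exists>h. matrix_on F B h"
  shows "\<exists>h. matrix_on F (\<lambda>\<psi> n. A \<psi> n + B \<psi> n) h"
proof -
  obtain h g where "matrix_on F A h" "matrix_on F B g" using assms by metis
  then have "matrix_on F (\<lambda>\<psi> n. A \<psi> n + B \<psi> n) (\<lambda>m m'. h m m' + g m m')"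
    by (simp add: matrix_on_def sum.distrib distrib_right)
  then show ?thesis by blast
qed

lemma matrix_on_scale:
  assumes "\<exists>h. matrix_on F A h"
  shows "\<exists>h. matrix_on F (\<lambda>\<psi> n. c * A \<psi> n) h"
proof -
  obtain h where "matrix_on F A h" using assms by metis
  then have "matrix_on F (\<lambda>\<psi> n. c * A \<psi> n) (\<lambda>m m'. c * h m m')"
    by (simp add: matrix_on_def sum_distrib_left mult.assoc)
  then show ?thesis by blast
qed

lemma matrix_on_single:
  assumes "finite F" "\<And>\<psi> m. m \<in> F \<Longrightarrow> A \<psi> m = c m * \<psi> (g m)"
    "\<And>m. m \<in> F \<Longrightarrow> c m \<noteq> 0 \<Longrightarrow> g m \<in> F"
  shows "\<exists>h. matrix_on F A h"
proof -
  have "matrix_on F A (\<lambda>m m'. if m' = g m then c m else 0)"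
    unfolding matrix_on_def
  proof (intro allI ballI)
    fix \<psi> m assume m: "m \<in> F"
    have "(\<Sum>m'\<in>F. (if m' = g m then c m else 0) * \<psi> m')
        = (\<Sum>m'\<in>F. if m' = g m then c m * \<psi> m' else 0)"
      by (intro sum.cong) auto
    also have "\<dots> = (if g m \<in> F then c m * \<psi> (g m) else 0)"
      using assms(1) by simp
    finally show "A \<psi> m = (\<Sum>m'\<in>F. (if m' = g m then c m else 0) * \<psi> m')"
      using assms(2,3) [OF m] by auto
  qed
  then show ?thesis by blast
qed

lemma shell_hop:
  assumes "finite S" "i \<in> S" "j \<in> S" "m \<in> shell S n" "m i \<noteq> 0"
  shows "(m(i := m i - 1))(j := (m(i := m i - 1)) j + 1) \<in> shell S n"
proof -
  have u: "sum (f(x := y)) S = y + sum f (S - {x})" if "x \<in> S" for f :: "'a \<Rightarrow> nat" and x y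
    using assms(1) that by (simp add: sum.remove)
  have r: "sum f S = f x + sum f (S - {x})" if "x \<in> S" for f :: "'a \<Rightarrow> nat" and x
    using assms(1) that by (simp add: sum.remove)
  have "sum ((m(i := m i - 1))(j := (m(i := m i - 1)) j + 1)) S = sum (m(i := m i - 1)) S + 1"
    unfolding u [OF assms(3)] r [OF assms(3), of "m(i := m i - 1)"] by simp
  also have "\<dots> = sum m S"
    unfolding u [OF assms(2)] r [OF assms(2), of m] using assms(5) by simp
  finally show ?thesis using assms(2-4) by (auto simp: shell_def)
qed

lemma matrix_on_hop:
  assumes "finite S" "i \<in> S" "j \<in> S"
  shows "\<exists>h. matrix_on (shell S n) (\<lambda>\<psi>. cre i (ann j \<psi>)) h"
  by (rule matrix_on_single [OF finite_shell [OF assms(1)],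
        where c = "\<lambda>m. complex_of_real (sqrt (real (m i)))
                * complex_of_real (sqrt (real ((m(i := m i - 1)) j + 1)))"
          and g = "\<lambda>m. (m(i := m i - 1))(j := (m(i := m i - 1)) j + 1)"])
     (use shell_hop [OF assms] in \<open>simp_all add: cre_def ann_def mult.assoc\<close>)

lemma matrix_on_pair:
  assumes "finite S"
  shows "\<exists>h. matrix_on (shell S n) (\<lambda>\<psi>. cre i (cre j (ann j (ann i \<psi>)))) h"
proof (rule matrix_on_single [OF finite_shell [OF assms],
        where c = "\<lambda>m. of_nat (m i) * of_nat ((m(i := m i - 1)) j)" and g = "\<lambda>m. m"])
  fix \<psi> m assume "m \<in> shell S n"
  have "cre i (cre j (ann j (ann i \<psi>))) m
      = complex_of_real (sqrt (real (m i))) * (of_nat ((m(i := m i - 1)) j) * ann i \<psi> (m(i := m i - 1)))"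
    by (simp only: cre_ann cre_def [of i])
  also have "\<dots> = of_nat ((m(i := m i - 1)) j) * cre i (ann i \<psi>) m"
    unfolding cre_def [of i] by (simp only: mult.left_commute)
  finally show "cre i (cre j (ann j (ann i \<psi>))) m
      = of_nat (m i) * of_nat ((m(i := m i - 1)) j) * \<psi> m"
    by (simp only: cre_ann mult.assoc mult.left_commute)
qed auto

lemma matrix_on_hamiltonian:
  assumes "finite S"
  shows "\<exists>h. matrix_on (shell S n) (hamiltonian J V S) h"
  unfolding hamiltonian_def
  by (intro matrix_on_add matrix_on_sum matrix_on_scale matrix_on_hop matrix_on_pair assms)

lemma self_in_shell: "n \<in> shell S n"
  by (simp add: shell_def)

lemma matrix_power_bound:
  assumes F: "finite F" and h: "matrix_on F H h" and m: "m \<in> F"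
  shows "cmod ((H ^^ k) \<psi> m)
    \<le> (\<Sum>m\<in>F. \<Sum>m'\<in>F. cmod (h m m')) ^ k * (\<Sum>m'\<in>F. cmod (\<psi> m'))"
  using m
proof (induction k arbitrary: m)
  case 0
  then show ?case using F member_le_sum [of m F "\<lambda>m'. cmod (\<psi> m')"] by simp
next
  case (Suc k)
  let ?M = "\<Sum>m\<in>F. \<Sum>m'\<in>F. cmod (h m m')" and ?w = "\<Sum>m'\<in>F. cmod (\<psi> m')"
  have w: "0 \<le> ?M ^ k * ?w"
    by (intro mult_nonneg_nonneg zero_le_power sum_nonneg) auto
  have "cmod ((H ^^ Suc k) \<psi> m) = cmod (\<Sum>m'\<in>F. h m m' * (H ^^ k) \<psi> m')"
    using h Suc.prems by (simp add: matrix_on_def)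
  also have "\<dots> \<le> (\<Sum>m'\<in>F. cmod (h m m') * cmod ((H ^^ k) \<psi> m'))"
    by (rule order_trans [OF norm_sum]) (simp add: norm_mult)
  also have "\<dots> \<le> (\<Sum>m'\<in>F. cmod (h m m') * (?M ^ k * ?w))"
    using Suc.IH by (intro sum_mono mult_left_mono) auto
  also have "\<dots> = (\<Sum>m'\<in>F. cmod (h m m')) * (?M ^ k * ?w)"
    by (simp add: sum_distrib_right)
  also have "\<dots> \<le> ?M * (?M ^ k * ?w)"
    by (intro mult_right_mono w member_le_sum [where f = "\<lambda>m. \<Sum>m'\<in>F. cmod (h m m')"])
       (use F Suc.prems in \<open>auto intro: sum_nonneg\<close>)
  finally show ?case by (simp add: mult.assoc)
qed

lemma matrix_exp_summable:
  assumes "finite F" "matrix_on F H h" "m \<in> F"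
  shows "summable (\<lambda>k. z ^ k / fact k * (H ^^ k) \<psi> m)"
proof (rule summable_comparison_test')
  let ?M = "\<Sum>m\<in>F. \<Sum>m'\<in>F. cmod (h m m')" and ?w = "\<Sum>m'\<in>F. cmod (\<psi> m')"
  show "summable (\<lambda>k. inverse (fact k) * (cmod z * ?M) ^ k * ?w)"
    by (intro summable_mult2 summable_exp)
  fix k :: nat
  have "cmod (z ^ k / fact k * (H ^^ k) \<psi> m) = cmod z ^ k / fact k * cmod ((H ^^ k) \<psi> m)"
    by (simp add: norm_mult norm_divide norm_power)
  also have "\<dots> \<le> cmod z ^ k / fact k * (?M ^ k * ?w)"
    by (intro mult_left_mono matrix_power_bound assms) auto
  finally show "cmod (z ^ k / fact k * (H ^^ k) \<psi> m) \<le> inverse (fact k) * (cmod z * ?M) ^ k * ?w"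
    by (simp add: field_simps power_mult_distrib)
qed

lemma hamiltonian_exp_summable:
  assumes "finite S"
  shows "summable (\<lambda>k. z ^ k / fact k * (hamiltonian J V S ^^ k) \<psi> n)"
  using matrix_on_hamiltonian [OF assms, of n J V]
    matrix_exp_summable [OF finite_shell [OF assms] _ self_in_shell] by blast

lemma time_evol_0: "time_evol H 0 \<psi> = \<psi>"
proof
  fix n
  have "(\<lambda>k. (0::complex) ^ k / fact k * (H ^^ k) \<psi> n) = (\<lambda>k. if k = 0 then \<psi> n else 0)"
    by (auto simp: fun_eq_iff)
  then show "time_evol H 0 \<psi> n = \<psi> n"
    unfolding time_evol_def by (simp add: sums_unique [OF sums_single, symmetric])
qed

theorem schroedinger_equation:
  fixes n :: "'s conf" and J :: "'s \<Rightarrow> 's \<Rightarrow> complex" and V :: "'s \<Rightarrow> 's \<Rightarrow> real"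
  assumes "finite S"
  defines "H \<equiv> hamiltonian J V S"
  shows "((\<lambda>t. time_evol H t \<psi> n) has_vector_derivative - \<i> * H (time_evol H t \<psi>) n) (at t)"
proof -
  let ?F = "shell S n"
  have F: "finite ?F" by (rule finite_shell [OF assms(1)])
  obtain h where h: "matrix_on ?F H h"
    using matrix_on_hamiltonian [OF assms(1)] unfolding H_def by blast
  define c where "c k = (- \<i>) ^ k / fact k * (H ^^ k) \<psi> n" for k
  have c: "c k * z ^ k = (- \<i> * z) ^ k / fact k * (H ^^ k) \<psi> n" for k z
    unfolding c_def power_mult_distrib by simp
  have dc: "diffs c k * z ^ k = - \<i> * (\<Sum>m\<in>?F. h n m * ((- \<i> * z) ^ k / fact k * (H ^^ k) \<psi> m))"
    for k z
  proof -
    have "diffs c k * z ^ k = - \<i> * ((- \<i> * z) ^ k / fact k * H ((H ^^ k) \<psi>) n)"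
      unfolding diffs_def c_def power_mult_distrib by (simp add: field_simps del: of_nat_Suc)
    also have "H ((H ^^ k) \<psi>) n = (\<Sum>m\<in>?F. h n m * (H ^^ k) \<psi> m)"
      using h self_in_shell [of n S] by (simp add: matrix_on_def)
    finally show ?thesis by (simp add: sum_distrib_left mult.left_commute)
  qed
  have "((\<lambda>z. \<Sum>k. c k * z ^ k) has_field_derivative (\<Sum>k. diffs c k * z ^ k)) (at z)" for z
  proof (rule termdiffs_strong_converges_everywhere)
    fix y
    show "summable (\<lambda>k. c k * y ^ k)"
      unfolding c by (rule matrix_exp_summable [OF F h self_in_shell])
  qed
  then have "((\<lambda>t. \<Sum>k. c k * complex_of_real t ^ k) has_vector_derivative
      (\<Sum>k. diffs c k * complex_of_real t ^ k)) (at t)"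
    by (intro has_vector_derivative_real_field)
  moreover have "(\<Sum>k. diffs c k * complex_of_real t ^ k) = - \<i> * H (time_evol H t \<psi>) n"
  proof -
    have s: "summable (\<lambda>k. (- \<i> * complex_of_real t) ^ k / fact k * (H ^^ k) \<psi> m)" if "m \<in> ?F" for m
      by (rule matrix_exp_summable [OF F h that])
    have "(\<Sum>k. diffs c k * complex_of_real t ^ k)
        = - \<i> * (\<Sum>k. \<Sum>m\<in>?F. h n m * ((- \<i> * complex_of_real t) ^ k / fact k * (H ^^ k) \<psi> m))"
      unfolding dc by (intro suminf_mult summable_sum summable_mult s)
    also have "(\<Sum>k. \<Sum>m\<in>?F. h n m * ((- \<i> * complex_of_real t) ^ k / fact k * (H ^^ k) \<psi> m))
        = (\<Sum>m\<in>?F. h n m * time_evol H t \<psi> m)"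
      unfolding time_evol_def
      by (simp only: suminf_sum suminf_mult summable_mult s cong: sum.cong)
    also have "\<dots> = H (time_evol H t \<psi>) n"
      using h self_in_shell [of n S] by (simp add: matrix_on_def)
    finally show ?thesis .
  qed
  ultimately show ?thesis
    unfolding c time_evol_def by simp
qed

definition bounded_op :: "'s set \<Rightarrow> 's oper \<Rightarrow> bool" where
  "bounded_op L A \<longleftrightarrow>
     (\<forall>\<psi>\<in>fock L. A \<psi> \<in> fock L) \<and>
     (\<forall>\<phi>\<in>fock L. \<forall>\<psi>\<in>fock L. A (\<lambda>n. \<phi> n + \<psi> n) = (\<lambda>n. A \<phi> n + A \<psi> n)) \<and>
     (\<forall>c. \<forall>\<psi>\<in>fock L. A (\<lambda>n. c * \<psi> n) = (\<lambda>n. c * A \<psi> n)) \<and>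
     (\<exists>K. \<forall>\<psi>\<in>fock L. fock_norm (A \<psi>) \<le> K * fock_norm \<psi>)"

definition op_norm :: "'s set \<Rightarrow> 's oper \<Rightarrow> real" where
  "op_norm L A = (SUP \<psi>\<in>fock L. fock_norm (A \<psi>) / fock_norm \<psi>)"

definition selfadjoint_op :: "'s set \<Rightarrow> 's oper \<Rightarrow> bool" where
  "selfadjoint_op L A \<longleftrightarrow>
     (\<forall>\<phi>\<in>fock L. \<forall>\<psi>\<in>fock L. fock_inner \<phi> (A \<psi>) = fock_inner (A \<phi>) \<psi>)"

text \<open>
  The operator \<open>A \<otimes> 1\<close> for \<open>A\<close> on the Fock space over \<open>X\<close>: freeze the occupation numbers of \<open>n\<close>
  outside \<open>X\<close>, let \<open>A\<close> act on the resulting vector of the Fock space over \<open>X\<close>, and take the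
  coefficient at the part of \<open>n\<close> inside \<open>X\<close>.
\<close>

definition ampliation :: "'s set \<Rightarrow> 's oper \<Rightarrow> 's oper" where
  "ampliation X A \<psi> = (\<lambda>n.
     A (\<lambda>m. if m \<in> configs X then \<psi> (\<lambda>x. if x \<in> X then m x else n x) else 0)
       (\<lambda>x. if x \<in> X then n x else 0))"

definition supported_on :: "'s set \<Rightarrow> 's set \<Rightarrow> 's oper \<Rightarrow> bool" where
  "supported_on L X A \<longleftrightarrow> (\<exists>B. bounded_op X B \<and> (\<forall>\<psi>\<in>fock L. A \<psi> = ampliation X B \<psi>))"

text \<open>
  \<open>\<langle>\<psi>|A|\<psi>\<rangle> \<le> c\<close> for a nonnegative diagonal operator \<open>A\<close>, with the understanding that the left-hand
  side is finite; without the first conjunct a divergent sum would count as \<open>0\<close>.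
\<close>

definition expectation_le :: "'s wave \<Rightarrow> 's oper \<Rightarrow> real \<Rightarrow> bool" where
  "expectation_le \<psi> A c \<longleftrightarrow>
     (\<lambda>n. cnj (\<psi> n) * A \<psi> n) summable_on UNIV \<and> Re (fock_inner \<psi> (A \<psi>)) \<le> c"

definition time_integral :: "'s wave \<Rightarrow> 's oper \<Rightarrow> real \<Rightarrow> 's oper \<Rightarrow> complex" where
  "time_integral \<psi> H T A =
     integral {0..T} (\<lambda>t. fock_inner \<psi> (time_evol H (- t) (A (time_evol H t \<psi>))))"

text \<open>For \<open>X = {}\<close> the distance to \<open>X\<close> is infinite, whereas \<open>infdist\<close> is \<open>0\<close> by convention.\<close>

definition nbhd :: "'s::metric_space set \<Rightarrow> 's set \<Rightarrow> real \<Rightarrow> 's set" where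
  "nbhd L X r = {i \<in> L. X \<noteq> {} \<and> infdist i X \<le> r}"

definition decay :: "real \<Rightarrow> 's::metric_space \<Rightarrow> 's \<Rightarrow> real" where
  "decay \<alpha> i j = (if i = j then 1 else dist i j powr (- \<alpha>))"

definition beta :: "nat \<Rightarrow> real \<Rightarrow> nat" where
  "beta D \<alpha> = nat \<lfloor>\<alpha> - 3 * real D - 1\<rfloor>"

locale bose_setup =
  fixes \<alpha> C\<^sub>J C\<^sub>V lam v :: real and X :: "(real ^ 'd) set"
    and L :: "(real ^ 'd) set"
    and J :: "real ^ 'd \<Rightarrow> real ^ 'd \<Rightarrow> complex" and V :: "real ^ 'd \<Rightarrow> real ^ 'd \<Rightarrow> real"
    and A :: "(real ^ 'd) oper" and R :: real and \<psi> :: "(real ^ 'd) wave"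
  assumes L_finite: "finite L"
    and L_lattice: "L \<subseteq> int_lattice"
    and J_hermitian: "\<And>i j. i \<in> L \<Longrightarrow> j \<in> L \<Longrightarrow> J j i = cnj (J i j)"
    and V_symmetric: "\<And>i j. i \<in> L \<Longrightarrow> j \<in> L \<Longrightarrow> V j i = V i j"
    and J_decay: "\<And>i j. i \<in> L \<Longrightarrow> j \<in> L \<Longrightarrow> cmod (J i j) \<le> C\<^sub>J * decay \<alpha> i j"
    and V_decay: "\<And>i j. i \<in> L \<Longrightarrow> j \<in> L \<Longrightarrow> \<bar>V i j\<bar> \<le> C\<^sub>V * decay \<alpha> i j"
    and X_subset: "X \<subseteq> L"
    and A_bounded: "bounded_op L A"
    and A_selfadjoint: "selfadjoint_op L A"
    and A_supported: "supported_on L X A"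
    and A_norm: "op_norm L A \<le> 1"
    and R_ge: "R \<ge> max 2 (diameter X)"
    and psi_fock: "\<psi> \<in> fock L"
    and psi_normalized: "fock_norm \<psi> = 1"
    and C1: "\<And>x r p. x \<in> L \<Longrightarrow> 1 \<le> r \<Longrightarrow> p \<in> {1, 2} \<Longrightarrow>
      expectation_le \<psi> (number_op (L \<inter> cball x r) ^^ p) ((lam * r ^ CARD('d)) ^ p)"
    and C2: "number_op (nbhd L X (2 * R) - X) \<psi> = (\<lambda>_. 0)"
    and v_gt: "v > 2 * (SUP x\<in>L. \<Sum>y\<in>L. cmod (J x y) * dist x y)"

end

theory Submission
  imports Defs "HOL-Real_Asymp.Real_Asymp"
begin

text \<open>
  The initial state is cut off at finitely many particles, so that everything happens in a
  finite-dimensional space with bounds that do not depend on the cutoff. In the interaction picture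
  the error is controlled by the terms of \<open>H\<close> that connect \<open>X\<^sub>R\<close> with its complement, evaluated in the
  state evolved with \<open>H\<close>: the terms inside the complement commute with the truncated Heisenberg
  evolution of \<open>O\<close> and drop out. A density-density term costs only \<open>\<parallel>n\<^sub>i \<psi>\<parallel> \<parallel>n\<^sub>j \<psi>\<parallel>\<close>, because \<open>n\<^sub>j\<close>
  passes through \<open>O\<close>; hence second moments are enough.

  Terms between sites at distance of order \<open>R\<close> are small by the decay of the couplings. For short
  ones, both sites lie near the boundary of \<open>X\<^sub>R\<close>, at distance almost \<open>R\<close> from all initial particles,
  and one needs that few particles arrive there before the time \<open>R / v\<close>. This is shown by monitoring
  the second moment of a weighted particle number with a logistic weight of width \<open>R / ln R\<close> that
  moves with velocity \<open>3 v / 4\<close>. Short hops are dominated by the motion of the weight, since the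
  logistic function satisfies \<open>(f x - f y)\<^sup>2 = f' x f' y (2 sinh ((x - y) / 2))\<^sup>2\<close>. Long hops are
  estimated on the level of amplitudes, against an a priori bound for a weight with polynomial tails.
\<close>

section \<open>Number-conserving operators on finitely many sectors\<close>

text \<open>The exponent \<open>3 * D + 1\<close>, with \<open>D\<close> the dimension, is a count
  of powers of \<open>R\<close>. A site may receive all particles from its surroundings of radius
  \<open>R\<close>, so the norm of its occupation number is only known to be of order
  \<open>R ^ D\<close>. Hops over distances of order \<open>R\<close> have total strength
  \<open>R ^ D * R powr (- \<alpha>)\<close> per site, and they act during a time of order
  \<open>R\<close>, so the amplitude that they carry to the boundary gets one more factor
  \<open>R\<close>. The truncation region has of order \<open>R ^ D\<close> sites. Of the two
  factors \<open>T\<close> in the bound, one comes from the interaction picture and one from the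
  time integral. The obstacle is that bosonic hops are unbounded and that only two moments are known
  initially. The interaction is diagonal in the occupation numbers and therefore real in the balance
  of the probabilities: it creates no flow, so its strength does not enter the velocity. Hops move
  one particle at a time, so the derivative of a second moment is again bounded by second moments
  and the estimates close.\<close>

definition sectors :: "'s set \<Rightarrow> nat \<Rightarrow> 's conf set" where
  "sectors L M = {n \<in> configs L. sum n L < M}"

definition wnum :: "'s set \<Rightarrow> ('s \<Rightarrow> real) \<Rightarrow> 's conf \<Rightarrow> real" where
  "wnum L w n = (\<Sum>i\<in>L. w i * real (n i))"

definition ket :: "'s conf \<Rightarrow> 's wave" where
  "ket m = (\<lambda>n. if n = m then 1 else 0)"

lemma sum_fun_upd:
  assumes "finite S" "i \<in> S"
  shows "sum (f(i := y)) S = y + sum f (S - {i})"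
  using assms by (simp add: sum.remove)

lemma sum_raise:
  assumes "finite L" "i \<in> L"
  shows "sum (m(i := Suc (m i))) L = Suc (sum m L)"
  unfolding sum_fun_upd [OF assms] using assms by (simp add: sum.remove)

lemma wnum_raise:
  assumes "finite L" "i \<in> L"
  shows "wnum L w (m(i := Suc (m i))) = wnum L w m + w i"
proof -
  have "wnum L w n = w i * real (n i) + (\<Sum>k\<in>L - {i}. w k * real (n k))" for n
    unfolding wnum_def using assms by (simp add: sum.remove)
  then show ?thesis by (simp add: algebra_simps)
qed

lemma finite_sectors:
  assumes "finite L"
  shows "finite (sectors L M)"
proof (rule finite_subset)
  let ?B = "(\<lambda>f x. if x \<in> L then f x else 0) ` (PiE L (\<lambda>_. {..M}))"
  show "finite ?B" using assms by (intro finite_imageI finite_PiE) auto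
  show "sectors L M \<subseteq> ?B"
  proof
    fix m assume m: "m \<in> sectors L M"
    have "m x \<le> M" if "x \<in> L" for x
      using member_le_sum [of x L m] that assms m by (auto simp: sectors_def)
    then have "restrict m L \<in> PiE L (\<lambda>_. {..M})" by auto
    moreover have "m = (\<lambda>x. if x \<in> L then restrict m L x else 0)"
      using m by (auto simp: sectors_def configs_def)
    ultimately show "m \<in> ?B" by (rule_tac image_eqI)
  qed
qed

lemma sectors_mono: "M \<le> M' \<Longrightarrow> sectors L M \<subseteq> sectors L M'"
  by (auto simp: sectors_def)

lemma raise_mem:
  assumes "finite L" "i \<in> L"
  shows "m(i := Suc (m i)) \<in> sectors L (Suc M) \<longleftrightarrow> m \<in> sectors L M"
  using assms sum_raise [OF assms, of m] by (auto simp: sectors_def configs_def)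

text \<open>The bound in \<open>sectors\<close> is strict, so raising a site shifts the index by
  exactly one and the vacuum needs no separate case: \<open>sectors L 0\<close> is empty, and the
  vacuum, the one element of \<open>sectors L 1\<close>, has \<open>n i = 0\<close>.\<close>

lemma bij_raise:
  assumes "finite L" "i \<in> L"
  shows "bij_betw (\<lambda>m. m(i := Suc (m i))) (sectors L M) {n \<in> sectors L (Suc M). n i \<noteq> 0}"
proof (rule bij_betwI [where g = "\<lambda>n. n(i := n i - 1)"])
  show "(\<lambda>m. m(i := Suc (m i))) \<in> sectors L M \<rightarrow> {n \<in> sectors L (Suc M). n i \<noteq> 0}"
    using raise_mem [OF assms] by auto
  show "(\<lambda>n. n(i := n i - 1)) \<in> {n \<in> sectors L (Suc M). n i \<noteq> 0} \<rightarrow> sectors L M"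
  proof
    fix n assume n: "n \<in> {n \<in> sectors L (Suc M). n i \<noteq> 0}"
    then have "(n(i := n i - 1))(i := Suc ((n(i := n i - 1)) i)) = n" by auto
    then show "n(i := n i - 1) \<in> sectors L M"
      using n raise_mem [OF assms, of "n(i := n i - 1)" M] by auto
  qed
qed auto

text \<open>Reindexing by the raised configuration moves the square root from \<open>cre\<close> to
  \<open>ann\<close>; terms with \<open>n i = 0\<close> vanish through it. A function
  \<open>G\<close> of the configuration is carried along, shifted accordingly, because it will be a
  squared weighted particle number.\<close>

lemma cre_adjoint:
  assumes "finite L" "i \<in> L"
  shows "(\<Sum>n\<in>sectors L (Suc M). G n * (cnj (\<phi> n) * cre i \<Psi> n))
    = (\<Sum>m\<in>sectors L M. G (m(i := Suc (m i))) * (cnj (ann i \<phi> m) * \<Psi> m))"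
proof -
  have "(\<Sum>n\<in>sectors L (Suc M). G n * (cnj (\<phi> n) * cre i \<Psi> n))
      = (\<Sum>n\<in>{n \<in> sectors L (Suc M). n i \<noteq> 0}. G n * (cnj (\<phi> n) * cre i \<Psi> n))"
    by (rule sum.mono_neutral_right) (auto simp: finite_sectors assms cre_def)
  also have "\<dots> = (\<Sum>m\<in>sectors L M. G (m(i := Suc (m i))) *
      (cnj (\<phi> (m(i := Suc (m i)))) * cre i \<Psi> (m(i := Suc (m i)))))"
    by (rule sum.reindex_bij_betw [OF bij_raise [OF assms], symmetric])
  also have "\<dots> = (\<Sum>m\<in>sectors L M. G (m(i := Suc (m i))) * (cnj (ann i \<phi> m) * \<Psi> m))"
    by (intro sum.cong) (auto simp: ann_def cre_def)
  finally show ?thesis .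
qed

text \<open>The adjoint relation with \<open>\<Psi> = ann i \<phi>\<close>, where
  \<open>cre i (ann i \<phi>)\<close> multiplies by \<open>n i\<close>. It returns estimates over
  configurations with one particle removed to sums over full configurations.\<close>

lemma ann_moment:
  assumes "finite L" "i \<in> L"
  shows "(\<Sum>m\<in>sectors L M. G (m(i := Suc (m i))) * (cmod (ann i \<phi> m))\<^sup>2)
    = (\<Sum>n\<in>sectors L (Suc M). real (n i) * G n * (cmod (\<phi> n))\<^sup>2)"
proof -
  have "complex_of_real (\<Sum>m\<in>sectors L M. G (m(i := Suc (m i))) * (cmod (ann i \<phi> m))\<^sup>2)
      = (\<Sum>m\<in>sectors L M. complex_of_real (G (m(i := Suc (m i)))) * (cnj (ann i \<phi> m) * ann i \<phi> m))"
    by (simp add: complex_norm_square mult.commute del: of_real_power)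
  also have "\<dots> = (\<Sum>n\<in>sectors L (Suc M). complex_of_real (G n) * (cnj (\<phi> n) * cre i (ann i \<phi>) n))"
    by (rule cre_adjoint [OF assms, symmetric])
  also have "\<dots> = complex_of_real (\<Sum>n\<in>sectors L (Suc M). real (n i) * G n * (cmod (\<phi> n))\<^sup>2)"
    by (simp add: cre_ann complex_norm_square mult_ac del: of_real_power)
  finally show ?thesis by (simp only: of_real_eq_iff)
qed

lemma pair_eq:
  "cre i (cre j (ann j (ann i \<psi>))) n = of_nat (n i) * of_nat ((n(i := n i - 1)) j) * \<psi> n"
proof -
  have "cre i (cre j (ann j (ann i \<psi>))) n
      = complex_of_real (sqrt (real (n i))) * (of_nat ((n(i := n i - 1)) j) * ann i \<psi> (n(i := n i - 1)))"
    by (simp only: cre_ann cre_def [of i])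
  also have "\<dots> = of_nat ((n(i := n i - 1)) j) * cre i (ann i \<psi>) n"
    unfolding cre_def [of i] by (simp only: mult.left_commute)
  finally show ?thesis by (simp only: cre_ann mult.assoc mult.left_commute)
qed

text \<open>For \<open>i = j\<close> the last factor is \<open>n i - 1\<close>, whose truncation at \<open>0\<close> is harmless in front of \<open>n i\<close>.\<close>

definition interaction :: "('s \<Rightarrow> 's \<Rightarrow> real) \<Rightarrow> 's set \<Rightarrow> 's conf \<Rightarrow> real" where
  "interaction V S n = 1/2 * (\<Sum>i\<in>S. \<Sum>j\<in>S. V i j * (real (n i) * real ((n(i := n i - 1)) j)))"

text \<open>The interaction is multiplication by a real function of the configuration; this is why
  it will drop out of all probability currents.\<close>

lemma hamiltonian_eq:
  "hamiltonian J V S \<psi> n = (\<Sum>i\<in>S. \<Sum>j\<in>S. J i j * cre i (ann j \<psi>) n)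
    + complex_of_real (interaction V S n) * \<psi> n"
  unfolding hamiltonian_def interaction_def pair_eq
  by (simp add: sum_distrib_right mult.assoc)

lemma hop_mem:
  assumes "finite L" "i \<in> L" "j \<in> L" "m i \<noteq> 0"
  shows "(m(i := m i - 1))(j := Suc ((m(i := m i - 1)) j)) \<in> sectors L (Suc M) \<longleftrightarrow> m \<in> sectors L (Suc M)"
proof -
  have "(m(i := m i - 1))(i := Suc ((m(i := m i - 1)) i)) = m" using assms by auto
  then show ?thesis
    using raise_mem [OF assms(1,3), of "m(i := m i - 1)" M] raise_mem [OF assms(1,2), of "m(i := m i - 1)" M]
    by simp
qed

text \<open>One finite set of configurations for all \<open>S \<subseteq> L\<close>, unlike
  \<open>shell S n\<close>: the full and the truncated evolution have to act on the same space in
  order to be compared.\<close>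

lemma matrix_on_hamiltonian_sectors:
  assumes L: "finite L" and S: "S \<subseteq> L"
  shows "\<exists>h. matrix_on (sectors L (Suc M)) (hamiltonian J V S) h"
proof -
  have hop: "\<exists>h. matrix_on (sectors L (Suc M)) (\<lambda>\<psi>. cre i (ann j \<psi>)) h" if "i \<in> S" "j \<in> S" for i j
  proof (rule matrix_on_single [OF finite_sectors [OF L],
        where c = "\<lambda>m. complex_of_real (sqrt (real (m i)))
                * complex_of_real (sqrt (real ((m(i := m i - 1)) j + 1)))"
          and g = "\<lambda>m. (m(i := m i - 1))(j := Suc ((m(i := m i - 1)) j))"])
    fix m assume "m \<in> sectors L (Suc M)"
      "complex_of_real (sqrt (real (m i))) * complex_of_real (sqrt (real ((m(i := m i - 1)) j + 1))) \<noteq> 0"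
    then show "(m(i := m i - 1))(j := Suc ((m(i := m i - 1)) j)) \<in> sectors L (Suc M)"
      using that S by (subst hop_mem [OF L]) auto
  qed (simp_all add: cre_def ann_def mult.assoc)
  have pair: "\<exists>h. matrix_on (sectors L (Suc M)) (\<lambda>\<psi>. cre i (cre j (ann j (ann i \<psi>)))) h" for i j
    by (rule matrix_on_single [OF finite_sectors [OF L],
        where c = "\<lambda>m. of_nat (m i) * of_nat ((m(i := m i - 1)) j)" and g = "\<lambda>m. m"])
       (auto simp: pair_eq)
  show ?thesis
    unfolding hamiltonian_def
    by (intro matrix_on_add matrix_on_sum matrix_on_scale hop pair)
qed

section \<open>Operators that commute with the Hamiltonian of a region\<close>

lemma ann_commute: "ann i (ann j \<phi>) = ann j (ann i \<phi>)"
  by (cases "i = j") (auto simp: ann_def fun_eq_iff fun_upd_twist mult.left_commute)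

lemma cre_commute: "cre i (cre j \<phi>) = cre j (cre i \<phi>)"
  by (cases "i = j") (auto simp: cre_def fun_eq_iff fun_upd_twist mult.left_commute)

lemma ann_cre_commute: "i \<noteq> j \<Longrightarrow> ann i (cre j \<phi>) = cre j (ann i \<phi>)"
  by (auto simp: cre_def ann_def fun_eq_iff fun_upd_twist mult.left_commute)

text \<open>Linearity is relative to a domain \<open>P\<close> because a bounded observable is
  linear on the Fock space only, whereas operators built from \<open>ann\<close> and
  \<open>cre\<close> are linear on all coefficient families.\<close>

definition linear_on :: "('s wave \<Rightarrow> bool) \<Rightarrow> 's oper \<Rightarrow> bool" where
  "linear_on P Z \<longleftrightarrow>
    (\<forall>\<phi> \<psi>. P \<phi> \<longrightarrow> P \<psi> \<longrightarrow> Z (\<lambda>n. \<phi> n + \<psi> n) = (\<lambda>n. Z \<phi> n + Z \<psi> n)) \<and>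
    (\<forall>c \<phi>. P \<phi> \<longrightarrow> Z (\<lambda>n. c * \<phi> n) = (\<lambda>n. c * Z \<phi> n))"

lemma linear_on_add: "linear_on P Z \<Longrightarrow> P \<phi> \<Longrightarrow> P \<psi> \<Longrightarrow> Z (\<lambda>n. \<phi> n + \<psi> n) = (\<lambda>n. Z \<phi> n + Z \<psi> n)"
  and linear_on_scale: "linear_on P Z \<Longrightarrow> P \<phi> \<Longrightarrow> Z (\<lambda>n. c * \<phi> n) = (\<lambda>n. c * Z \<phi> n)"
  by (auto simp: linear_on_def)

lemma linear_on_zero: "linear_on P Z \<Longrightarrow> P \<phi> \<Longrightarrow> Z (\<lambda>n. 0) = (\<lambda>n. 0)"
  using linear_on_scale [of P Z \<phi> 0] by simp

locale wave_space =
  fixes P :: "'s wave \<Rightarrow> bool"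
  assumes zero: "P (\<lambda>n. 0)"
    and add: "P \<phi> \<Longrightarrow> P \<psi> \<Longrightarrow> P (\<lambda>n. \<phi> n + \<psi> n)"
    and scale: "P \<phi> \<Longrightarrow> P (\<lambda>n. c * \<phi> n)"
begin

lemma sum: "(\<And>i. i \<in> I \<Longrightarrow> P (f i)) \<Longrightarrow> P (\<lambda>n. \<Sum>i\<in>I. f i n)"
  by (induction I rule: infinite_finite_induct) (auto intro: zero add)

lemma linear_on_sum:
  assumes "linear_on P Z" "\<And>i. i \<in> I \<Longrightarrow> P (f i)"
  shows "Z (\<lambda>n. \<Sum>i\<in>I. f i n) = (\<lambda>n. \<Sum>i\<in>I. Z (f i) n)"
  using assms(2)
proof (induction I rule: infinite_finite_induct)
  case (insert x I)
  then have "Z (\<lambda>n. f x n + (\<Sum>i\<in>I. f i n)) = (\<lambda>n. Z (f x) n + (\<Sum>i\<in>I. Z (f i) n))"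
    by (subst linear_on_add [OF assms(1)]) (auto intro: sum)
  with insert show ?case by simp
qed (use linear_on_zero [OF assms(1) zero] in auto)

lemma linear_on_sum2:
  assumes Z: "linear_on P Z" and f: "\<And>i j. i \<in> S \<Longrightarrow> j \<in> S \<Longrightarrow> P (f i j)"
  shows "Z (\<lambda>n. \<Sum>i\<in>S. \<Sum>j\<in>S. c i j * f i j n) = (\<lambda>n. \<Sum>i\<in>S. \<Sum>j\<in>S. c i j * Z (f i j) n)"
proof -
  have "Z (\<lambda>n. \<Sum>j\<in>S. c i j * f i j n) = (\<lambda>n. \<Sum>j\<in>S. c i j * Z (f i j) n)" if "i \<in> S" for i
    using that f by (subst linear_on_sum [OF Z]) (auto intro: scale simp: linear_on_scale [OF Z])
  then show ?thesis
    using f by (subst linear_on_sum [OF Z]) (auto intro!: sum scale)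
qed

text \<open>Every term of the Hamiltonian is a word in \<open>ann\<close> and \<open>cre\<close> at
  sites of \<open>S\<close>, so it is enough to pass \<open>Z\<close> through one letter at a time,
  on a domain invariant under the letters. This serves for operators at sites outside
  \<open>S\<close>, for Hamiltonians of disjoint regions and for the observable.\<close>

lemma commute_hamiltonian:
  assumes Z: "linear_on P Z" and \<phi>: "P \<phi>"
    and P: "\<And>k \<psi>. k \<in> S \<Longrightarrow> P \<psi> \<Longrightarrow> P (ann k \<psi>)" "\<And>k \<psi>. k \<in> S \<Longrightarrow> P \<psi> \<Longrightarrow> P (cre k \<psi>)"
    and c: "\<And>k \<psi>. k \<in> S \<Longrightarrow> P \<psi> \<Longrightarrow> Z (ann k \<psi>) = ann k (Z \<psi>)"
      "\<And>k \<psi>. k \<in> S \<Longrightarrow> P \<psi> \<Longrightarrow> Z (cre k \<psi>) = cre k (Z \<psi>)"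
  shows "Z (hamiltonian J V S \<phi>) = hamiltonian J V S (Z \<phi>)"
proof -
  have 1: "P (\<lambda>n. \<Sum>i\<in>S. \<Sum>j\<in>S. J i j * cre i (ann j \<phi>) n)"
    and 2: "P (\<lambda>n. \<Sum>i\<in>S. \<Sum>j\<in>S. complex_of_real (V i j) * cre i (cre j (ann j (ann i \<phi>))) n)"
    by (rule sum, rule sum, rule scale, (rule P \<phi> | assumption)+)+
  have 3: "Z (\<lambda>n. \<Sum>i\<in>S. \<Sum>j\<in>S. J i j * cre i (ann j \<phi>) n)
      = (\<lambda>n. \<Sum>i\<in>S. \<Sum>j\<in>S. J i j * cre i (ann j (Z \<phi>)) n)"
    by (subst linear_on_sum2 [OF Z]) (auto simp: P c \<phi> intro!: ext sum.cong)
  have 4: "Z (\<lambda>n. \<Sum>i\<in>S. \<Sum>j\<in>S. complex_of_real (V i j) * cre i (cre j (ann j (ann i \<phi>))) n)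
      = (\<lambda>n. \<Sum>i\<in>S. \<Sum>j\<in>S. complex_of_real (V i j) * cre i (cre j (ann j (ann i (Z \<phi>)))) n)"
    by (subst linear_on_sum2 [OF Z]) (auto simp: P c \<phi> intro!: ext sum.cong)
  have "Z (hamiltonian J V S \<phi>) = (\<lambda>n. Z (\<lambda>n. \<Sum>i\<in>S. \<Sum>j\<in>S. J i j * cre i (ann j \<phi>) n) n
      + Z (\<lambda>n. 1/2 * (\<Sum>i\<in>S. \<Sum>j\<in>S. complex_of_real (V i j) * cre i (cre j (ann j (ann i \<phi>))) n)) n)"
    unfolding hamiltonian_def by (rule linear_on_add [OF Z, OF 1 scale [OF 2]])
  then show ?thesis
    unfolding linear_on_scale [OF Z, OF 2] 3 4 hamiltonian_def [of J V S "Z \<phi>"] .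
qed

end

lemma wave_space_True: "wave_space (\<lambda>_. True)"
  by unfold_locales auto

lemma linear_on_ann: "linear_on P (ann k)"
  by (auto simp: linear_on_def ann_def algebra_simps)

lemma linear_on_cre: "linear_on P (cre k)"
  by (auto simp: linear_on_def cre_def algebra_simps)

lemma linear_on_mult: "linear_on P (\<lambda>\<phi> n. f n * \<phi> n)"
  by (auto simp: linear_on_def algebra_simps)

lemma linear_on_hamiltonian: "linear_on P (hamiltonian J V S)"
  unfolding linear_on_def
  by (auto simp: hamiltonian_eq fun_eq_iff linear_on_add [OF linear_on_ann, of "\<lambda>_. True"]
      linear_on_add [OF linear_on_cre, of "\<lambda>_. True"] linear_on_scale [OF linear_on_ann, of "\<lambda>_. True"]
      linear_on_scale [OF linear_on_cre, of "\<lambda>_. True"] distrib_left sum.distrib sum_distrib_left mult.left_commute)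

lemma hamiltonian_commute_ann:
  "k \<notin> S \<Longrightarrow> ann k (hamiltonian J V S \<phi>) = hamiltonian J V S (ann k \<phi>)"
  by (rule wave_space.commute_hamiltonian [OF wave_space_True linear_on_ann])
     (auto simp: ann_commute intro!: ann_cre_commute)

lemma hamiltonian_commute_cre:
  "k \<notin> S \<Longrightarrow> cre k (hamiltonian J V S \<phi>) = hamiltonian J V S (cre k \<phi>)"
  by (rule wave_space.commute_hamiltonian [OF wave_space_True linear_on_cre])
     (auto simp: cre_commute intro!: ann_cre_commute [symmetric])

lemma hamiltonian_commute_disjoint:
  "S \<inter> S' = {} \<Longrightarrow> hamiltonian J V S (hamiltonian J' V' S' \<phi>) = hamiltonian J' V' S' (hamiltonian J V S \<phi>)"
  by (rule wave_space.commute_hamiltonian [OF wave_space_True linear_on_hamiltonian])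
     (auto intro!: hamiltonian_commute_ann [symmetric] hamiltonian_commute_cre [symmetric])

lemma hamiltonian_commute_number:
  "k \<notin> S \<Longrightarrow> (\<lambda>n. of_nat (n k) * hamiltonian J V S \<phi> n) = hamiltonian J V S (\<lambda>n. of_nat (n k) * \<phi> n)"
  by (rule wave_space.commute_hamiltonian [OF wave_space_True linear_on_mult [of _ "\<lambda>n. of_nat (n k)"]])
     (auto simp: ann_def cre_def fun_eq_iff)

text \<open>Once \<open>cre i\<close> is moved to the left factor, the hopping becomes the
  sesquilinear form \<open>c\<close>, and hermiticity of \<open>J\<close> amounts to exchanging the
  two summation indices; the interaction is symmetric because it is real.\<close>

lemma hamiltonian_hermitian:
  assumes L: "finite L" and S: "S \<subseteq> L"
    and J: "\<And>i j. i \<in> L \<Longrightarrow> j \<in> L \<Longrightarrow> J j i = cnj (J i j)"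
  shows "(\<Sum>n\<in>sectors L (Suc M). cnj (\<phi> n) * hamiltonian J V S \<psi> n)
    = (\<Sum>n\<in>sectors L (Suc M). cnj (hamiltonian J V S \<phi> n) * \<psi> n)"
proof -
  let ?F = "sectors L (Suc M)" and ?G = "sectors L M"
  define c where "c f g i j = (\<Sum>m\<in>?G. cnj (ann i f m) * ann j g m)" for f g i j
  have hop: "(\<Sum>n\<in>?F. cnj (f n) * cre i (ann j g) n) = c f g i j" if "i \<in> S" "j \<in> S" for i j f g
    using cre_adjoint [OF L, of i "\<lambda>_. 1" f "ann j g" M] that S unfolding c_def by auto
  have e: "(\<Sum>n\<in>?F. cnj (f n) * hamiltonian J V S g n)
      = (\<Sum>i\<in>S. \<Sum>j\<in>S. J i j * c f g i j) + (\<Sum>n\<in>?F. complex_of_real (interaction V S n) * (cnj (f n) * g n))"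
    for f g
  proof -
    have "(\<Sum>n\<in>?F. cnj (f n) * (\<Sum>i\<in>S. \<Sum>j\<in>S. J i j * cre i (ann j g) n))
        = (\<Sum>i\<in>S. \<Sum>j\<in>S. J i j * (\<Sum>n\<in>?F. cnj (f n) * cre i (ann j g) n))"
      by (simp add: sum_distrib_left sum.swap [of _ _ ?F] mult.left_commute)
    also have "\<dots> = (\<Sum>i\<in>S. \<Sum>j\<in>S. J i j * c f g i j)"
      by (simp add: hop)
    finally show ?thesis
      by (simp add: hamiltonian_eq distrib_left sum.distrib mult.left_commute)
  qed
  have "(\<Sum>n\<in>?F. cnj (hamiltonian J V S \<phi> n) * \<psi> n) = cnj (\<Sum>n\<in>?F. cnj (\<psi> n) * hamiltonian J V S \<phi> n)"
    by (simp add: mult.commute)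
  also have "\<dots> = (\<Sum>i\<in>S. \<Sum>j\<in>S. cnj (J i j) * cnj (c \<psi> \<phi> i j))
      + (\<Sum>n\<in>?F. complex_of_real (interaction V S n) * (cnj (\<phi> n) * \<psi> n))"
    unfolding e by (simp add: mult_ac)
  also have "(\<Sum>i\<in>S. \<Sum>j\<in>S. cnj (J i j) * cnj (c \<psi> \<phi> i j)) = (\<Sum>i\<in>S. \<Sum>j\<in>S. J j i * c \<phi> \<psi> j i)"
  proof (intro sum.cong refl)
    fix i j assume "i \<in> S" "j \<in> S"
    then have "cnj (J i j) = J j i" using S by (intro J [symmetric]) auto
    then show "cnj (J i j) * cnj (c \<psi> \<phi> i j) = J j i * c \<phi> \<psi> j i"
      by (simp add: c_def mult.commute)
  qed
  also have "\<dots> = (\<Sum>i\<in>S. \<Sum>j\<in>S. J i j * c \<phi> \<psi> i j)" by (rule sum.swap)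
  finally show ?thesis unfolding e by simp
qed

lemma hamiltonian_support:
  assumes L: "finite L" and S: "S \<subseteq> L" and \<psi>: "\<And>n. n \<notin> sectors L (Suc M) \<Longrightarrow> \<psi> n = 0"
    and n: "n \<notin> sectors L (Suc M)"
  shows "hamiltonian J V S \<psi> n = 0"
proof -
  have "cre i (ann j \<psi>) n = 0" if "i \<in> S" "j \<in> S" for i j
  proof (cases "n i = 0")
    case False
    then have "(n(i := n i - 1))(j := Suc ((n(i := n i - 1)) j)) \<notin> sectors L (Suc M)"
      using n that S by (subst hop_mem [OF L]) auto
    then have "\<psi> ((n(i := n i - 1))(j := Suc ((n(i := n i - 1)) j))) = 0" by (rule \<psi>)
    then show ?thesis by (simp add: cre_def ann_def)
  qed (simp add: cre_def)
  then show ?thesis by (simp add: hamiltonian_eq \<psi> [OF n])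
qed

section \<open>Unitary time evolution\<close>

text \<open>Only the coefficients on \<open>F\<close> enter, so \<open>nrm F\<close> is a seminorm
  on all coefficient families and operators may produce values outside \<open>F\<close> without
  being cut off.\<close>

definition inn :: "'s conf set \<Rightarrow> 's wave \<Rightarrow> 's wave \<Rightarrow> complex" where
  "inn F \<phi> \<psi> = (\<Sum>n\<in>F. cnj (\<phi> n) * \<psi> n)"

definition nrm :: "'s conf set \<Rightarrow> 's wave \<Rightarrow> real" where
  "nrm F \<psi> = L2_set (\<lambda>n. cmod (\<psi> n)) F"

lemma nrm_nonneg: "0 \<le> nrm F \<psi>"
  by (simp add: nrm_def L2_set_nonneg)

lemma nrm_square: "(nrm F \<psi>)\<^sup>2 = (\<Sum>n\<in>F. (cmod (\<psi> n))\<^sup>2)"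
  unfolding nrm_def L2_set_def by (intro real_sqrt_pow2 sum_nonneg) auto

lemma inn_self: "inn F \<psi> \<psi> = complex_of_real ((nrm F \<psi>)\<^sup>2)"
  unfolding nrm_square inn_def by (simp add: complex_norm_square mult.commute del: of_real_power)

lemma inn_bound: "cmod (inn F \<phi> \<psi>) \<le> nrm F \<phi> * nrm F \<psi>"
proof -
  have "cmod (inn F \<phi> \<psi>) \<le> (\<Sum>n\<in>F. \<bar>cmod (\<phi> n)\<bar> * \<bar>cmod (\<psi> n)\<bar>)"
    unfolding inn_def by (rule order_trans [OF norm_sum]) (simp add: norm_mult)
  also have "\<dots> \<le> nrm F \<phi> * nrm F \<psi>"
    unfolding nrm_def by (rule L2_set_mult_ineq)
  finally show ?thesis .
qed

lemma inn_commute: "cnj (inn F \<phi> \<psi>) = inn F \<psi> \<phi>"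
  by (simp add: inn_def mult.commute)

lemma nrm_mono:
  assumes "\<And>n. n \<in> F \<Longrightarrow> cmod (\<phi> n) \<le> cmod (\<psi> n)"
  shows "nrm F \<phi> \<le> nrm F \<psi>"
  unfolding nrm_def by (rule L2_set_mono) (use assms in auto)

lemma nrm_add: "nrm F (\<lambda>n. \<phi> n + \<psi> n) \<le> nrm F \<phi> + nrm F \<psi>"
proof -
  have "nrm F (\<lambda>n. \<phi> n + \<psi> n) \<le> L2_set (\<lambda>n. cmod (\<phi> n) + cmod (\<psi> n)) F"
    unfolding nrm_def by (rule L2_set_mono) (auto intro: norm_triangle_ineq)
  also have "\<dots> \<le> nrm F \<phi> + nrm F \<psi>"
    unfolding nrm_def by (rule L2_set_triangle_ineq)
  finally show ?thesis .
qed

lemma nrm_sum: "nrm F (\<lambda>n. \<Sum>i\<in>I. f i n) \<le> (\<Sum>i\<in>I. nrm F (f i))"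
proof (induction I rule: infinite_finite_induct)
  case (insert x I)
  then show ?case using nrm_add [of F "f x" "\<lambda>n. \<Sum>i\<in>I. f i n"] by simp
qed (auto simp: nrm_def L2_set_def)

lemma nrm_scale: "nrm F (\<lambda>n. c * \<phi> n) = cmod c * nrm F \<phi>"
  unfolding nrm_def by (simp add: norm_mult L2_set_right_distrib)

lemma nrm_cong: "(\<And>n. n \<in> F \<Longrightarrow> \<phi> n = \<psi> n) \<Longrightarrow> nrm F \<phi> = nrm F \<psi>"
  unfolding nrm_def by (rule L2_set_cong) auto

lemma inn_cong: "(\<And>n. n \<in> F \<Longrightarrow> \<phi> n = \<phi>' n) \<Longrightarrow> (\<And>n. n \<in> F \<Longrightarrow> \<psi> n = \<psi>' n) \<Longrightarrow> inn F \<phi> \<psi> = inn F \<phi>' \<psi>'"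
  unfolding inn_def by (rule sum.cong) auto

lemma matrix_on_ket:
  assumes "finite F" "matrix_on F A h" "n \<in> F"
  shows "A \<psi> n = (\<Sum>m\<in>F. A (ket m) n * \<psi> m)"
proof -
  have "A (ket m) n = h n m" if "m \<in> F" for m
    using assms that unfolding matrix_on_def by (simp add: ket_def mult_delta_right)
  then show ?thesis using assms by (simp add: matrix_on_def)
qed

lemma matrix_on_power:
  assumes "finite F" "matrix_on F H h"
  shows "\<exists>g. matrix_on F (H ^^ k) g"
proof (induction k)
  case 0
  have "matrix_on F (\<lambda>\<psi>. \<psi>) (\<lambda>n m. if m = n then 1 else 0)"
    using assms(1) by (simp add: matrix_on_def mult_delta_left)
  then show ?case by (auto simp: id_def)
next
  case (Suc k)
  then obtain g where g: "matrix_on F (H ^^ k) g" by blast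
  have "matrix_on F (H ^^ Suc k) (\<lambda>n m. \<Sum>l\<in>F. h n l * g l m)"
    unfolding matrix_on_def
  proof (intro allI ballI)
    fix \<psi> n assume "n \<in> F"
    then have "(H ^^ Suc k) \<psi> n = (\<Sum>l\<in>F. h n l * (\<Sum>m\<in>F. g l m * \<psi> m))"
      using assms(2) g by (simp add: matrix_on_def)
    also have "\<dots> = (\<Sum>m\<in>F. (\<Sum>l\<in>F. h n l * g l m) * \<psi> m)"
      by (simp add: sum_distrib_left sum_distrib_right mult.assoc) (rule sum.swap)
    finally show "(H ^^ Suc k) \<psi> n = (\<Sum>m\<in>F. (\<Sum>l\<in>F. h n l * g l m) * \<psi> m)" .
  qed
  then show ?case by blast
qed

text \<open>The evolved kets are the matrix of the propagator. Through it, the time derivative of an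
  evolution applied to a time-dependent wave becomes the product rule in a finite sum.\<close>

lemma time_evol_ket:
  assumes F: "finite F" and h: "matrix_on F H h" and n: "n \<in> F"
  shows "time_evol H t \<psi> n = (\<Sum>m\<in>F. time_evol H t (ket m) n * \<psi> m)"
proof -
  define c where "c k = (- \<i> * complex_of_real t) ^ k / fact k" for k
  have s: "summable (\<lambda>k. c k * (H ^^ k) (ket m) n)" for m
    unfolding c_def by (rule matrix_exp_summable [OF F h n])
  have "(H ^^ k) \<psi> n = (\<Sum>m\<in>F. (H ^^ k) (ket m) n * \<psi> m)" for k
    using matrix_on_power [OF F h, of k] matrix_on_ket [OF F _ n] by blast
  then have "time_evol H t \<psi> n = (\<Sum>k. \<Sum>m\<in>F. c k * (H ^^ k) (ket m) n * \<psi> m)"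
    unfolding time_evol_def c_def by (simp add: sum_distrib_left mult.assoc)
  also have "\<dots> = (\<Sum>m\<in>F. \<Sum>k. c k * (H ^^ k) (ket m) n * \<psi> m)"
    by (rule suminf_sum) (intro summable_mult2 s)
  also have "\<dots> = (\<Sum>m\<in>F. time_evol H t (ket m) n * \<psi> m)"
    unfolding time_evol_def c_def [symmetric]
    by (intro sum.cong refl suminf_mult2 [symmetric] s)
  finally show ?thesis .
qed

lemma time_evol_commute:
  assumes F: "finite F" and h: "matrix_on F H h" and Z: "matrix_on F Z z" and n: "n \<in> F"
    and c: "\<And>\<psi>. Z (H \<psi>) = H (Z \<psi>)"
  shows "Z (time_evol H t \<phi>) n = time_evol H t (Z \<phi>) n"
proof -
  define c where "c k = (- \<i> * complex_of_real t) ^ k / fact k" for k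
  have s: "summable (\<lambda>k. c k * (H ^^ k) \<phi> m)" if "m \<in> F" for m
    unfolding c_def by (rule matrix_exp_summable [OF F h that])
  have ck: "Z ((H ^^ k) \<phi>) = (H ^^ k) (Z \<phi>)" for k
    by (induction k) (auto simp: c)
  have "Z (time_evol H t \<phi>) n = (\<Sum>m\<in>F. z n m * (\<Sum>k. c k * (H ^^ k) \<phi> m))"
    using Z n by (simp add: matrix_on_def time_evol_def c_def)
  also have "\<dots> = (\<Sum>m\<in>F. \<Sum>k. z n m * (c k * (H ^^ k) \<phi> m))"
    using s by (simp add: suminf_mult)
  also have "\<dots> = (\<Sum>k. \<Sum>m\<in>F. z n m * (c k * (H ^^ k) \<phi> m))"
    by (rule suminf_sum [symmetric]) (intro summable_mult s)
  also have "\<dots> = (\<Sum>k. c k * Z ((H ^^ k) \<phi>) n)"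
    using Z n by (simp add: matrix_on_def sum_distrib_left mult.left_commute)
  finally show ?thesis by (simp add: ck time_evol_def c_def)
qed

lemma time_evol_vanish:
  assumes "\<And>k. (H ^^ k) \<psi> n = 0"
  shows "time_evol H t \<psi> n = 0"
  using assms by (simp add: time_evol_def)

locale hermitian_hopping =
  fixes L :: "'s set" and J :: "'s \<Rightarrow> 's \<Rightarrow> complex"
  assumes L: "finite L" and J: "\<And>i j. i \<in> L \<Longrightarrow> j \<in> L \<Longrightarrow> J j i = cnj (J i j)"
begin

abbreviation F :: "nat \<Rightarrow> 's conf set" where "F M \<equiv> sectors L (Suc M)"

lemma finite_F: "finite (F M)"
  by (rule finite_sectors [OF L])

context
  fixes V :: "'s \<Rightarrow> 's \<Rightarrow> real" and S :: "'s set"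
  assumes S: "S \<subseteq> L"
begin

lemma finite_S: "finite S"
  using S L finite_subset by blast

lemma evol_ket:
  "n \<in> F M \<Longrightarrow> time_evol (hamiltonian J V S) t \<psi> n = (\<Sum>m\<in>F M. time_evol (hamiltonian J V S) t (ket m) n * \<psi> m)"
  using matrix_on_hamiltonian_sectors [OF L S, of M J V] time_evol_ket [OF finite_F] by blast

lemma evol_commute:
  assumes "matrix_on (F M) Z z" "n \<in> F M"
    and "\<And>\<psi>. Z (hamiltonian J V S \<psi>) = hamiltonian J V S (Z \<psi>)"
  shows "Z (time_evol (hamiltonian J V S) t \<phi>) n = time_evol (hamiltonian J V S) t (Z \<phi>) n"
proof -
  obtain h where "matrix_on (F M) (hamiltonian J V S) h"
    using matrix_on_hamiltonian_sectors [OF L S] by blast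
  then show ?thesis by (rule time_evol_commute [OF finite_F _ assms(1,2)]) (rule assms(3))
qed

lemma evol_support:
  assumes "\<And>n. n \<notin> F M \<Longrightarrow> \<psi> n = 0" and n: "n \<notin> F M"
  shows "time_evol (hamiltonian J V S) t \<psi> n = 0"
proof (rule time_evol_vanish)
  fix k
  have "(hamiltonian J V S ^^ k) \<psi> n = 0" if "n \<notin> F M" for n k
    using that by (induction k arbitrary: n) (auto simp: assms intro: hamiltonian_support [OF L S])
  then show "(hamiltonian J V S ^^ k) \<psi> n = 0" using n .
qed

lemma evol_configs:
  assumes "\<And>n. n \<notin> configs L \<Longrightarrow> \<psi> n = 0" and n: "n \<notin> configs L"
  shows "time_evol (hamiltonian J V S) t \<psi> n = 0"
proof (rule time_evol_vanish)
  fix k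
  have "hamiltonian J V S \<phi> n = 0" if \<phi>: "\<And>n. n \<notin> configs L \<Longrightarrow> \<phi> n = 0" and n: "n \<notin> configs L" for \<phi> n
  proof -
    obtain x where "x \<notin> L" "n x \<noteq> 0" using n by (auto simp: configs_def)
    then have "(n(i := y))(j := z) \<notin> configs L" if "i \<in> S" "j \<in> S" for i j y z
      using that S by (auto simp: configs_def intro!: exI [of _ x])
    then have "cre i (ann j \<phi>) n = 0" if "i \<in> S" "j \<in> S" for i j
      using that \<phi> by (simp add: cre_def ann_def)
    then show ?thesis using \<phi> [OF n] by (simp add: hamiltonian_eq)
  qed
  then have "(hamiltonian J V S ^^ k) \<psi> n = 0" if "n \<notin> configs L" for n k
    using that by (induction k arbitrary: n) (auto simp: assms)
  then show "(hamiltonian J V S ^^ k) \<psi> n = 0" using n .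
qed

lemma inn_hamiltonian:
  "inn (F M) \<phi> (hamiltonian J V S \<psi>) = inn (F M) (hamiltonian J V S \<phi>) \<psi>"
  unfolding inn_def by (rule hamiltonian_hermitian [OF L S J])

text \<open>The left-hand side has derivative \<open>0\<close> in \<open>s\<close>, since the
  Hamiltonian is hermitian on the sectors, and the right-hand side is its value at
  \<open>s = 0\<close>. The choices \<open>s = t\<close> and \<open>t = 0\<close> give adjointness
  and unitarity.\<close>

lemma evol_adjoint_aux:
  "inn (F M) (time_evol (hamiltonian J V S) s \<phi>) (time_evol (hamiltonian J V S) (s - t) \<xi>)
    = inn (F M) \<phi> (time_evol (hamiltonian J V S) (- t) \<xi>)"
proof -
  let ?H = "hamiltonian J V S"
  define g where "g s = inn (F M) (time_evol ?H s \<phi>) (time_evol ?H (s - t) \<xi>)" for s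
  have "(g has_vector_derivative 0) (at s within UNIV)" for s
  proof -
    have 1: "((\<lambda>s. time_evol ?H s \<phi> n) has_vector_derivative - \<i> * ?H (time_evol ?H s \<phi>) n) (at s)" for n
      by (rule schroedinger_equation [OF finite_S])
    have 2: "((\<lambda>s. time_evol ?H (s - t) \<xi> n) has_vector_derivative - \<i> * ?H (time_evol ?H (s - t) \<xi>) n) (at s)" for n
      using vector_diff_chain_at [of "\<lambda>s. s - t" 1 s "\<lambda>s. time_evol ?H s \<xi> n",
          OF _ schroedinger_equation [OF finite_S]]
      by (simp add: o_def has_vector_derivative_diff_const has_vector_derivative_id)
    have "(g has_vector_derivative (\<Sum>n\<in>F M. cnj (time_evol ?H s \<phi> n) * (- \<i> * ?H (time_evol ?H (s - t) \<xi>) n)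
        + cnj (- \<i> * ?H (time_evol ?H s \<phi>) n) * time_evol ?H (s - t) \<xi> n)) (at s)"
      unfolding g_def inn_def
      by (intro has_vector_derivative_sum has_vector_derivative_mult has_vector_derivative_cnj 1 2)
    also have "(\<Sum>n\<in>F M. cnj (time_evol ?H s \<phi> n) * (- \<i> * ?H (time_evol ?H (s - t) \<xi>) n)
        + cnj (- \<i> * ?H (time_evol ?H s \<phi>) n) * time_evol ?H (s - t) \<xi> n)
        = - \<i> * inn (F M) (time_evol ?H s \<phi>) (?H (time_evol ?H (s - t) \<xi>))
          + \<i> * inn (F M) (?H (time_evol ?H s \<phi>)) (time_evol ?H (s - t) \<xi>)"
      unfolding inn_def by (simp add: sum.distrib sum_distrib_left mult_ac sum_subtractf sum_negf)
    finally show ?thesis by (simp add: inn_hamiltonian)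
  qed
  then obtain c where "\<And>s. g s = c"
    using has_vector_derivative_zero_constant [OF convex_UNIV, of g] by auto
  then have "g s = g 0" by simp
  then show ?thesis by (simp add: g_def time_evol_0)
qed

lemma evol_adjoint:
  "inn (F M) \<phi> (time_evol (hamiltonian J V S) (- t) \<xi>) = inn (F M) (time_evol (hamiltonian J V S) t \<phi>) \<xi>"
  using evol_adjoint_aux [of M t \<phi> t \<xi>] by (simp add: time_evol_0)

lemma evol_unitary:
  "inn (F M) (time_evol (hamiltonian J V S) t \<phi>) (time_evol (hamiltonian J V S) t \<xi>) = inn (F M) \<phi> \<xi>"
  using evol_adjoint_aux [of M t \<phi> 0 \<xi>] by (simp add: time_evol_0)

lemma evol_nrm: "nrm (F M) (time_evol (hamiltonian J V S) t \<phi>) = nrm (F M) \<phi>"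
  using evol_unitary [of M t \<phi> \<phi>] unfolding inn_self of_real_eq_iff
  by (simp add: nrm_nonneg)

text \<open>Duhamel's formula: differentiating the outer evolution produces the Hamiltonian of
  \<open>S\<close> in front, which commutes with its own evolution, so that only the difference of
  the two Hamiltonians remains in the middle.\<close>

lemma interaction_deriv:
  fixes \<psi> :: "'s wave" and t :: real
  assumes "n \<in> F M"
  shows "((\<lambda>s. time_evol (hamiltonian J V S) (t - s) (time_evol (hamiltonian J V' L) s \<psi>) n) has_vector_derivative
    - \<i> * time_evol (hamiltonian J V S) (t - s) (\<lambda>m. hamiltonian J V' L (time_evol (hamiltonian J V' L) s \<psi>) m
      - hamiltonian J V S (time_evol (hamiltonian J V' L) s \<psi>) m) n) (at s)"
proof -
  let ?R = "hamiltonian J V S" and ?H = "hamiltonian J V' L"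
  let ?UR = "time_evol ?R" and ?\<psi> = "time_evol ?H s \<psi>"
  have R: "?R \<phi> k = (\<Sum>m\<in>F M. ?R (ket m) k * \<phi> m)" if "k \<in> F M" for k \<phi>
    using matrix_on_hamiltonian_sectors [OF L S, of M J V] matrix_on_ket [OF finite_F _ that] by blast
  have 1: "((\<lambda>s. time_evol ?H s \<psi> m) has_vector_derivative - \<i> * ?H ?\<psi> m) (at s)" for m
    by (rule schroedinger_equation [OF L])
  have 2: "((\<lambda>s. ?UR (t - s) \<phi> n) has_vector_derivative \<i> * ?R (?UR (t - s) \<phi>) n) (at s)" for \<phi>
    using vector_diff_chain_at [of "\<lambda>s. t - s" "-1" s "\<lambda>s. ?UR s \<phi> n",
        OF _ schroedinger_equation [OF finite_S]] has_vector_derivative_diff [OF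
          has_vector_derivative_const [of t] has_vector_derivative_id [of "at s"]]
    by (simp add: o_def)
  have 3: "?R (?UR (t - s) \<phi>) n = ?UR (t - s) (?R \<phi>) n" for \<phi>
  proof -
    obtain h where "matrix_on (F M) ?R h"
      using matrix_on_hamiltonian_sectors [OF L S] by blast
    then show ?thesis by (rule evol_commute [OF _ assms]) (rule refl)
  qed
  have "((\<lambda>s. \<Sum>m\<in>F M. ?UR (t - s) (ket m) n * time_evol ?H s \<psi> m) has_vector_derivative
      (\<Sum>m\<in>F M. ?UR (t - s) (ket m) n * (- \<i> * ?H ?\<psi> m) + \<i> * ?R (?UR (t - s) (ket m)) n * ?\<psi> m)) (at s)"
    by (rule has_vector_derivative_sum, rule has_vector_derivative_mult, rule 2, rule 1)
  also have "(\<lambda>s. \<Sum>m\<in>F M. ?UR (t - s) (ket m) n * time_evol ?H s \<psi> m)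
      = (\<lambda>s. ?UR (t - s) (time_evol ?H s \<psi>) n)"
    by (rule ext) (rule evol_ket [OF assms, symmetric])
  also have "(\<Sum>m\<in>F M. ?UR (t - s) (ket m) n * (- \<i> * ?H ?\<psi> m) + \<i> * ?R (?UR (t - s) (ket m)) n * ?\<psi> m)
      = - \<i> * ?UR (t - s) (\<lambda>m. ?H ?\<psi> m - ?R ?\<psi> m) n"
  proof -
    have "?UR (t - s) (?R (ket m)) n = (\<Sum>k\<in>F M. ?UR (t - s) (ket k) n * ?R (ket m) k)" for m
      by (rule evol_ket [OF assms])
    then have "(\<Sum>m\<in>F M. ?R (?UR (t - s) (ket m)) n * ?\<psi> m)
        = (\<Sum>m\<in>F M. \<Sum>k\<in>F M. ?UR (t - s) (ket k) n * ?R (ket m) k * ?\<psi> m)"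
      unfolding 3 by (simp add: sum_distrib_right)
    also have "\<dots> = (\<Sum>k\<in>F M. ?UR (t - s) (ket k) n * (\<Sum>m\<in>F M. ?R (ket m) k * ?\<psi> m))"
      by (subst sum.swap) (simp add: sum_distrib_left mult.assoc)
    also have "\<dots> = (\<Sum>k\<in>F M. ?UR (t - s) (ket k) n * ?R ?\<psi> k)"
      by (intro sum.cong refl) (use R in auto)
    finally have "(\<Sum>m\<in>F M. ?UR (t - s) (ket m) n * (- \<i> * ?H ?\<psi> m) + \<i> * ?R (?UR (t - s) (ket m)) n * ?\<psi> m)
        = - \<i> * (\<Sum>m\<in>F M. ?UR (t - s) (ket m) n * (?H ?\<psi> m - ?R ?\<psi> m))"
      by (simp add: sum.distrib sum_distrib_left [symmetric] mult.assoc mult.left_commute [of _ \<i>]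
          right_diff_distrib sum_subtractf sum_negf algebra_simps)
    then show ?thesis unfolding evol_ket [OF assms, of "t - s" "\<lambda>m. ?H ?\<psi> m - ?R ?\<psi> m"] .
  qed
  finally show ?thesis .
qed

end

end

section \<open>Growth of second moments of weighted particle numbers\<close>

definition moment :: "'s set \<Rightarrow> nat \<Rightarrow> ('s \<Rightarrow> real) \<Rightarrow> 's wave \<Rightarrow> real" where
  "moment L M w \<psi> = (\<Sum>n\<in>sectors L (Suc M). (wnum L w n)\<^sup>2 * (cmod (\<psi> n))\<^sup>2)"

lemma wnum_nonneg: "(\<And>i. i \<in> L \<Longrightarrow> 0 \<le> w i) \<Longrightarrow> 0 \<le> wnum L w n"
  unfolding wnum_def by (intro sum_nonneg) auto

lemma wnum_ge:
  assumes "finite L" "i \<in> L" "\<And>i. i \<in> L \<Longrightarrow> 0 \<le> w i"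
  shows "w i * real (n i) \<le> wnum L w n"
  unfolding wnum_def using assms by (intro member_le_sum) auto

lemma wnum_ge_weight:
  assumes "finite L" "i \<in> L" "\<And>i. i \<in> L \<Longrightarrow> 0 \<le> w i" "n i \<noteq> 0"
  shows "w i \<le> wnum L w n"
proof -
  have "w i * 1 \<le> w i * real (n i)"
    using assms by (intro mult_left_mono) auto
  moreover have "w i * real (n i) \<le> wnum L w n" by (rule wnum_ge [OF assms(1-3)])
  ultimately show ?thesis by linarith
qed

lemma moment_nonneg: "0 \<le> moment L M w \<psi>"
  unfolding moment_def by (intro sum_nonneg) auto

lemma moment_eq: "moment L M w \<psi> = (nrm (sectors L (Suc M)) (\<lambda>n. complex_of_real (wnum L w n) * \<psi> n))\<^sup>2"
  unfolding moment_def nrm_square by (simp add: norm_mult power_mult_distrib)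

text \<open>Only the product \<open>p * q\<close> is tied to \<open>c\<close>, so the two ends of a
  hop may be charged very unequally. Both weighted moment estimates exploit this freedom.\<close>

lemma young_pair:
  fixes x y c p q :: real
  assumes "c\<^sup>2 \<le> p * q" "0 \<le> p" "0 \<le> q" "0 \<le> x" "0 \<le> y"
  shows "c * (x * y) \<le> (p * x\<^sup>2 + q * y\<^sup>2) / 2"
proof -
  have "\<bar>c\<bar> \<le> sqrt p * sqrt q"
    using assms(1) by (simp add: real_sqrt_mult [symmetric] real_le_rsqrt)
  then have "c * (x * y) \<le> (sqrt p * sqrt q) * (x * y)"
    using assms by (intro mult_right_mono) auto
  also have "\<dots> = (sqrt p * x) * (sqrt q * y)" by (simp add: mult_ac)
  also have "\<dots> \<le> ((sqrt p * x)\<^sup>2 + (sqrt q * y)\<^sup>2) / 2"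
    using sum_squares_bound [of "sqrt p * x" "sqrt q * y"] by simp
  also have "\<dots> = (p * x\<^sup>2 + q * y\<^sup>2) / 2"
    using assms by (simp add: power_mult_distrib)
  finally show ?thesis .
qed

context hermitian_hopping
begin

lemma occupation_deriv:
  fixes V :: "'s \<Rightarrow> 's \<Rightarrow> real"
  defines "H \<equiv> hamiltonian J V L"
  shows "((\<lambda>s. (cmod (time_evol H s \<psi> n))\<^sup>2) has_real_derivative
    2 * Im (cnj (time_evol H s \<psi> n) * H (time_evol H s \<psi>) n)) (at s)"
proof -
  let ?z = "\<lambda>s. time_evol H s \<psi> n" and ?h = "H (time_evol H s \<psi>) n"
  have d: "(?z has_vector_derivative - \<i> * ?h) (at s)"
    unfolding H_def by (rule schroedinger_equation [OF L])
  have 1: "((\<lambda>s. Re (?z s)) has_real_derivative Im ?h) (at s)"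
    using bounded_linear.has_vector_derivative [OF bounded_linear_Re d]
    by (simp add: has_real_derivative_iff_has_vector_derivative)
  have 2: "((\<lambda>s. Im (?z s)) has_real_derivative - Re ?h) (at s)"
    using bounded_linear.has_vector_derivative [OF bounded_linear_Im d]
    by (simp add: has_real_derivative_iff_has_vector_derivative)
  have "((\<lambda>s. (Re (?z s))\<^sup>2 + (Im (?z s))\<^sup>2) has_real_derivative
      2 * Re (?z s) * Im ?h + 2 * Im (?z s) * (- Re ?h)) (at s)"
    using DERIV_add [OF DERIV_power [OF 1, of 2] DERIV_power [OF 2, of 2]] by (simp add: mult_ac)
  then show ?thesis by (simp add: cmod_power2 algebra_simps)
qed

text \<open>The interaction term is real and has no imaginary part. In the hopping term
  \<open>cre i\<close> is moved to the left factor, which leaves the current between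
  \<open>i\<close> and \<open>j\<close> over a configuration \<open>m\<close> with the hopping
  particle removed.\<close>

lemma current_eq:
  "(\<Sum>n\<in>F M. G n * Im (cnj (\<psi> n) * hamiltonian J V L \<psi> n))
    = (\<Sum>m\<in>sectors L M. \<Sum>i\<in>L. \<Sum>j\<in>L. G (m(i := Suc (m i))) * Im (J i j * (cnj (ann i \<psi> m) * ann j \<psi> m)))"
proof -
  have e: "Im (cnj (\<psi> n) * hamiltonian J V L \<psi> n) = (\<Sum>i\<in>L. \<Sum>j\<in>L. Im (J i j * (cnj (\<psi> n) * cre i (ann j \<psi>) n)))"
    for n
  proof -
    have "cnj (\<psi> n) * hamiltonian J V L \<psi> n = (\<Sum>i\<in>L. \<Sum>j\<in>L. J i j * (cnj (\<psi> n) * cre i (ann j \<psi>) n))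
        + complex_of_real (interaction V L n * (cmod (\<psi> n))\<^sup>2)"
      by (simp add: hamiltonian_eq distrib_left sum_distrib_left complex_norm_square mult_ac del: of_real_power)
    then show ?thesis by simp
  qed
  have "(\<Sum>n\<in>F M. G n * Im (cnj (\<psi> n) * hamiltonian J V L \<psi> n))
      = (\<Sum>i\<in>L. \<Sum>j\<in>L. \<Sum>n\<in>F M. G n * Im (J i j * (cnj (\<psi> n) * cre i (ann j \<psi>) n)))"
    unfolding e by (simp add: sum_distrib_left sum.swap [of _ _ "F M"])
  also have "\<dots> = (\<Sum>i\<in>L. \<Sum>j\<in>L. \<Sum>m\<in>sectors L M. G (m(i := Suc (m i))) * Im (J i j * (cnj (ann i \<psi> m) * ann j \<psi> m)))"
  proof (rule sum.cong [OF refl], rule sum.cong [OF refl])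
    fix i j assume i: "i \<in> L" "j \<in> L"
    have "(\<Sum>n\<in>F M. G n * Im (J i j * (cnj (\<psi> n) * cre i (ann j \<psi>) n)))
        = Im (J i j * (\<Sum>n\<in>F M. complex_of_real (G n) * (cnj (\<psi> n) * cre i (ann j \<psi>) n)))"
      by (simp add: sum_distrib_left mult.left_commute [of "J i j"])
    also have "\<dots> = Im (J i j * (\<Sum>m\<in>sectors L M. complex_of_real (G (m(i := Suc (m i)))) * (cnj (ann i \<psi> m) * ann j \<psi> m)))"
      by (subst cre_adjoint [OF L i(1)]) (rule refl)
    also have "\<dots> = (\<Sum>m\<in>sectors L M. G (m(i := Suc (m i))) * Im (J i j * (cnj (ann i \<psi> m) * ann j \<psi> m)))"
      by (simp add: sum_distrib_left mult.left_commute [of "J i j"])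
    finally show "(\<Sum>n\<in>F M. G n * Im (J i j * (cnj (\<psi> n) * cre i (ann j \<psi>) n)))
      = (\<Sum>m\<in>sectors L M. G (m(i := Suc (m i))) * Im (J i j * (cnj (ann i \<psi> m) * ann j \<psi> m)))" .
  qed
  also have "\<dots> = (\<Sum>m\<in>sectors L M. \<Sum>i\<in>L. \<Sum>j\<in>L. G (m(i := Suc (m i))) * Im (J i j * (cnj (ann i \<psi> m) * ann j \<psi> m)))"
    by (simp add: sum.swap [of _ _ "sectors L M"])
  finally show ?thesis .
qed

text \<open>Moving a particle from \<open>j\<close> to \<open>i\<close> changes \<open>N\<^sup>2\<close> by a multiple of \<open>w i - w j\<close>; the weights \<open>p\<close> tell
  which of the two sites pays for the hop in the arithmetic-geometric mean inequality.\<close>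

lemma current_bound:
  assumes w: "\<And>i. i \<in> L \<Longrightarrow> 0 \<le> w i"
    and p: "\<And>i j. i \<in> L \<Longrightarrow> j \<in> L \<Longrightarrow> 0 \<le> p i j"
    and pp: "\<And>i j. i \<in> L \<Longrightarrow> j \<in> L \<Longrightarrow> (cmod (J i j) * (w i - w j))\<^sup>2 \<le> p i j * p j i"
  shows "(\<Sum>n\<in>F M. (wnum L w n)\<^sup>2 * (2 * Im (cnj (\<psi> n) * hamiltonian J V L \<psi> n)))
    \<le> (\<Sum>n\<in>F M. (\<Sum>i\<in>L. real (n i) * (\<Sum>j\<in>L. p i j * (2 * wnum L w n - w i + w j))) * (cmod (\<psi> n))\<^sup>2)"
proof -
  define a where "a i m = cmod (ann i \<psi> m)" for i m
  define z where "z i j m = Im (J i j * (cnj (ann i \<psi> m) * ann j \<psi> m))" for i j m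
  let ?N = "wnum L w" and ?G = "sectors L M"
  have zz: "z j i m = - z i j m" if "i \<in> L" "j \<in> L" for i j m
  proof -
    have "J j i * (cnj (ann j \<psi> m) * ann i \<psi> m) = cnj (J i j * (cnj (ann i \<psi> m) * ann j \<psi> m))"
      using J [OF that] by (simp add: mult.commute)
    then show ?thesis unfolding z_def by (simp only: cnj.simps)
  qed
  have za: "\<bar>z i j m\<bar> \<le> cmod (J i j) * (a i m * a j m)" for i j m
    unfolding z_def a_def by (rule order_trans [OF abs_Im_le_cmod]) (simp add: norm_mult)
  have "(\<Sum>n\<in>F M. (?N n)\<^sup>2 * (2 * Im (cnj (\<psi> n) * hamiltonian J V L \<psi> n)))
      = 2 * (\<Sum>n\<in>F M. (?N n)\<^sup>2 * Im (cnj (\<psi> n) * hamiltonian J V L \<psi> n))"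
    unfolding sum_distrib_left by (simp only: mult.left_commute)
  also have "\<dots> = (\<Sum>m\<in>?G. 2 * (\<Sum>i\<in>L. \<Sum>j\<in>L. (?N m + w i)\<^sup>2 * z i j m))"
    unfolding current_eq sum_distrib_left z_def
    by (intro sum.cong refl) (simp add: wnum_raise [OF L])
  also have "\<dots> \<le> (\<Sum>m\<in>?G. \<Sum>i\<in>L. \<Sum>j\<in>L. p i j * ((2 * ?N m + w i + w j) * (a i m)\<^sup>2))"
  proof (rule sum_mono)
    fix m assume "m \<in> ?G"
    let ?s = "\<lambda>i j. 2 * ?N m + w i + w j"
    \<comment> \<open>Antisymmetry of the current \<open>z\<close> turns the squares into a
      difference of squares, which factors as \<open>(w i - w j)\<close> times
      \<open>2 * ?N m + w i + w j\<close>.\<close>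
    have "(\<Sum>i\<in>L. \<Sum>j\<in>L. (?N m + w i)\<^sup>2 * z i j m) = (\<Sum>i\<in>L. \<Sum>j\<in>L. (?N m + w j)\<^sup>2 * z j i m)"
      by (rule sum.swap)
    also have "\<dots> = (\<Sum>i\<in>L. \<Sum>j\<in>L. - ((?N m + w j)\<^sup>2 * z i j m))"
    proof (rule sum.cong [OF refl], rule sum.cong [OF refl])
      fix i j assume "i \<in> L" "j \<in> L"
      then have "z j i m = - z i j m" by (rule zz)
      then show "(?N m + w j)\<^sup>2 * z j i m = - ((?N m + w j)\<^sup>2 * z i j m)" by simp
    qed
    finally have "2 * (\<Sum>i\<in>L. \<Sum>j\<in>L. (?N m + w i)\<^sup>2 * z i j m)
        = (\<Sum>i\<in>L. \<Sum>j\<in>L. (?N m + w i)\<^sup>2 * z i j m) + (\<Sum>i\<in>L. \<Sum>j\<in>L. - ((?N m + w j)\<^sup>2 * z i j m))"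
      by simp
    also have "\<dots> = (\<Sum>i\<in>L. \<Sum>j\<in>L. (w i - w j) * ?s i j * z i j m)"
      by (simp add: sum.distrib [symmetric] power2_eq_square algebra_simps)
    also have "\<dots> \<le> (\<Sum>i\<in>L. \<Sum>j\<in>L. ?s i j * ((p i j * (a i m)\<^sup>2 + p j i * (a j m)\<^sup>2) / 2))"
    proof (intro sum_mono)
      fix i j assume ij: "i \<in> L" "j \<in> L"
      have s: "0 \<le> ?s i j" using wnum_nonneg [of L w m] w ij by simp
      have "(w i - w j) * ?s i j * z i j m \<le> \<bar>(w i - w j) * ?s i j * z i j m\<bar>" by simp
      also have "\<dots> = ?s i j * (\<bar>w i - w j\<bar> * \<bar>z i j m\<bar>)" using s by (simp add: abs_mult)
      also have "\<dots> \<le> ?s i j * (\<bar>w i - w j\<bar> * (cmod (J i j) * (a i m * a j m)))"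
        using s by (intro mult_left_mono za) auto
      also have "\<dots> = ?s i j * ((cmod (J i j) * \<bar>w i - w j\<bar>) * (a i m * a j m))" by (simp add: mult_ac)
      also have "\<dots> \<le> ?s i j * ((p i j * (a i m)\<^sup>2 + p j i * (a j m)\<^sup>2) / 2)"
        using pp [OF ij] p ij by (intro mult_left_mono s young_pair) (auto simp: a_def power_mult_distrib)
      finally show "(w i - w j) * ?s i j * z i j m \<le> ?s i j * ((p i j * (a i m)\<^sup>2 + p j i * (a j m)\<^sup>2) / 2)" .
    qed
    also have "\<dots> = (\<Sum>i\<in>L. \<Sum>j\<in>L. ?s i j * p i j * (a i m)\<^sup>2) / 2 + (\<Sum>i\<in>L. \<Sum>j\<in>L. ?s j i * p j i * (a j m)\<^sup>2) / 2"
      by (simp add: sum.distrib [symmetric] sum_divide_distrib) (intro sum.cong refl, simp add: field_simps)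
    also have "(\<Sum>i\<in>L. \<Sum>j\<in>L. ?s j i * p j i * (a j m)\<^sup>2) = (\<Sum>i\<in>L. \<Sum>j\<in>L. ?s i j * p i j * (a i m)\<^sup>2)"
      by (rule sum.swap)
    finally show "2 * (\<Sum>i\<in>L. \<Sum>j\<in>L. (?N m + w i)\<^sup>2 * z i j m)
        \<le> (\<Sum>i\<in>L. \<Sum>j\<in>L. p i j * (?s i j * (a i m)\<^sup>2))"
      by (simp add: mult_ac)
  qed
  also have "\<dots> = (\<Sum>i\<in>L. \<Sum>j\<in>L. p i j * (\<Sum>m\<in>?G. (2 * ?N m + w i + w j) * (a i m)\<^sup>2))"
    by (simp add: sum_distrib_left sum.swap [of _ _ ?G])
  also have "\<dots> = (\<Sum>i\<in>L. \<Sum>j\<in>L. p i j * (\<Sum>n\<in>F M. real (n i) * (2 * ?N n - w i + w j) * (cmod (\<psi> n))\<^sup>2))"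
  proof (rule sum.cong [OF refl], rule sum.cong [OF refl], rule arg_cong [where f = "(*) _"])
    fix i j assume i: "i \<in> L"
    \<comment> \<open>Putting the particle back at \<open>i\<close> replaces \<open>?N m\<close> by
      \<open>?N n - w i\<close>; this is where the sign in \<open>2 * ?N n - w i + w j\<close> comes
      from.\<close>
    show "(\<Sum>m\<in>?G. (2 * ?N m + w i + w j) * (a i m)\<^sup>2)
        = (\<Sum>n\<in>F M. real (n i) * (2 * ?N n - w i + w j) * (cmod (\<psi> n))\<^sup>2)"
      unfolding ann_moment [OF L i, symmetric] a_def by (simp add: wnum_raise [OF L i] algebra_simps)
  qed
  also have "\<dots> = (\<Sum>n\<in>F M. (\<Sum>i\<in>L. real (n i) * (\<Sum>j\<in>L. p i j * (2 * ?N n - w i + w j))) * (cmod (\<psi> n))\<^sup>2)"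
    by (simp add: sum_distrib_left sum_distrib_right sum.swap [of _ _ "F M"] mult_ac)
  finally show ?thesis .
qed

text \<open>A Gronwall estimate for a weight that moves in time. The hypothesis \<open>key\<close>
  is a pointwise inequality between configurations: the drift of the weight plus the charges for the
  hops is at most \<open>a\<close> times the moment itself plus a source measured by a second weight
  \<open>u\<close>, for which \<open>B\<close> is an independent bound. With a decreasing
  \<open>w\<close> the drift is negative and can pay for hops.\<close>

lemma moment_growth:
  fixes w w' :: "real \<Rightarrow> 's \<Rightarrow> real" and p :: "real \<Rightarrow> 's \<Rightarrow> 's \<Rightarrow> real" and V :: "'s \<Rightarrow> 's \<Rightarrow> real"
  defines "U \<equiv> time_evol (hamiltonian J V L)"
  assumes t: "0 \<le> t" and a: "0 \<le> a" and b: "0 \<le> b"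
    and w: "\<And>s i. i \<in> L \<Longrightarrow> 0 \<le> w s i"
    and w': "\<And>s i. i \<in> L \<Longrightarrow> ((\<lambda>s. w s i) has_real_derivative w' s i) (at s)"
    and p: "\<And>s i j. i \<in> L \<Longrightarrow> j \<in> L \<Longrightarrow> 0 \<le> p s i j"
    and pp: "\<And>s i j. i \<in> L \<Longrightarrow> j \<in> L \<Longrightarrow> (cmod (J i j) * (w s i - w s j))\<^sup>2 \<le> p s i j * p s j i"
    and key: "\<And>s n. 0 \<le> s \<Longrightarrow> s \<le> t \<Longrightarrow>
      2 * wnum L (w s) n * wnum L (w' s) n
        + (\<Sum>i\<in>L. real (n i) * (\<Sum>j\<in>L. p s i j * (2 * wnum L (w s) n - w s i + w s j)))
      \<le> a * (wnum L (w s) n)\<^sup>2 + b * (wnum L u n)\<^sup>2"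
    and B: "\<And>s. 0 \<le> s \<Longrightarrow> s \<le> t \<Longrightarrow> moment L M u (U s \<psi>) \<le> B"
  shows "moment L M (w t) (U t \<psi>) \<le> exp (a * t) * (moment L M (w 0) \<psi> + b * B * t)"
proof -
  let ?H = "hamiltonian J V L"
  define f where "f s = moment L M (w s) (U s \<psi>)" for s
  define f' where "f' s = (\<Sum>n\<in>F M. (wnum L (w s) n)\<^sup>2 * (2 * Im (cnj (U s \<psi> n) * ?H (U s \<psi>) n))
      + 2 * wnum L (w s) n * wnum L (w' s) n * (cmod (U s \<psi> n))\<^sup>2)" for s
  have d: "(f has_real_derivative f' s) (at s)" for s
  proof -
    have 1: "((\<lambda>s. wnum L (w s) n) has_real_derivative wnum L (w' s) n) (at s)" for n
      unfolding wnum_def by (intro DERIV_sum DERIV_cmult_right w')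
    have 2: "((\<lambda>s. (wnum L (w s) n)\<^sup>2) has_real_derivative 2 * wnum L (w s) n * wnum L (w' s) n) (at s)" for n
      using DERIV_power [OF 1 [of n], where n = 2] by (simp add: mult_ac)
    have 3: "((\<lambda>s. (cmod (U s \<psi> n))\<^sup>2) has_real_derivative 2 * Im (cnj (U s \<psi> n) * ?H (U s \<psi>) n)) (at s)" for n
      unfolding U_def by (rule occupation_deriv)
    show ?thesis
      unfolding f_def [abs_def] f'_def moment_def
      by (rule DERIV_sum, rule DERIV_cong [OF DERIV_mult [OF 2 3]]) (simp add: mult_ac)
  qed
  have f': "f' s \<le> a * f s + b * B" if s: "0 \<le> s" "s \<le> t" for s
  proof -
    let ?K = "\<lambda>n. \<Sum>i\<in>L. real (n i) * (\<Sum>j\<in>L. p s i j * (2 * wnum L (w s) n - w s i + w s j))"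
    have "f' s \<le> (\<Sum>n\<in>F M. ?K n * (cmod (U s \<psi> n))\<^sup>2)
        + (\<Sum>n\<in>F M. 2 * wnum L (w s) n * wnum L (w' s) n * (cmod (U s \<psi> n))\<^sup>2)"
      unfolding f'_def sum.distrib by (intro add_right_mono current_bound w p pp)
    also have "\<dots> = (\<Sum>n\<in>F M. (2 * wnum L (w s) n * wnum L (w' s) n + ?K n) * (cmod (U s \<psi> n))\<^sup>2)"
      by (simp add: sum.distrib [symmetric] algebra_simps)
    also have "\<dots> \<le> (\<Sum>n\<in>F M. (a * (wnum L (w s) n)\<^sup>2 + b * (wnum L u n)\<^sup>2) * (cmod (U s \<psi> n))\<^sup>2)"
      by (intro sum_mono mult_right_mono key s) auto
    also have "\<dots> = a * f s + b * moment L M u (U s \<psi>)"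
      unfolding f_def moment_def by (simp add: sum.distrib sum_distrib_left algebra_simps)
    also have "\<dots> \<le> a * f s + b * B"
      using mult_left_mono [OF B [OF s] b] by simp
    finally show ?thesis .
  qed
  have B0: "0 \<le> B" using B [of 0] t moment_nonneg [of L M u "U 0 \<psi>"] by simp
  define g where "g s = exp (- a * s) * f s - b * B * s" for s
  have "g t \<le> g 0"
  proof (rule DERIV_nonpos_imp_nonincreasing [OF t])
    fix s assume s: "0 \<le> s" "s \<le> t"
    have "(g has_real_derivative exp (- a * s) * f' s + exp (- a * s) * (- a) * f s - b * B) (at s)"
      unfolding g_def [abs_def] by (auto intro!: derivative_eq_intros d)
    moreover have "exp (- a * s) * f' s + exp (- a * s) * (- a) * f s - b * B \<le> 0"
    proof -
      have "exp (- a * s) * (f' s - a * f s) \<le> exp (- a * s) * (b * B)"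
        using f' [OF s] by (intro mult_left_mono) auto
      also have "\<dots> \<le> 1 * (b * B)"
        using a s b B0 by (intro mult_right_mono) auto
      finally show ?thesis by (simp add: algebra_simps)
    qed
    ultimately show "\<exists>y. (g has_real_derivative y) (at s) \<and> y \<le> 0" by blast
  qed
  then have "exp (- a * t) * f t \<le> f 0 + b * B * t" by (simp add: g_def)
  then have "exp (a * t) * (exp (- a * t) * f t) \<le> exp (a * t) * (f 0 + b * B * t)"
    by (intro mult_left_mono) auto
  then show ?thesis
    by (simp add: f_def U_def time_evol_0 mult.assoc [symmetric] exp_add [symmetric])
qed

end

section \<open>Comparison of two evolutions\<close>

definition occ :: "'s \<Rightarrow> 's oper" where
  "occ j \<phi> = (\<lambda>n. of_nat (n j) * \<phi> n)"

lemma vector_derivative_bound: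
  fixes f :: "real \<Rightarrow> 'a::real_normed_vector"
  assumes t: "0 \<le> t"
    and d: "\<And>s. 0 \<le> s \<Longrightarrow> s \<le> t \<Longrightarrow> (f has_vector_derivative f' s) (at s)"
    and b: "\<And>s. 0 \<le> s \<Longrightarrow> s \<le> t \<Longrightarrow> norm (f' s) \<le> B"
  shows "norm (f t - f 0) \<le> B * t"
proof -
  have "norm (f t - f 0) \<le> B * norm (t - 0)"
  proof (rule differentiable_bound [where f' = "\<lambda>s h. h *\<^sub>R f' s" and S = "{0..t}"])
    show "(f has_derivative (\<lambda>h. h *\<^sub>R f' s)) (at s within {0..t})" if "s \<in> {0..t}" for s
      using d [of s] that has_derivative_at_withinI unfolding has_vector_derivative_def by auto
    show "onorm (\<lambda>h. h *\<^sub>R f' s) \<le> B" if "s \<in> {0..t}" for s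
      by (rule onorm_le) (use b [of s] that in \<open>auto simp: mult.commute [of B] intro!: mult_left_mono\<close>)
  qed (use t in auto)
  then show ?thesis using t by simp
qed

lemma sum_split_square:
  fixes f :: "'s \<Rightarrow> 's \<Rightarrow> 'a::comm_monoid_add"
  assumes "finite L" "I \<subseteq> L"
  shows "(\<Sum>i\<in>L. \<Sum>j\<in>L. f i j) = (\<Sum>i\<in>I. \<Sum>j\<in>I. f i j) + (\<Sum>i\<in>L - I. \<Sum>j\<in>L - I. f i j)
    + (\<Sum>i\<in>I. \<Sum>j\<in>L - I. f i j + f j i)"
proof -
  have s: "sum g L = sum g I + sum g (L - I)" for g :: "'s \<Rightarrow> 'a"
    using assms by (metis sum.subset_diff add.commute)
  have "(\<Sum>i\<in>L. \<Sum>j\<in>L. f i j) = (\<Sum>i\<in>I. \<Sum>j\<in>I. f i j) + (\<Sum>i\<in>I. \<Sum>j\<in>L - I. f i j)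
      + ((\<Sum>i\<in>L - I. \<Sum>j\<in>I. f i j) + (\<Sum>i\<in>L - I. \<Sum>j\<in>L - I. f i j))"
    by (simp add: s sum.distrib ac_simps)
  also have "(\<Sum>i\<in>L - I. \<Sum>j\<in>I. f i j) = (\<Sum>i\<in>I. \<Sum>j\<in>L - I. f j i)"
    by (rule sum.swap)
  finally show ?thesis by (simp add: sum.distrib ac_simps)
qed

text \<open>The factor \<open>1/2\<close> cancels against the two orders of a mixed pair, whose
  occupation factors agree because its sites differ. The mixed interaction is written with
  \<open>occ j\<close>, where \<open>j\<close> is outside \<open>I\<close>, in front: this operator
  will be pulled through the truncated evolution and the observable.\<close>

lemma hamiltonian_split:
  assumes L: "finite L" and I: "I \<subseteq> L"
    and V: "\<And>i j. i \<in> L \<Longrightarrow> j \<in> L \<Longrightarrow> V j i = V i j"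
  shows "hamiltonian J V L \<phi> n = hamiltonian J V I \<phi> n + hamiltonian J V (L - I) \<phi> n
    + (\<Sum>i\<in>I. \<Sum>j\<in>L - I. J i j * cre i (ann j \<phi>) n + J j i * cre j (ann i \<phi>) n)
    + (\<Sum>j\<in>L - I. occ j (\<lambda>n. (\<Sum>i\<in>I. complex_of_real (V i j) * of_nat (n i)) * \<phi> n) n)"
proof -
  have "(\<Sum>i\<in>I. \<Sum>j\<in>L - I. V i j * (real (n i) * real ((n(i := n i - 1)) j)) + V j i * (real (n j) * real ((n(j := n j - 1)) i)))
      = (\<Sum>i\<in>I. \<Sum>j\<in>L - I. 2 * (V i j * (real (n i) * real (n j))))"
  proof (rule sum.cong [OF refl], rule sum.cong [OF refl])
    fix i j assume "i \<in> I" "j \<in> L - I"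
    then show "V i j * (real (n i) * real ((n(i := n i - 1)) j)) + V j i * (real (n j) * real ((n(j := n j - 1)) i))
        = 2 * (V i j * (real (n i) * real (n j)))"
      using V [of i j] I by (auto simp: algebra_simps)
  qed
  also have "\<dots> = 2 * (\<Sum>i\<in>I. \<Sum>j\<in>L - I. V i j * (real (n i) * real (n j)))"
    by (simp add: sum_distrib_left)
  also have "(\<Sum>i\<in>I. \<Sum>j\<in>L - I. V i j * (real (n i) * real (n j)))
      = (\<Sum>j\<in>L - I. real (n j) * (\<Sum>i\<in>I. V i j * real (n i)))"
    by (subst sum.swap) (simp add: sum_distrib_left mult_ac)
  finally have "interaction V L n = interaction V I n + interaction V (L - I) n
      + (\<Sum>j\<in>L - I. real (n j) * (\<Sum>i\<in>I. V i j * real (n i)))"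
    unfolding interaction_def sum_split_square [OF L I] by (simp add: algebra_simps)
  then have "complex_of_real (interaction V L n) * \<phi> n
      = complex_of_real (interaction V I n) * \<phi> n + complex_of_real (interaction V (L - I) n) * \<phi> n
      + (\<Sum>j\<in>L - I. occ j (\<lambda>n. (\<Sum>i\<in>I. complex_of_real (V i j) * of_nat (n i)) * \<phi> n) n)"
    by (simp add: occ_def distrib_right sum_distrib_right mult.assoc)
  then show ?thesis
    unfolding hamiltonian_eq sum_split_square [OF L I] by simp
qed

text \<open>The norm of a product of two occupation numbers would need a fourth moment; the second
  sum has a product of norms instead. The sum over \<open>i\<close> stays inside the norm so that
  distant pairs can be estimated by one weighted particle number rather than site by site, which
  saves a factor \<open>R ^ D\<close>.\<close>

definition boundary_terms :: "('s \<Rightarrow> 's \<Rightarrow> complex) \<Rightarrow> ('s \<Rightarrow> 's \<Rightarrow> real) \<Rightarrow> 's set \<Rightarrow> 's set \<Rightarrow> 's conf set \<Rightarrow> 's wave \<Rightarrow> real"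
  where "boundary_terms J V I K F \<phi> =
    (\<Sum>i\<in>I. \<Sum>j\<in>K. cmod (J i j) * (nrm F (cre i (ann j \<phi>)) + nrm F (cre j (ann i \<phi>))))
    + (\<Sum>j\<in>K. nrm F (occ j \<phi>) * nrm F (\<lambda>n. (\<Sum>i\<in>I. complex_of_real (V i j) * of_nat (n i)) * \<phi> n))"

context hermitian_hopping
begin

text \<open>Along \<open>\<xi> s = UR (t - s) (U s \<psi>)\<close> the expectation of
  \<open>B\<close> runs from the truncated value at \<open>s = 0\<close> to the full one at
  \<open>s = t\<close>. The operator \<open>B\<close> stands for the compression of the observable
  to the sectors.\<close>

lemma interaction_picture_bound:
  fixes V :: "'s \<Rightarrow> 's \<Rightarrow> real" and B :: "'s oper" and I :: "'s set"
  defines "U \<equiv> time_evol (hamiltonian J V L)" and "UR \<equiv> time_evol (hamiltonian J V I)"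
  assumes I: "I \<subseteq> L" and V: "\<And>i j. i \<in> L \<Longrightarrow> j \<in> L \<Longrightarrow> V j i = V i j"
    and Bm: "matrix_on (F M) B b"
    and Bh: "\<And>\<phi> \<psi>. inn (F M) \<phi> (B \<psi>) = inn (F M) (B \<phi>) \<psi>"
    and Bn: "\<And>\<phi> \<psi>. cmod (inn (F M) \<phi> (B \<psi>)) \<le> nrm (F M) \<phi> * nrm (F M) \<psi>"
    and Bo: "\<And>\<phi> n. n \<in> F M \<Longrightarrow> B (hamiltonian J V (L - I) \<phi>) n = hamiltonian J V (L - I) (B \<phi>) n"
    and Bj: "\<And>j \<phi> n. j \<in> L - I \<Longrightarrow> n \<in> F M \<Longrightarrow> B (occ j \<phi>) n = occ j (B \<phi>) n"
    and \<psi>: "nrm (F M) \<psi> \<le> 1"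
    and t: "0 \<le> t"
    and E: "\<And>s. 0 \<le> s \<Longrightarrow> s \<le> t \<Longrightarrow> boundary_terms J V I (L - I) (F M) (U s \<psi>) \<le> E"
  shows "cmod (inn (F M) (U t \<psi>) (B (U t \<psi>)) - inn (F M) (UR t \<psi>) (B (UR t \<psi>))) \<le> 2 * E * t"
proof -
  let ?H = "hamiltonian J V L" and ?R = "hamiltonian J V I" and ?O = "hamiltonian J V (L - I)"
  have fI: "finite I" and OL: "L - I \<subseteq> L" using I L finite_subset by auto
  define \<xi> where "\<xi> s = UR (t - s) (U s \<psi>)" for s
  define W where "W s = (\<lambda>m. ?H (U s \<psi>) m - ?R (U s \<psi>) m)" for s
  define l where "l s \<phi> = inn (F M) (\<xi> s) (B (UR (t - s) \<phi>))" for s \<phi>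
  have Bcong: "B \<phi> n = B \<phi>' n" if "n \<in> F M" "\<And>m. m \<in> F M \<Longrightarrow> \<phi> m = \<phi>' m" for \<phi> \<phi>' n
    using Bm that by (simp add: matrix_on_def)
  have Om: "\<exists>h. matrix_on (F M) ?O h"
    by (rule matrix_on_hamiltonian_sectors [OF L OL])
  have UR_O: "UR s (?O \<phi>) n = ?O (UR s \<phi>) n" if "n \<in> F M" for s \<phi> n
  proof -
    obtain h where h: "matrix_on (F M) ?O h" using Om by blast
    show ?thesis unfolding UR_def
      by (rule evol_commute [OF I h that, symmetric]) (rule hamiltonian_commute_disjoint, auto)
  qed
  have UR_occ: "UR s (occ j \<phi>) n = occ j (UR s \<phi>) n" if "n \<in> F M" "j \<in> L - I" for s j \<phi> n
  proof -
    have "matrix_on (F M) (occ j) (\<lambda>n m. if m = n then of_nat (n j) else 0)"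
      unfolding matrix_on_def occ_def using finite_F by (simp add: mult_delta_left)
    then show ?thesis unfolding UR_def
      by (rule evol_commute [OF I _ that(1), symmetric]) (use that(2) hamiltonian_commute_number [of j I] in \<open>simp add: occ_def\<close>)
  qed
  have Ocong: "?O \<phi> n = ?O \<phi>' n" if "n \<in> F M" "\<And>m. m \<in> F M \<Longrightarrow> \<phi> m = \<phi>' m" for \<phi> \<phi>' n
    using Om that by (auto simp: matrix_on_def)
  have nUR: "nrm (F M) (UR s \<phi>) = nrm (F M) \<phi>" for s \<phi>
    unfolding UR_def by (rule evol_nrm [OF I])
  have n\<xi>: "nrm (F M) (\<xi> s) \<le> 1" for s
    unfolding \<xi>_def nUR using \<psi> evol_nrm [of L M V s \<psi>] by (simp add: U_def)
  have l_bound: "cmod (l s \<phi>) \<le> nrm (F M) \<phi>" for s \<phi>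
  proof -
    have "cmod (l s \<phi>) \<le> nrm (F M) (\<xi> s) * nrm (F M) (UR (t - s) \<phi>)"
      unfolding l_def by (rule Bn)
    also have "\<dots> \<le> 1 * nrm (F M) \<phi>"
      unfolding nUR by (intro mult_right_mono n\<xi> nrm_nonneg)
    finally show ?thesis by simp
  qed
  \<comment> \<open>As a finite linear form, \<open>l s\<close> can be distributed over the terms of
    \<open>hamiltonian_split\<close>.\<close>
  have "\<exists>g. \<forall>\<phi>. l s \<phi> = (\<Sum>m\<in>F M. g m * \<phi> m)" for s
  proof -
    define u where "u m = inn (F M) (\<xi> s) (\<lambda>n. b n m)" for m
    have 1: "inn (F M) (\<xi> s) (B \<phi>) = (\<Sum>m\<in>F M. u m * \<phi> m)" for \<phi>
    proof -
      have "inn (F M) (\<xi> s) (B \<phi>) = (\<Sum>n\<in>F M. \<Sum>m\<in>F M. cnj (\<xi> s n) * b n m * \<phi> m)"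
        unfolding inn_def using Bm by (simp add: matrix_on_def sum_distrib_left mult.assoc)
      then show ?thesis
        by (subst (asm) sum.swap) (simp add: u_def inn_def sum_distrib_right)
    qed
    have "l s \<phi> = (\<Sum>k\<in>F M. (\<Sum>m\<in>F M. u m * UR (t - s) (ket k) m) * \<phi> k)" for \<phi>
    proof -
      have "UR (t - s) \<phi> m = (\<Sum>k\<in>F M. UR (t - s) (ket k) m * \<phi> k)" if "m \<in> F M" for m
        unfolding UR_def by (rule evol_ket [OF I that])
      then have "l s \<phi> = (\<Sum>m\<in>F M. \<Sum>k\<in>F M. u m * UR (t - s) (ket k) m * \<phi> k)"
        unfolding l_def 1 by (simp add: sum_distrib_left mult.assoc)
      then show ?thesis
        by (subst (asm) sum.swap) (simp add: sum_distrib_right)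
    qed
    then show ?thesis
      by (intro exI [of _ "\<lambda>k. \<Sum>m\<in>F M. u m * UR (t - s) (ket k) m"] allI)
  qed
  then obtain g where g: "\<And>s \<phi>. l s \<phi> = (\<Sum>m\<in>F M. g s m * \<phi> m)" by metis
  define y where "y s j = (\<lambda>n. (\<Sum>i\<in>I. complex_of_real (V i j) * of_nat (n i)) * U s \<psi> n)" for s j
  have lW: "l s (W s) = l s (?O (U s \<psi>))
      + (\<Sum>i\<in>I. \<Sum>j\<in>L - I. J i j * l s (cre i (ann j (U s \<psi>))) + J j i * l s (cre j (ann i (U s \<psi>))))
      + (\<Sum>j\<in>L - I. l s (occ j (y s j)))" for s
  proof -
    have "?H \<phi> n = ?R \<phi> n + ?O \<phi> n
        + (\<Sum>i\<in>I. \<Sum>j\<in>L - I. J i j * cre i (ann j \<phi>) n + J j i * cre j (ann i \<phi>) n)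
        + (\<Sum>j\<in>L - I. occ j (\<lambda>n. (\<Sum>i\<in>I. complex_of_real (V i j) * of_nat (n i)) * \<phi> n) n)" for \<phi> n
      by (rule hamiltonian_split [OF L I]) (rule V)
    then have "W s = (\<lambda>n. ?O (U s \<psi>) n
      + (\<Sum>i\<in>I. \<Sum>j\<in>L - I. J i j * cre i (ann j (U s \<psi>)) n + J j i * cre j (ann i (U s \<psi>)) n)
      + (\<Sum>j\<in>L - I. occ j (y s j) n))"
      unfolding W_def y_def by (simp add: fun_eq_iff)
    then show ?thesis
      unfolding g by (simp add: distrib_left sum.distrib sum_distrib_left sum.swap [of _ _ "F M"] mult.left_commute)
  qed
  \<comment> \<open>The outer Hamiltonian commutes with the truncated evolution and with
    \<open>B\<close>. The expectation of a product of two commuting hermitian operators is real, and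
    the derivative sees the imaginary part only.\<close>
  have Im0: "Im (l s (?O (U s \<psi>))) = 0" for s
  proof -
    have 1: "UR (t - s) (?O (U s \<psi>)) n = ?O (\<xi> s) n" if "n \<in> F M" for n
      unfolding \<xi>_def by (rule UR_O [OF that])
    have "l s (?O (U s \<psi>)) = inn (F M) (\<xi> s) (B (?O (\<xi> s)))"
      unfolding l_def by (intro inn_cong refl Bcong 1)
    moreover have "inn (F M) (\<xi> s) (B (?O (\<xi> s))) = inn (F M) (\<xi> s) (?O (B (\<xi> s)))"
      by (intro inn_cong refl Bo)
    moreover have "\<dots> = inn (F M) (?O (\<xi> s)) (B (\<xi> s))"
      by (rule inn_hamiltonian [OF OL])
    moreover have "\<dots> = cnj (inn (F M) (\<xi> s) (B (?O (\<xi> s))))"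
      unfolding inn_commute by (rule Bh)
    ultimately have "l s (?O (U s \<psi>)) = cnj (l s (?O (U s \<psi>)))" by metis
    then show ?thesis by (metis Im_complex_of_real Reals_cases Reals_cnj_iff)
  qed
  \<comment> \<open>\<open>occ j\<close> travels through \<open>UR\<close> and \<open>B\<close> to
    the left factor; there it goes back through \<open>UR\<close>, which preserves the norm, and
    ends up on \<open>U s \<psi>\<close>.\<close>
  have l_occ: "cmod (l s (occ j (y s j))) \<le> nrm (F M) (occ j (U s \<psi>)) * nrm (F M) (y s j)"
    if j: "j \<in> L - I" for s j
  proof -
    have "l s (occ j (y s j)) = inn (F M) (\<xi> s) (B (occ j (UR (t - s) (y s j))))"
      unfolding l_def by (intro inn_cong refl Bcong UR_occ j)
    also have "\<dots> = inn (F M) (\<xi> s) (occ j (B (UR (t - s) (y s j))))"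
      by (intro inn_cong refl Bj j)
    also have "\<dots> = inn (F M) (occ j (\<xi> s)) (B (UR (t - s) (y s j)))"
      by (simp add: inn_def occ_def mult_ac)
    also have "cmod \<dots> \<le> nrm (F M) (occ j (\<xi> s)) * nrm (F M) (UR (t - s) (y s j))"
      by (rule Bn)
    also have "nrm (F M) (occ j (\<xi> s)) = nrm (F M) (UR (t - s) (occ j (U s \<psi>)))"
      unfolding \<xi>_def by (intro nrm_cong UR_occ [symmetric] j)
    finally show ?thesis unfolding nUR .
  qed
  have ImW: "\<bar>Im (l s (W s))\<bar> \<le> E" if s: "0 \<le> s" "s \<le> t" for s
  proof -
    have "\<bar>Im (l s (W s))\<bar> = \<bar>Im ((\<Sum>i\<in>I. \<Sum>j\<in>L - I. J i j * l s (cre i (ann j (U s \<psi>))) + J j i * l s (cre j (ann i (U s \<psi>))))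
      + (\<Sum>j\<in>L - I. l s (occ j (y s j))))\<bar>"
      unfolding lW using Im0 [of s] by simp
    also have "\<dots> \<le> cmod ((\<Sum>i\<in>I. \<Sum>j\<in>L - I. J i j * l s (cre i (ann j (U s \<psi>))) + J j i * l s (cre j (ann i (U s \<psi>))))
      + (\<Sum>j\<in>L - I. l s (occ j (y s j))))"
      by (rule abs_Im_le_cmod)
    also have "\<dots> \<le> (\<Sum>i\<in>I. \<Sum>j\<in>L - I. cmod (J i j) * (nrm (F M) (cre i (ann j (U s \<psi>))) + nrm (F M) (cre j (ann i (U s \<psi>)))))
      + (\<Sum>j\<in>L - I. nrm (F M) (occ j (U s \<psi>)) * nrm (F M) (y s j))"
    proof (rule order_trans [OF norm_triangle_ineq], rule add_mono, rule sum_norm_le, rule sum_norm_le, rule_tac [2] sum_norm_le)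
      fix i j assume ij: "i \<in> I" "j \<in> L - I"
      then have "cmod (J j i) = cmod (J i j)" using J [of i j] I by auto
      then have "cmod (J i j * l s (cre i (ann j (U s \<psi>))) + J j i * l s (cre j (ann i (U s \<psi>))))
          \<le> cmod (J i j) * cmod (l s (cre i (ann j (U s \<psi>)))) + cmod (J i j) * cmod (l s (cre j (ann i (U s \<psi>))))"
        by (metis norm_mult norm_triangle_ineq)
      also have "\<dots> \<le> cmod (J i j) * nrm (F M) (cre i (ann j (U s \<psi>))) + cmod (J i j) * nrm (F M) (cre j (ann i (U s \<psi>)))"
        by (intro add_mono mult_left_mono l_bound) auto
      finally show "cmod (J i j * l s (cre i (ann j (U s \<psi>))) + J j i * l s (cre j (ann i (U s \<psi>))))
        \<le> cmod (J i j) * (nrm (F M) (cre i (ann j (U s \<psi>))) + nrm (F M) (cre j (ann i (U s \<psi>))))"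
        by (simp add: distrib_left)
    qed (rule l_occ)
    also have "\<dots> \<le> E" unfolding y_def by (rule E [OF s, unfolded boundary_terms_def])
    finally show ?thesis .
  qed
  define G where "G s = inn (F M) (\<xi> s) (B (\<xi> s))" for s
  have dG: "(G has_vector_derivative complex_of_real (2 * Im (l s (W s)))) (at s)" for s
  proof -
    define d where "d n = - \<i> * UR (t - s) (W s) n" for n
    have 1: "((\<lambda>s. \<xi> s n) has_vector_derivative d n) (at s)" if "n \<in> F M" for n
      unfolding \<xi>_def d_def W_def UR_def U_def by (rule interaction_deriv [OF I that])
    have 2: "((\<lambda>s. B (\<xi> s) n) has_vector_derivative B d n) (at s)" if "n \<in> F M" for n
    proof -
      have "((\<lambda>s. \<Sum>m\<in>F M. b n m * \<xi> s m) has_vector_derivative (\<Sum>m\<in>F M. b n m * d m)) (at s)"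
        by (intro has_vector_derivative_sum has_vector_derivative_mult_right 1)
      then show ?thesis using Bm that by (simp add: matrix_on_def)
    qed
    have "(G has_vector_derivative (\<Sum>n\<in>F M. cnj (\<xi> s n) * B d n + cnj (d n) * B (\<xi> s) n)) (at s)"
      unfolding G_def [abs_def] inn_def
      by (intro has_vector_derivative_sum has_vector_derivative_mult has_vector_derivative_cnj 1 2)
    also have "(\<Sum>n\<in>F M. cnj (\<xi> s n) * B d n + cnj (d n) * B (\<xi> s) n)
        = inn (F M) (\<xi> s) (B d) + cnj (inn (F M) (\<xi> s) (B d))"
      unfolding inn_commute Bh [symmetric] by (simp add: inn_def sum.distrib)
    also have "inn (F M) (\<xi> s) (B d) = - \<i> * l s (W s)"
    proof -
      have "B d n = - \<i> * B (UR (t - s) (W s)) n" if "n \<in> F M" for n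
        using Bm that unfolding d_def by (simp add: matrix_on_def sum_distrib_left mult_ac sum_negf)
      then have "inn (F M) (\<xi> s) (B d) = inn (F M) (\<xi> s) (\<lambda>n. - \<i> * B (UR (t - s) (W s)) n)"
        by (intro inn_cong refl)
      then show ?thesis unfolding l_def inn_def by (simp add: sum_distrib_left mult_ac sum_negf)
    qed
    also have "- \<i> * l s (W s) + cnj (- \<i> * l s (W s)) = complex_of_real (2 * Im (l s (W s)))"
      by (simp add: complex_eq_iff)
    finally show ?thesis .
  qed
  have "norm (G t - G 0) \<le> 2 * E * t"
    by (rule vector_derivative_bound [OF t dG]) (use ImW in \<open>auto simp: abs_mult simp del: of_real_mult\<close>)
  then show ?thesis
    by (simp add: G_def \<xi>_def UR_def U_def time_evol_0)
qed

end

section \<open>Lattice sums\<close>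

lemma one_add_powr_le:
  fixes y q :: real
  assumes "0 \<le> y" "0 \<le> q"
  shows "(1 + y) powr q - 1 \<le> q * y * (1 + y) powr q"
proof -
  have "ln (1 + y) \<le> y" using ln_add_one_self_le_self [OF assms(1)] .
  then have "- (q * y) \<le> - (q * ln (1 + y))" using assms by (simp add: mult_left_mono)
  then have "1 - q * y \<le> 1 + - (q * ln (1 + y))" by simp
  also have "\<dots> \<le> exp (- (q * ln (1 + y)))" by (rule exp_ge_add_one_self)
  also have "\<dots> = (1 + y) powr (- q)" using assms by (simp add: powr_def)
  finally have "(1 - q * y) * (1 + y) powr q \<le> (1 + y) powr (- q) * (1 + y) powr q"
    by (intro mult_right_mono) auto
  also have "\<dots> = 1" using assms by (simp add: powr_add [symmetric])
  finally show ?thesis by (simp add: algebra_simps)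
qed

text \<open>By the mean value theorem each term is at most a difference of the antiderivative
  \<open>?f\<close>, and these differences telescope.\<close>

lemma sum_powr_bound:
  fixes R \<theta> :: real
  assumes R: "0 < R" and \<theta>: "1 < \<theta>"
  shows "(\<Sum>m=1..N. (1 + real m / R) powr (- \<theta>)) \<le> R / (\<theta> - 1)"
proof -
  let ?f = "\<lambda>x. R / (\<theta> - 1) * (1 + x / R) powr (1 - \<theta>)"
  have step: "(1 + real (Suc m) / R) powr (- \<theta>) \<le> ?f (real m) - ?f (real (Suc m))" for m
  proof -
    have d: "(?f has_real_derivative - ((1 + x / R) powr (- \<theta>))) (at x)" if "0 \<le> x" for x
    proof -
      have p: "0 < 1 + x / R" using R that by (simp add: add_pos_nonneg)
      have "((\<lambda>x. (1 + x / R) powr (1 - \<theta>)) has_real_derivative (1 - \<theta>) * (1 + x / R) powr (1 - \<theta> - 1) * (1 / R)) (at x)"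
        using p by (auto intro!: derivative_eq_intros simp: R[THEN less_imp_neq, symmetric])
      then have "(?f has_real_derivative R / (\<theta> - 1) * ((1 - \<theta>) * (1 + x / R) powr (1 - \<theta> - 1) * (1 / R))) (at x)"
        by (rule DERIV_cmult)
      moreover have "R / (\<theta> - 1) * ((1 - \<theta>) * (1 + x / R) powr (1 - \<theta> - 1) * (1 / R)) = - ((1 + x / R) powr (- \<theta>))"
        using R \<theta> by (simp add: field_simps)
      ultimately show ?thesis by simp
    qed
    obtain z where z: "real m < z" "z < real (Suc m)"
      "?f (real (Suc m)) - ?f (real m) = (real (Suc m) - real m) * - ((1 + z / R) powr (- \<theta>))"
      using MVT2 [of "real m" "real (Suc m)" ?f "\<lambda>x. - ((1 + x / R) powr (- \<theta>))"] d by auto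
    have "(1 + real (Suc m) / R) powr (- \<theta>) \<le> (1 + z / R) powr (- \<theta>)"
      using z R \<theta> by (intro powr_mono2') (auto simp: divide_right_mono add_pos_nonneg)
    then show ?thesis using z(3) by simp
  qed
  have "(\<Sum>m=1..N. (1 + real m / R) powr (- \<theta>)) \<le> ?f 0 - ?f (real N)"
  proof (induction N)
    case (Suc N)
    then show ?case using step [of N] by simp
  qed simp
  also have "\<dots> \<le> ?f 0" using R \<theta> by simp
  finally show ?thesis by simp
qed

lemma sum_int_powr_bound:
  fixes R \<theta> :: real
  assumes R: "1 \<le> R" and \<theta>: "1 < \<theta>"
  shows "(\<Sum>m\<in>{- int N..int N}. (1 + \<bar>real_of_int m\<bar> / R) powr (- \<theta>)) \<le> (1 + 2 / (\<theta> - 1)) * R"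
proof -
  let ?g = "\<lambda>m. (1 + \<bar>real_of_int m\<bar> / R) powr (- \<theta>)"
  have split: "{- int N..int N} = insert 0 (int ` {1..N} \<union> (\<lambda>m. - int m) ` {1..N})"
  proof (intro set_eqI iffI)
    fix x assume x: "x \<in> {- int N..int N}"
    consider "x = 0" | "x > 0" | "x < 0" by linarith
    then show "x \<in> insert 0 (int ` {1..N} \<union> (\<lambda>m. - int m) ` {1..N})"
    proof cases
      case 2
      then have "x = int (nat x)" "nat x \<in> {1..N}" using x by auto
      then show ?thesis by blast
    next
      case 3
      then have "x = - int (nat (- x))" "nat (- x) \<in> {1..N}" using x by auto
      then show ?thesis by blast
    qed simp
  qed auto
  have "sum ?g {- int N..int N} = ?g 0 + (sum ?g (int ` {1..N}) + sum ?g ((\<lambda>m. - int m) ` {1..N}))"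
    unfolding split by (subst sum.insert) (auto intro!: sum.union_disjoint)
  also have "sum ?g (int ` {1..N}) = (\<Sum>m=1..N. (1 + real m / R) powr (- \<theta>))"
    by (subst sum.reindex) auto
  also have "sum ?g ((\<lambda>m. - int m) ` {1..N}) = (\<Sum>m=1..N. (1 + real m / R) powr (- \<theta>))"
    by (subst sum.reindex) (auto simp: inj_on_def)
  also have "?g 0 + ((\<Sum>m=1..N. (1 + real m / R) powr (- \<theta>)) + (\<Sum>m=1..N. (1 + real m / R) powr (- \<theta>)))
      \<le> R + (R / (\<theta> - 1) + R / (\<theta> - 1))"
    using sum_powr_bound [of R \<theta> N] R \<theta> by (intro add_mono) auto
  also have "\<dots> = (1 + 2 / (\<theta> - 1)) * R" by (simp add: field_simps)
  finally show ?thesis .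
qed

text \<open>Distance on the scale \<open>R\<close>, shifted by \<open>1\<close> so that the triangle
  inequality becomes submultiplicativity and survives taking powers.\<close>

definition bracket :: "real \<Rightarrow> 'a::metric_space \<Rightarrow> 'a \<Rightarrow> real" where
  "bracket R x y = 1 + dist x y / R"

lemma bracket_ge_1: "0 < R \<Longrightarrow> 1 \<le> bracket R x y"
  by (simp add: bracket_def)

lemma bracket_pos: "0 < R \<Longrightarrow> 0 < bracket R x y"
  using bracket_ge_1 [of R x y] by linarith

lemma bracket_commute: "bracket R x y = bracket R y x"
  by (simp add: bracket_def dist_commute)

lemma bracket_self [simp]: "bracket R x x = 1"
  by (simp add: bracket_def)

lemma bracket_triangle:
  assumes "0 < R"
  shows "bracket R x z \<le> bracket R x y * bracket R y z"
proof -
  have "dist x z / R \<le> dist x y / R + dist y z / R"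
    using assms dist_triangle [of x z y] by (simp add: add_divide_distrib [symmetric] divide_right_mono)
  also have "\<dots> \<le> dist x y / R + dist y z / R + (dist x y / R) * (dist y z / R)"
    using assms by simp
  finally show ?thesis by (simp add: bracket_def algebra_simps)
qed

definition lattice_const :: "nat \<Rightarrow> real \<Rightarrow> real" where
  "lattice_const D q = (1 + 2 / (q / real D - 1)) ^ D"

lemma lattice_const_ge_1: "real D < q \<Longrightarrow> 1 \<le> lattice_const D q"
  unfolding lattice_const_def by (cases "D = 0") (auto intro!: one_le_power simp: field_simps)

text \<open>The exponent is divided evenly among the coordinates. No coordinate of
  \<open>x - y\<close> exceeds the distance, so each term is at most a product of one-dimensional
  terms with exponent \<open>\<theta> = q / D > 1\<close>, and the sum over a box of integer vectors
  factorizes. \<open>lattice_const\<close> is the power of the one-dimensional constant.\<close>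

lemma lattice_sum:
  fixes L :: "(real ^ 'd) set" and q R :: real
  assumes L: "finite L" "L \<subseteq> int_lattice" and x: "x \<in> int_lattice"
    and R: "1 \<le> R" and q: "real CARD('d) < q"
  shows "(\<Sum>y\<in>L. bracket R x y powr (- q)) \<le> lattice_const CARD('d) q * R ^ CARD('d)"
proof -
  define \<theta> where "\<theta> = q / real CARD('d)"
  have \<theta>: "1 < \<theta>" using q by (simp add: \<theta>_def)
  define g where "g m = (1 + \<bar>real_of_int m\<bar> / R) powr (- \<theta>)" for m
  define c where "c y = (\<lambda>k. \<lfloor>(x - y) $ k\<rfloor>)" for y
  have c: "real_of_int (c y k) = (x - y) $ k" if "y \<in> L" for y k
  proof -
    have "(x - y) $ k \<in> \<int>" using that L x by (auto simp: int_lattice_def)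
    then show ?thesis unfolding c_def by (metis Ints_cases of_int_floor_cancel)
  qed
  have inj: "inj_on c L"
  proof (rule inj_onI)
    fix y y' assume "y \<in> L" "y' \<in> L" "c y = c y'"
    then have "(x - y) $ k = (x - y') $ k" for k using c by metis
    then show "y = y'" by (simp add: vec_eq_iff)
  qed
  have "\<exists>N. \<forall>y\<in>L. \<forall>k. \<bar>c y k\<bar> \<le> int N"
  proof -
    have "finite ((\<lambda>(y, k). nat \<bar>c y k\<bar>) ` (L \<times> UNIV))" using L by simp
    then obtain N where "\<forall>m\<in>(\<lambda>(y, k). nat \<bar>c y k\<bar>) ` (L \<times> UNIV). m \<le> N"
      using finite_nat_set_iff_bounded_le by blast
    then have "\<forall>y\<in>L. \<forall>k. \<bar>c y k\<bar> \<le> int N" by (auto simp: nat_le_iff)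
    then show ?thesis by blast
  qed
  then obtain N where N: "\<And>y k. y \<in> L \<Longrightarrow> \<bar>c y k\<bar> \<le> int N" by blast
  have "(\<Sum>y\<in>L. bracket R x y powr (- q)) \<le> (\<Sum>y\<in>L. \<Prod>k\<in>UNIV. g (c y k))"
  proof (rule sum_mono)
    fix y assume y: "y \<in> L"
    have "bracket R x y powr (- q) = (\<Prod>k\<in>(UNIV::'d set). bracket R x y powr (- \<theta>))"
      using bracket_pos [of R x y] R by (simp add: powr_realpow [symmetric] powr_powr \<theta>_def)
    also have "\<dots> \<le> (\<Prod>k\<in>UNIV. g (c y k))"
    proof (rule prod_mono, intro conjI)
      fix k
      have "\<bar>(x - y) $ k\<bar> \<le> dist x y" by (metis component_le_norm_cart dist_norm)
      then show "bracket R x y powr (- \<theta>) \<le> g (c y k)"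
        unfolding g_def c [OF y] bracket_def using R \<theta>
        by (intro powr_mono2') (auto simp: divide_right_mono add_pos_nonneg)
    qed simp
    finally show "bracket R x y powr (- q) \<le> (\<Prod>k\<in>UNIV. g (c y k))" .
  qed
  also have "\<dots> = (\<Sum>f\<in>c ` L. \<Prod>k\<in>UNIV. g (f k))"
    by (subst sum.reindex [OF inj]) simp
  also have "\<dots> \<le> (\<Sum>f\<in>PiE UNIV (\<lambda>_::'d. {- int N..int N}). \<Prod>k\<in>UNIV. g (f k))"
  proof (rule sum_mono2)
    show "finite (PiE UNIV (\<lambda>_::'d. {- int N..int N}))" by (intro finite_PiE) auto
    show "c ` L \<subseteq> PiE UNIV (\<lambda>_. {- int N..int N})"
    proof (rule image_subsetI)
      fix y assume "y \<in> L"
      then have "- int N \<le> c y k \<and> c y k \<le> int N" for k using N [of y k] by linarith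
      then show "c y \<in> PiE UNIV (\<lambda>_. {- int N..int N})" by auto
    qed
  qed (auto simp: g_def intro: prod_nonneg)
  also have "\<dots> = (\<Prod>k\<in>(UNIV::'d set). \<Sum>m\<in>{- int N..int N}. g m)"
    by (rule prod_sum_PiE [symmetric]) auto
  also have "\<dots> \<le> (\<Prod>k\<in>(UNIV::'d set). (1 + 2 / (\<theta> - 1)) * R)"
    unfolding g_def by (intro prod_mono conjI sum_int_powr_bound sum_nonneg R \<theta>) auto
  also have "\<dots> = lattice_const CARD('d) q * R ^ CARD('d)"
    by (simp add: lattice_const_def \<theta>_def power_mult_distrib)
  finally show ?thesis .
qed

lemma int_lattice_dist:
  fixes x y :: "real ^ 'd"
  assumes "x \<in> int_lattice" "y \<in> int_lattice" "x \<noteq> y"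
  shows "1 \<le> dist x y"
proof -
  obtain k where k: "(x - y) $ k \<noteq> 0" using assms(3) by (auto simp: vec_eq_iff)
  have "(x - y) $ k \<in> \<int>" using assms by (auto simp: int_lattice_def)
  then have "1 \<le> \<bar>(x - y) $ k\<bar>" using k by (rule Ints_nonzero_abs_ge1)
  also have "\<dots> \<le> dist x y" by (metis component_le_norm_cart dist_norm)
  finally show ?thesis .
qed

lemma decay_le_bracket:
  fixes x y :: "real ^ 'd"
  assumes "x \<in> int_lattice" "y \<in> int_lattice" "0 \<le> \<alpha>"
  shows "decay \<alpha> x y \<le> 2 powr \<alpha> * bracket 1 x y powr (- \<alpha>)"
proof (cases "x = y")
  case True
  then show ?thesis using assms by (simp add: decay_def ge_one_powr_ge_zero)
next
  case False
  then have d: "1 \<le> dist x y" using int_lattice_dist assms by blast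
  have "decay \<alpha> x y = dist x y powr (- \<alpha>)" using False by (simp add: decay_def)
  also have "\<dots> \<le> (bracket 1 x y / 2) powr (- \<alpha>)"
    using d assms by (intro powr_mono2') (auto simp: bracket_def)
  also have "\<dots> = 2 powr \<alpha> * bracket 1 x y powr (- \<alpha>)"
    using bracket_pos [of 1 x y] by (simp add: powr_divide powr_minus field_simps)
  finally show ?thesis .
qed

section \<open>A priori bound on local particle numbers\<close>

definition logistic :: "real \<Rightarrow> real" where
  "logistic x = 1 / (1 + exp x)"

lemma logistic_pos: "0 < logistic x"
  by (simp add: logistic_def add_pos_pos)

lemma logistic_le_1: "logistic x \<le> 1"
  by (simp add: logistic_def divide_le_eq_1 add_pos_pos)

lemma logistic_le_exp: "logistic x \<le> exp (- x)"
  by (simp add: logistic_def exp_minus inverse_eq_divide frac_le)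

lemma logistic_ge_half: "x \<le> 0 \<Longrightarrow> 1 / 2 \<le> logistic x"
  by (simp add: logistic_def field_simps add_pos_pos)

lemma logistic_deriv:
  "(logistic has_real_derivative - (logistic x * (1 - logistic x))) (at x)"
proof -
  have p: "1 + exp x \<noteq> 0" using exp_gt_zero [of x] by linarith
  have "((\<lambda>x. 1 / (1 + exp x)) has_real_derivative - (exp x / (1 + exp x)\<^sup>2)) (at x)"
    using p by (auto intro!: derivative_eq_intros simp: power2_eq_square)
  moreover have "exp x / (1 + exp x)\<^sup>2 = logistic x * (1 - logistic x)"
    using p unfolding logistic_def by (simp add: field_simps power2_eq_square)
  ultimately show ?thesis unfolding logistic_def [abs_def] by simp
qed

lemma logistic_ratio:
  assumes "\<bar>x - y\<bar> \<le> z"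
  shows "logistic y \<le> exp z * logistic x"
proof -
  have "1 + exp x \<le> exp z + exp z * exp y"
    using assms by (intro add_mono) (auto simp: exp_add [symmetric])
  then have "1 + exp x \<le> exp z * (1 + exp y)" by (simp add: algebra_simps)
  moreover have "a \<le> c * b \<Longrightarrow> 1 / b \<le> c * (1 / a)" if "0 < a" "0 < b" for a b c :: real
    using that by (simp add: field_simps)
  ultimately show ?thesis
    unfolding logistic_def by (simp add: add_pos_pos)
qed

text \<open>The bound splits into minus the derivative at \<open>x\<close> and at \<open>y\<close>,
  as \<open>current_bound\<close> demands of \<open>p i j * p j i\<close>. After the substitution of
  \<open>a\<close> for \<open>exp (x / 2)\<close> and \<open>b\<close> for
  \<open>exp (y / 2)\<close> the identity behind it is rational; monotonicity of \<open>cosh\<close>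
  then replaces \<open>x - y\<close> by \<open>z\<close>.\<close>

lemma logistic_diff:
  assumes "\<bar>x - y\<bar> \<le> z"
  shows "(logistic x - logistic y)\<^sup>2 \<le>
    (logistic x * (1 - logistic x)) * (logistic y * (1 - logistic y)) * (exp (z / 2) - exp (- z / 2))\<^sup>2"
proof -
  have sq: "(exp (u / 2) - exp (- u / 2))\<^sup>2 = 2 * cosh u - 2" for u :: real
  proof -
    have "exp u = (exp (u / 2))\<^sup>2" "exp (- u) = (exp (- u / 2))\<^sup>2" "exp (u / 2) * exp (- u / 2) = 1"
      by (simp_all add: power2_eq_square exp_add [symmetric])
    then show ?thesis by (simp add: power2_diff cosh_def mult.assoc)
  qed
  have "(exp ((x - y) / 2) - exp (- (x - y) / 2))\<^sup>2 \<le> (exp (z / 2) - exp (- z / 2))\<^sup>2"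
  proof -
    have "cosh (x - y) = cosh \<bar>x - y\<bar>" by (rule cosh_real_abs [symmetric])
    also have "\<dots> \<le> cosh z" using assms by (subst cosh_real_nonneg_le_iff) auto
    finally show ?thesis unfolding sq by simp
  qed
  moreover have "(logistic x - logistic y)\<^sup>2 =
    (logistic x * (1 - logistic x)) * (logistic y * (1 - logistic y)) * (exp ((x - y) / 2) - exp (- (x - y) / 2))\<^sup>2"
  proof -
    have e: "exp x = exp (x / 2) ^ 2" "exp y = exp (y / 2) ^ 2" by (simp_all add: power2_eq_square exp_add [symmetric])
    have h: "exp ((x - y) / 2) = exp (x / 2) / exp (y / 2)" "exp (- (x - y) / 2) = exp (y / 2) / exp (x / 2)"
      by (simp_all add: diff_divide_distrib exp_diff)
    have "(1 / (1 + a\<^sup>2) - 1 / (1 + b\<^sup>2))\<^sup>2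
        = (1 / (1 + a\<^sup>2) * (1 - 1 / (1 + a\<^sup>2))) * (1 / (1 + b\<^sup>2) * (1 - 1 / (1 + b\<^sup>2))) * (a / b - b / a)\<^sup>2"
      if "0 < a" "0 < b" for a b :: real
    proof -
      have p: "0 < 1 + a\<^sup>2" "0 < 1 + b\<^sup>2" by (simp_all add: add_pos_nonneg)
      have 1: "1 / (1 + a\<^sup>2) - 1 / (1 + b\<^sup>2) = (b\<^sup>2 - a\<^sup>2) / ((1 + a\<^sup>2) * (1 + b\<^sup>2))"
        using p by (simp add: diff_frac_eq)
      have 2: "1 - 1 / (1 + c\<^sup>2) = c\<^sup>2 / (1 + c\<^sup>2)" if "0 < 1 + c\<^sup>2" for c :: real
        using that by (simp add: field_simps)
      have 3: "a / b - b / a = (a\<^sup>2 - b\<^sup>2) / (a * b)"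
        using that by (simp add: field_simps power2_eq_square)
      show ?thesis
        unfolding 1 2 [OF p(1)] 2 [OF p(2)] 3 power_divide power_mult_distrib power2_commute [of "b\<^sup>2"]
        using that p by (simp add: power2_eq_square)
    qed
    from this [of "exp (x / 2)" "exp (y / 2)"] show ?thesis
      unfolding logistic_def e h by simp
  qed
  ultimately show ?thesis
    using logistic_pos [of x] logistic_pos [of y] logistic_le_1 [of x] logistic_le_1 [of y]
    by (simp add: mult_left_mono)
qed

lemma exp_diff_half:
  assumes "0 \<le> (z::real)"
  shows "exp (z / 2) - exp (- z / 2) \<le> z * exp (z / 2)"
proof -
  have "exp (- z / 2) = exp (z / 2) * exp (- z)" by (simp add: exp_add [symmetric])
  moreover have "1 - z \<le> exp (- z)" using exp_ge_add_one_self [of "- z"] by simp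
  then have "exp (z / 2) * (1 - z) \<le> exp (z / 2) * exp (- z)" by (intro mult_left_mono) auto
  ultimately show ?thesis by (simp add: algebra_simps)
qed

lemma exp_le_bracket_powr:
  assumes "0 \<le> (q::real)" "0 \<le> x"
  shows "exp (- (q * x)) \<le> (1 + x) powr (- q)"
proof -
  have "ln (1 + x) \<le> x" using ln_add_one_self_le_self [OF assms(2)] .
  then have "- (q * x) \<le> - q * ln (1 + x)" using assms by (simp add: mult_left_mono)
  then show ?thesis using assms by (simp add: powr_def)
qed

section \<open>Long distances and weights with polynomial tails\<close>

definition far_const :: "real \<Rightarrow> real" where
  "far_const \<alpha> = (1 + 64 * \<alpha>) powr \<alpha>"

text \<open>If \<open>d\<close> is the distance, then
  \<open>R + d \<le> (1 + 64 * \<alpha>) * d\<close>. So decay on the scale \<open>1\<close> yields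
  the small factor \<open>R powr (- \<alpha>)\<close> and still decays with the same exponent on the
  scale \<open>R\<close>.\<close>

lemma far_bracket:
  assumes \<alpha>: "0 < \<alpha>" and R: "1 \<le> R" and far: "R / (64 * \<alpha>) \<le> dist x y"
  shows "bracket 1 x y powr (- \<alpha>) \<le> far_const \<alpha> * R powr (- \<alpha>) * bracket R x y powr (- \<alpha>)"
proof -
  have "R \<le> 64 * \<alpha> * dist x y" using far \<alpha> by (simp add: field_simps)
  then have "R * bracket R x y \<le> (1 + 64 * \<alpha>) * bracket 1 x y"
    using R \<alpha> by (simp add: bracket_def algebra_simps)
  then have "R * bracket R x y / (1 + 64 * \<alpha>) \<le> bracket 1 x y"
    using \<alpha> by (simp add: field_simps)
  then have "bracket 1 x y powr (- \<alpha>) \<le> (R * bracket R x y / (1 + 64 * \<alpha>)) powr (- \<alpha>)"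
    using R \<alpha> bracket_pos [of R x y] by (intro powr_mono2') auto
  also have "\<dots> = far_const \<alpha> * R powr (- \<alpha>) * bracket R x y powr (- \<alpha>)"
    using R \<alpha> bracket_pos [of R x y] by (simp add: far_const_def powr_divide powr_mult powr_minus field_simps)
  finally show ?thesis .
qed

text \<open>The exponent is a compromise. Since \<open>\<alpha> / 2 > D\<close> the weight is
  summable; since \<open>\<alpha> / 2 - 1 > D\<close> the hopping stays summable against
  \<open>bracket 1 i j powr (\<alpha> / 2 + 1)\<close>, which bounds the change of the weight along
  a hop; and the square of the weight decays like the hopping itself.\<close>

definition point_weight :: "real \<Rightarrow> real \<Rightarrow> 'a::metric_space \<Rightarrow> 'a \<Rightarrow> real" where
  "point_weight \<alpha> R x i = bracket R i x powr (- (\<alpha> / 2))"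

lemma point_weight_pos: "0 < R \<Longrightarrow> 0 < point_weight \<alpha> R x i"
  using bracket_pos [of R i x] by (simp add: point_weight_def)

lemma point_weight_square: "0 < R \<Longrightarrow> (point_weight \<alpha> R x i)\<^sup>2 = bracket R i x powr (- \<alpha>)"
  using bracket_pos [of R i x] by (simp add: point_weight_def power2_eq_square powr_add [symmetric])

lemma point_weight_le_1: "0 < R \<Longrightarrow> 0 < \<alpha> \<Longrightarrow> point_weight \<alpha> R x i \<le> 1"
  using bracket_ge_1 [of R i x] powr_mono [of "- (\<alpha> / 2)" 0 "bracket R i x"] by (simp add: point_weight_def)

lemma point_weight_ratio:
  assumes "0 < R" "0 < \<alpha>"
  shows "point_weight \<alpha> R x i \<le> bracket R i j powr (\<alpha> / 2) * point_weight \<alpha> R x j"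
proof -
  have b: "0 < bracket R i x" "0 < bracket R j x" "0 < bracket R i j" using assms bracket_pos by auto
  have "bracket R j x powr (\<alpha> / 2) \<le> (bracket R i j * bracket R i x) powr (\<alpha> / 2)"
    using assms b bracket_triangle [of R j x i] by (intro powr_mono2) (auto simp: bracket_commute)
  also have "\<dots> = bracket R i j powr (\<alpha> / 2) * bracket R i x powr (\<alpha> / 2)"
    using b by (simp add: powr_mult)
  finally show ?thesis
    using b by (simp add: point_weight_def powr_minus field_simps)
qed

locale lattice_hopping = hermitian_hopping L J
  for L :: "(real ^ 'd) set" and J :: "real ^ 'd \<Rightarrow> real ^ 'd \<Rightarrow> complex" +
  fixes \<alpha> K v :: real
  assumes lattice: "L \<subseteq> int_lattice"
    and \<alpha>: "3 * real CARD('d) + 1 < \<alpha>" and K: "0 \<le> K" and v: "0 < v"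
    and J_le: "\<And>i j. i \<in> L \<Longrightarrow> j \<in> L \<Longrightarrow> cmod (J i j) \<le> K * bracket 1 i j powr (- \<alpha>)"
    and velocity: "\<And>i. i \<in> L \<Longrightarrow> 2 * (\<Sum>j\<in>L. cmod (J i j) * dist i j) \<le> v"
begin

lemma D_ge_1: "1 \<le> real CARD('d)"
  by (simp add: Suc_leI)

lemma \<alpha>_gt: "4 < \<alpha>"
  using \<alpha> D_ge_1 by linarith

lemma J_sym: "i \<in> L \<Longrightarrow> j \<in> L \<Longrightarrow> cmod (J j i) = cmod (J i j)"
  using J [of i j] by simp

lemma coeff_sum:
  assumes c: "\<And>j. j \<in> L \<Longrightarrow> c j \<le> K * bracket 1 i j powr (- \<alpha>)" and i: "i \<in> L" and m: "real CARD('d) < \<alpha> - m"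
  shows "(\<Sum>j\<in>L. c j * bracket 1 i j powr m) \<le> K * lattice_const CARD('d) (\<alpha> - m)"
proof -
  have "(\<Sum>j\<in>L. c j * bracket 1 i j powr m) \<le> (\<Sum>j\<in>L. K * bracket 1 i j powr (- (\<alpha> - m)))"
  proof (rule sum_mono)
    fix j assume "j \<in> L"
    then have "c j * bracket 1 i j powr m \<le> K * bracket 1 i j powr (- \<alpha>) * bracket 1 i j powr m"
      by (intro mult_right_mono c) auto
    then show "c j * bracket 1 i j powr m \<le> K * bracket 1 i j powr (- (\<alpha> - m))"
      by (simp add: mult.assoc powr_add [symmetric])
  qed
  also have "\<dots> = K * (\<Sum>j\<in>L. bracket 1 i j powr (- (\<alpha> - m)))"
    by (simp add: sum_distrib_left)
  also have "\<dots> \<le> K * (lattice_const CARD('d) (\<alpha> - m) * 1 ^ CARD('d))"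
    using i lattice by (intro mult_left_mono K lattice_sum L m) auto
  finally show ?thesis by simp
qed

text \<open>A hop of length \<open>d\<close> changes the weight by a relative amount of order
  \<open>d / R\<close>, so the growth rate is of order \<open>1 / R\<close> and the moment grows
  only by a constant factor up to times of order \<open>R\<close>.\<close>

lemma apriori_moment:
  fixes V :: "real ^ 'd \<Rightarrow> real ^ 'd \<Rightarrow> real"
  assumes R: "1 \<le> R" and t: "0 \<le> t"
  shows "moment L M (point_weight \<alpha> R x) (time_evol (hamiltonian J V L) t \<psi>)
    \<le> exp (3 * (\<alpha> / 2) * K * lattice_const CARD('d) (\<alpha> / 2 - 1) / R * t) * moment L M (point_weight \<alpha> R x) \<psi>"
proof -
  define w where "w = point_weight \<alpha> R x"
  \<comment> \<open>The ratio cancels in \<open>p i j * p j i\<close>. It makes site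
    \<open>i\<close> pay in proportion to its own weight: the difference of the weights is at most a
    multiple of \<open>w j\<close>, so the quotient by \<open>w j\<close> leaves that multiple times
    \<open>w i\<close>.\<close>
  define p where "p i j = cmod (J i j) * \<bar>w i - w j\<bar> * (w i / w j)" for i j
  define a where "a = 3 * (\<alpha> / 2) * K * lattice_const CARD('d) (\<alpha> / 2 - 1) / R"
  have wpos: "0 < w i" for i unfolding w_def using R by (intro point_weight_pos) auto
  have dim: "real CARD('d) < \<alpha> / 2 - 1" using \<alpha> D_ge_1 by linarith
  have a0: "0 \<le> a"
    unfolding a_def using R K \<alpha>_gt lattice_const_ge_1 [OF dim] by auto
  have dw: "\<bar>w i - w j\<bar> \<le> (bracket R i j powr (\<alpha> / 2) - 1) * min (w i) (w j)" for i j
  proof -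
    have "w i \<le> bracket R i j powr (\<alpha> / 2) * w j" "w j \<le> bracket R i j powr (\<alpha> / 2) * w i"
      unfolding w_def using R \<alpha>_gt point_weight_ratio [of R \<alpha> x i j] point_weight_ratio [of R \<alpha> x j i]
      by (auto simp: bracket_commute)
    then show ?thesis by (simp add: min_def algebra_simps)
  qed
  have "moment L M w (time_evol (hamiltonian J V L) t \<psi>) \<le> exp (a * t) * (moment L M w \<psi> + 0 * 0 * t)"
  proof (rule moment_growth [where w = "\<lambda>_. w" and w' = "\<lambda>_ _. 0" and p = "\<lambda>_. p" and u = "\<lambda>_. 0" and b = 0 and B = 0])
    show "0 \<le> w i" for i using wpos less_imp_le by blast
    show "((\<lambda>s. w i) has_real_derivative 0) (at s)" for s i by simp
    show "0 \<le> p i j" for i j unfolding p_def using wpos [of i] wpos [of j] by simp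
    show "(cmod (J i j) * (w i - w j))\<^sup>2 \<le> p i j * p j i" if "i \<in> L" "j \<in> L" for i j
      unfolding p_def J_sym [OF that] using wpos [of i] wpos [of j]
      by (simp add: power_mult_distrib power2_eq_square abs_minus_commute [of "w j" "w i"] flip: abs_mult_self_eq [of "w i - w j"])
    show "2 * wnum L w n * wnum L (\<lambda>_. 0) n + (\<Sum>i\<in>L. real (n i) * (\<Sum>j\<in>L. p i j * (2 * wnum L w n - w i + w j)))
        \<le> a * (wnum L w n)\<^sup>2 + 0 * (wnum L (\<lambda>_. 0) n)\<^sup>2" for n
    proof -
      let ?N = "wnum L w n"
      have N0: "0 \<le> ?N" by (intro wnum_nonneg less_imp_le wpos)
      have "real (n i) * (\<Sum>j\<in>L. p i j * (2 * ?N - w i + w j)) \<le> real (n i) * (w i * (a * ?N))"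
        if i: "i \<in> L" for i
      proof (cases "n i = 0")
        case False
        have wN: "w i \<le> ?N" using wpos less_imp_le False by (intro wnum_ge_weight [OF L i]) auto
        have "p i j * (2 * ?N - w i + w j) \<le> 3 * (\<alpha> / 2) / R * (w i * ?N) * (cmod (J i j) * bracket 1 i j powr (\<alpha> / 2 + 1))"
          if j: "j \<in> L" for j
        proof -
          define e where "e = bracket R i j powr (\<alpha> / 2) - 1"
          have e0: "0 \<le> e" unfolding e_def using bracket_ge_1 [of R i j] R \<alpha>_gt by (simp add: ge_one_powr_ge_zero)
          have ei: "\<bar>w i - w j\<bar> \<le> e * w i" and ej: "\<bar>w i - w j\<bar> \<le> e * w j"
            using dw [of i j] e0 mult_left_mono [of "min (w i) (w j)" "w i" e] mult_left_mono [of "min (w i) (w j)" "w j" e]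
            unfolding e_def by auto
          \<comment> \<open>The main term uses the bound of the difference by
            \<open>e * w j\<close>. In the correction the last quotient is at most \<open>1\<close>,
            the difference is at most \<open>e * w i\<close>, and \<open>w i \<le> ?N\<close>
            because site \<open>i\<close> is occupied. Together this gives the factor
            \<open>3\<close>.\<close>
          have "\<bar>w i - w j\<bar> * (w i / w j) * (2 * ?N - w i + w j)
              = \<bar>w i - w j\<bar> / w j * (w i * (2 * ?N)) + \<bar>w i - w j\<bar> * w i * ((w j - w i) / w j)"
            using wpos [of j] by (simp add: field_simps)
          also have "\<dots> \<le> e * (w i * (2 * ?N)) + \<bar>w i - w j\<bar> * w i * 1"
            using wpos [of i] wpos [of j] N0 ej
            by (intro add_mono mult_right_mono mult_left_mono) (auto simp: divide_le_eq)
          also have "\<bar>w i - w j\<bar> * w i * 1 \<le> e * w i * ?N"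
            using ei wN wpos [of i] e0 by (simp add: mult_mono)
          finally have 1: "\<bar>w i - w j\<bar> * (w i / w j) * (2 * ?N - w i + w j) \<le> 3 * e * (w i * ?N)"
            by (simp add: algebra_simps)
          have "e \<le> \<alpha> / 2 * (dist i j / R) * (1 + dist i j / R) powr (\<alpha> / 2)"
            unfolding e_def bracket_def using R \<alpha>_gt by (intro one_add_powr_le) auto
          also have "\<dots> \<le> \<alpha> / 2 * (bracket 1 i j / R) * bracket 1 i j powr (\<alpha> / 2)"
          proof (intro mult_mono)
            have "dist i j / R \<le> dist i j / 1" using R by (intro divide_left_mono) auto
            then show "(1 + dist i j / R) powr (\<alpha> / 2) \<le> bracket 1 i j powr (\<alpha> / 2)"
              using R \<alpha>_gt by (intro powr_mono2) (auto simp: bracket_def)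
          qed (use R \<alpha>_gt in \<open>auto simp: bracket_def divide_right_mono\<close>)
          also have "\<dots> = \<alpha> / 2 / R * bracket 1 i j powr (\<alpha> / 2 + 1)"
            using bracket_pos [of 1 i j] by (simp add: powr_add)
          finally have 2: "e \<le> \<alpha> / 2 / R * bracket 1 i j powr (\<alpha> / 2 + 1)" .
          have "p i j * (2 * ?N - w i + w j) \<le> cmod (J i j) * (3 * e * (w i * ?N))"
            unfolding p_def using mult_left_mono [OF 1, of "cmod (J i j)"] by (simp add: mult.assoc)
          also have "\<dots> \<le> cmod (J i j) * (3 * (\<alpha> / 2 / R * bracket 1 i j powr (\<alpha> / 2 + 1)) * (w i * ?N))"
            using 2 wpos [of i] N0 by (intro mult_left_mono mult_right_mono) auto
          finally show ?thesis by (simp add: mult_ac)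
        qed
        then have "(\<Sum>j\<in>L. p i j * (2 * ?N - w i + w j))
            \<le> (\<Sum>j\<in>L. 3 * (\<alpha> / 2) / R * (w i * ?N) * (cmod (J i j) * bracket 1 i j powr (\<alpha> / 2 + 1)))"
          by (rule sum_mono)
        also have "\<dots> = 3 * (\<alpha> / 2) / R * (w i * ?N) * (\<Sum>j\<in>L. cmod (J i j) * bracket 1 i j powr (\<alpha> / 2 + 1))"
          by (simp add: sum_distrib_left)
        also have "\<dots> \<le> 3 * (\<alpha> / 2) / R * (w i * ?N) * (K * lattice_const CARD('d) (\<alpha> - (\<alpha> / 2 + 1)))"
          using R \<alpha>_gt wpos [of i] N0 dim i by (intro mult_left_mono coeff_sum J_le) auto
        also have "\<alpha> - (\<alpha> / 2 + 1) = \<alpha> / 2 - 1" by (simp add: field_simps)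
        finally have "(\<Sum>j\<in>L. p i j * (2 * ?N - w i + w j)) \<le> w i * (a * ?N)"
          unfolding a_def by (simp add: mult_ac)
        then show ?thesis by (intro mult_left_mono) auto
      qed simp
      then have "(\<Sum>i\<in>L. real (n i) * (\<Sum>j\<in>L. p i j * (2 * ?N - w i + w j))) \<le> (\<Sum>i\<in>L. real (n i) * (w i * (a * ?N)))"
        by (rule sum_mono)
      also have "\<dots> = a * ?N * (\<Sum>i\<in>L. w i * real (n i))" by (simp add: sum_distrib_left mult_ac)
      also have "\<dots> = a * ?N\<^sup>2" by (simp add: wnum_def [symmetric] power2_eq_square)
      finally show ?thesis by (simp add: wnum_def [of L "\<lambda>_. 0"])
    qed
    show "moment L M (\<lambda>_. 0) (time_evol (hamiltonian J V L) s \<psi>) \<le> 0" for s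
      by (simp add: moment_def wnum_def)
  qed (use t a0 in auto)
  then show ?thesis by (simp add: w_def a_def)
qed

end

section \<open>Propagation with the hopping velocity\<close>

text \<open>The second-order correction to the speed of the short hops must fit into
  \<open>v / 4\<close>, the margin between \<open>v / 2\<close>, half of the velocity hypothesis,
  and the front speed \<open>3 * v / 4\<close>. It is of order \<open>ln R / sqrt R\<close>, so the
  condition holds for all large \<open>R\<close>.\<close>

definition slow_tail :: "real \<Rightarrow> nat \<Rightarrow> real \<Rightarrow> real \<Rightarrow> real \<Rightarrow> bool" where
  "slow_tail \<alpha> D K v R \<longleftrightarrow> 32 * \<alpha> * K * lattice_const D (\<alpha> - 2) * (ln R / sqrt R) \<le> v / 4"

definition long_const :: "real \<Rightarrow> nat \<Rightarrow> real \<Rightarrow> real" where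
  "long_const \<alpha> D K = K * far_const \<alpha> * lattice_const D \<alpha>"

context lattice_hopping
begin

lemma far_sum:
  assumes c: "\<And>j. j \<in> L \<Longrightarrow> c j \<le> K * bracket 1 i j powr (- \<alpha>)" and i: "i \<in> L" and R: "1 \<le> R"
  shows "(\<Sum>j\<in>{j \<in> L. R / (64 * \<alpha>) < dist i j}. c j)
    \<le> long_const \<alpha> CARD('d) K * (R ^ CARD('d) * R powr (- \<alpha>))"
proof -
  have "(\<Sum>j\<in>{j \<in> L. R / (64 * \<alpha>) < dist i j}. c j)
      \<le> (\<Sum>j\<in>{j \<in> L. R / (64 * \<alpha>) < dist i j}. K * (far_const \<alpha> * R powr (- \<alpha>) * bracket R i j powr (- \<alpha>)))"
  proof (rule sum_mono)
    fix j assume j: "j \<in> {j \<in> L. R / (64 * \<alpha>) < dist i j}"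
    then have "c j \<le> K * bracket 1 i j powr (- \<alpha>)" by (intro c) auto
    also have "\<dots> \<le> K * (far_const \<alpha> * R powr (- \<alpha>) * bracket R i j powr (- \<alpha>))"
      using j \<alpha>_gt by (intro mult_left_mono far_bracket K R) auto
    finally show "c j \<le> K * (far_const \<alpha> * R powr (- \<alpha>) * bracket R i j powr (- \<alpha>))" .
  qed
  also have "\<dots> \<le> (\<Sum>j\<in>L. K * (far_const \<alpha> * R powr (- \<alpha>) * bracket R i j powr (- \<alpha>)))"
    using K L by (intro sum_mono2) (auto simp: far_const_def)
  also have "\<dots> = K * far_const \<alpha> * R powr (- \<alpha>) * (\<Sum>j\<in>L. bracket R i j powr (- \<alpha>))"
    by (simp add: sum_distrib_left mult_ac)
  also have "\<dots> \<le> K * far_const \<alpha> * R powr (- \<alpha>) * (lattice_const CARD('d) \<alpha> * R ^ CARD('d))"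
    using i lattice \<alpha> D_ge_1 K by (intro mult_left_mono lattice_sum L R) (auto simp: far_const_def)
  finally show ?thesis by (simp add: long_const_def mult_ac)
qed

text \<open>The exponent \<open>2 * \<alpha>\<close> of the weight is used twice: one
  \<open>\<alpha>\<close> converts decay between \<open>i\<close> and \<open>j\<close> into decay
  between \<open>i\<close> and \<open>x\<close> by submultiplicativity, the other makes the sum over
  \<open>j\<close> converge.\<close>

lemma far_sum_weighted:
  assumes c: "\<And>j. j \<in> L \<Longrightarrow> c j \<le> K * bracket 1 i j powr (- \<alpha>)" and i: "i \<in> L" and x: "x \<in> L" and R: "1 \<le> R"
    and w: "\<And>j. j \<in> L \<Longrightarrow> 0 \<le> w j" "\<And>j. j \<in> L \<Longrightarrow> w j \<le> W * bracket R j x powr (- (2 * \<alpha>))" and W: "0 \<le> W"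
  shows "(\<Sum>j\<in>{j \<in> L. R / (64 * \<alpha>) < dist i j}. c j * w j)
    \<le> W * long_const \<alpha> CARD('d) K * (R ^ CARD('d) * R powr (- \<alpha>)) * bracket R i x powr (- \<alpha>)"
proof -
  define A where "A = W * K * far_const \<alpha> * R powr (- \<alpha>) * bracket R i x powr (- \<alpha>)"
  have A0: "0 \<le> A" unfolding A_def using K W by (simp add: far_const_def)
  have "(\<Sum>j\<in>{j \<in> L. R / (64 * \<alpha>) < dist i j}. c j * w j)
      \<le> (\<Sum>j\<in>{j \<in> L. R / (64 * \<alpha>) < dist i j}. A * bracket R x j powr (- \<alpha>))"
  proof (rule sum_mono)
    fix j assume j: "j \<in> {j \<in> L. R / (64 * \<alpha>) < dist i j}"
    have b: "0 < bracket R i j" "0 < bracket R j x" "0 < bracket R i x" using R by (simp_all add: bracket_pos)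
    have "c j * w j \<le> K * bracket 1 i j powr (- \<alpha>) * (W * bracket R j x powr (- (2 * \<alpha>)))"
    proof -
      have "c j * w j \<le> K * bracket 1 i j powr (- \<alpha>) * w j"
        using j by (intro mult_right_mono c w) auto
      also have "\<dots> \<le> K * bracket 1 i j powr (- \<alpha>) * (W * bracket R j x powr (- (2 * \<alpha>)))"
        using j K by (intro mult_left_mono w) auto
      finally show ?thesis .
    qed
    also have "\<dots> \<le> K * (far_const \<alpha> * R powr (- \<alpha>) * bracket R i j powr (- \<alpha>)) * (W * bracket R j x powr (- (2 * \<alpha>)))"
      using j \<alpha>_gt W by (intro mult_right_mono mult_left_mono far_bracket K R) auto
    also have "\<dots> = W * K * far_const \<alpha> * R powr (- \<alpha>) * (bracket R i j * bracket R j x) powr (- \<alpha>) * bracket R j x powr (- \<alpha>)"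
    proof -
      have "bracket R j x powr (- (2 * \<alpha>)) = bracket R j x powr (- \<alpha>) * bracket R j x powr (- \<alpha>)"
        using b by (simp add: powr_add [symmetric])
      then show ?thesis using b by (simp add: powr_mult mult_ac)
    qed
    also have "\<dots> \<le> W * K * far_const \<alpha> * R powr (- \<alpha>) * bracket R i x powr (- \<alpha>) * bracket R j x powr (- \<alpha>)"
      using K W b \<alpha>_gt bracket_triangle [of R i x j] R
      by (intro mult_left_mono mult_right_mono powr_mono2') (auto simp: far_const_def)
    finally show "c j * w j \<le> A * bracket R x j powr (- \<alpha>)"
      by (simp add: A_def bracket_commute)
  qed
  also have "\<dots> \<le> (\<Sum>j\<in>L. A * bracket R x j powr (- \<alpha>))"
    using A0 L by (intro sum_mono2) auto
  also have "\<dots> = A * (\<Sum>j\<in>L. bracket R x j powr (- \<alpha>))"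
    by (simp add: sum_distrib_left)
  also have "\<dots> \<le> A * (lattice_const CARD('d) \<alpha> * R ^ CARD('d))"
    using x lattice \<alpha> D_ge_1 A0 by (intro mult_left_mono lattice_sum L R) auto
  finally show ?thesis by (simp add: A_def long_const_def mult_ac)
qed

text \<open>Hops shorter than \<open>R / (64 \<alpha>)\<close> see only weight ratios below \<open>R powr (1/2)\<close>, so they move the
  weight almost as slowly as the first moment of the hopping allows.\<close>

lemma near_sum:
  assumes i: "i \<in> L" and R: "2 \<le> R" and slow: "slow_tail \<alpha> CARD('d) K v R"
  defines "\<mu> \<equiv> 16 * \<alpha> * ln R / R"
  shows "(\<Sum>j\<in>{j \<in> L. dist i j \<le> R / (64 * \<alpha>)}. cmod (J i j) *
      (exp (\<mu> * dist i j / 2) - exp (- (\<mu> * dist i j) / 2)) * exp (\<mu> * dist i j)) \<le> \<mu> * (3 * v / 4)"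
proof -
  have \<mu>: "0 \<le> \<mu>" unfolding \<mu>_def using R \<alpha>_gt by simp
  have dim: "real CARD('d) < \<alpha> - 2" using \<alpha> D_ge_1 by linarith
  have "(\<Sum>j\<in>{j \<in> L. dist i j \<le> R / (64 * \<alpha>)}. cmod (J i j) *
      (exp (\<mu> * dist i j / 2) - exp (- (\<mu> * dist i j) / 2)) * exp (\<mu> * dist i j))
    \<le> (\<Sum>j\<in>{j \<in> L. dist i j \<le> R / (64 * \<alpha>)}. \<mu> * (cmod (J i j) * dist i j + 2 * \<mu> * sqrt R * (cmod (J i j) * bracket 1 i j powr 2)))"
  proof (rule sum_mono)
    fix j assume j: "j \<in> {j \<in> L. dist i j \<le> R / (64 * \<alpha>)}"
    define z where "z = \<mu> * dist i j"
    have z: "0 \<le> z" unfolding z_def using \<mu> by simp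
    \<comment> \<open>The cutoff \<open>R / (64 * \<alpha>)\<close> is matched to the slope
      \<open>16 * \<alpha> * ln R / R\<close>: their product is \<open>ln R / 4\<close>.\<close>
    have "2 * z \<le> 2 * (\<mu> * (R / (64 * \<alpha>)))" unfolding z_def using j \<mu> by (intro mult_left_mono) auto
    also have "\<dots> = ln R / 2" unfolding \<mu>_def using R \<alpha>_gt by simp
    finally have "exp (2 * z) \<le> exp (ln R / 2)" by simp
    also have "\<dots> = sqrt R" using R by (simp add: powr_half_sqrt [symmetric] powr_def)
    finally have 1: "exp (2 * z) \<le> sqrt R" .
    have "1 - 2 * z \<le> exp (- (2 * z))" using exp_ge_add_one_self [of "- (2 * z)"] by simp
    then have "exp (2 * z) * (1 - 2 * z) \<le> exp (2 * z) * exp (- (2 * z))" by (intro mult_left_mono) auto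
    also have "\<dots> = 1" by (simp add: exp_add [symmetric])
    finally have "exp (2 * z) \<le> 1 + 2 * z * exp (2 * z)" by (simp add: algebra_simps)
    also have "\<dots> \<le> 1 + 2 * z * sqrt R" using 1 z by (intro add_left_mono mult_left_mono) auto
    finally have 2: "exp (2 * z) \<le> 1 + 2 * z * sqrt R" .
    have "(exp (z / 2) - exp (- z / 2)) * exp z \<le> z * exp (z / 2) * exp z"
      by (intro mult_right_mono exp_diff_half z) auto
    also have "\<dots> = z * exp (3 / 2 * z)" by (simp add: mult.assoc exp_add [symmetric])
    also have "\<dots> \<le> z * exp (2 * z)" using z by (intro mult_left_mono) auto
    also have "\<dots> \<le> z * (1 + 2 * z * sqrt R)" using 2 z by (intro mult_left_mono) auto
    also have "\<dots> = \<mu> * (dist i j + 2 * \<mu> * sqrt R * (dist i j)\<^sup>2)"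
      unfolding z_def by (simp add: algebra_simps power2_eq_square)
    also have "\<dots> \<le> \<mu> * (dist i j + 2 * \<mu> * sqrt R * bracket 1 i j powr 2)"
    proof -
      have "(dist i j)\<^sup>2 \<le> (bracket 1 i j)\<^sup>2" by (intro power_mono) (auto simp: bracket_def)
      also have "\<dots> = bracket 1 i j powr 2" using bracket_pos [of 1 i j] by (simp add: powr_numeral)
      finally show ?thesis using \<mu> R by (intro mult_left_mono add_left_mono) auto
    qed
    finally have "cmod (J i j) * ((exp (z / 2) - exp (- z / 2)) * exp z)
        \<le> cmod (J i j) * (\<mu> * (dist i j + 2 * \<mu> * sqrt R * bracket 1 i j powr 2))"
      by (intro mult_left_mono) auto
    then show "cmod (J i j) * (exp (\<mu> * dist i j / 2) - exp (- (\<mu> * dist i j) / 2)) * exp (\<mu> * dist i j)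
        \<le> \<mu> * (cmod (J i j) * dist i j + 2 * \<mu> * sqrt R * (cmod (J i j) * bracket 1 i j powr 2))"
      unfolding z_def by (simp add: algebra_simps)
  qed
  also have "\<dots> \<le> (\<Sum>j\<in>L. \<mu> * (cmod (J i j) * dist i j + 2 * \<mu> * sqrt R * (cmod (J i j) * bracket 1 i j powr 2)))"
    using \<mu> R L by (intro sum_mono2) auto
  also have "\<dots> = \<mu> * ((\<Sum>j\<in>L. cmod (J i j) * dist i j) + 2 * \<mu> * sqrt R * (\<Sum>j\<in>L. cmod (J i j) * bracket 1 i j powr 2))"
    by (simp add: sum_distrib_left sum.distrib distrib_left)
  also have "\<dots> \<le> \<mu> * (v / 2 + 2 * \<mu> * sqrt R * (K * lattice_const CARD('d) (\<alpha> - 2)))"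
    using velocity [OF i] \<mu> R by (intro mult_left_mono add_mono coeff_sum J_le i dim) auto
  also have "2 * \<mu> * sqrt R * (K * lattice_const CARD('d) (\<alpha> - 2))
      = 32 * \<alpha> * K * lattice_const CARD('d) (\<alpha> - 2) * (ln R / sqrt R)"
  proof -
    have "sqrt R / R = 1 / sqrt R" using R by (simp add: field_simps)
    then have 1: "\<mu> * sqrt R = 16 * \<alpha> * (ln R / sqrt R)"
      unfolding \<mu>_def by (metis (no_types, lifting) mult.assoc mult.right_neutral times_divide_eq_left times_divide_eq_right)
    show ?thesis unfolding mult.assoc [of 2] 1 by simp
  qed
  also have "\<mu> * (v / 2 + 32 * \<alpha> * K * lattice_const CARD('d) (\<alpha> - 2) * (ln R / sqrt R)) \<le> \<mu> * (v / 2 + v / 4)"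
    using slow \<mu> unfolding slow_tail_def by (intro mult_left_mono add_left_mono) auto
  finally show ?thesis by simp
qed

end

section \<open>The moving front\<close>

definition tail_const :: "real \<Rightarrow> nat \<Rightarrow> real \<Rightarrow> real" where
  "tail_const \<alpha> D K = 3 powr (2 * \<alpha>) * long_const \<alpha> D K"

text \<open>The factor \<open>4\<close> comes from the weight \<open>1 / 2\<close> at the observed
  site, the exponential from a growth rate of order \<open>1 / R\<close> during a time at most
  \<open>R / v\<close>, the \<open>1\<close> from the initial moment and the last summand from long
  hops during the evolution.\<close>

definition spread_const :: "real \<Rightarrow> nat \<Rightarrow> real \<Rightarrow> real \<Rightarrow> real" where
  "spread_const \<alpha> D K v = 4 * exp ((2 * long_const \<alpha> D K + tail_const \<alpha> D K) / v) * (1 + 2 * tail_const \<alpha> D K / v)"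

context lattice_hopping
begin

lemma long_const_nonneg: "0 \<le> long_const \<alpha> CARD('d) K"
proof -
  have "1 \<le> lattice_const CARD('d) \<alpha>" by (rule lattice_const_ge_1) (use \<alpha> D_ge_1 in linarith)
  then show ?thesis using K by (simp add: long_const_def far_const_def)
qed

lemma tail_const_nonneg: "0 \<le> tail_const \<alpha> CARD('d) K"
  using long_const_nonneg by (simp add: tail_const_def)

text \<open>Up to distance \<open>2 * R\<close> the bracket is at most \<open>3\<close> and the
  trivial bound \<open>1\<close> suffices. Beyond it the front at \<open>c \<le> R\<close> is at
  least \<open>d / 2\<close> away and exponential decay wins.\<close>

lemma logistic_weight_tail:
  assumes R: "2 \<le> R" and d: "0 \<le> d" and c: "c \<le> R"
  shows "logistic (16 * \<alpha> * ln R / R * (d - c)) \<le> 3 powr (2 * \<alpha>) * (1 + d / R) powr (- (2 * \<alpha>))"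
proof (cases "d \<le> 2 * R")
  case True
  then have "1 + d / R \<le> 3" using R by (simp add: field_simps)
  then have "3 powr (- (2 * \<alpha>)) \<le> (1 + d / R) powr (- (2 * \<alpha>))"
    using d R \<alpha>_gt by (intro powr_mono2') (auto simp: add_pos_nonneg)
  then have "3 powr (2 * \<alpha>) * 3 powr (- (2 * \<alpha>)) \<le> 3 powr (2 * \<alpha>) * (1 + d / R) powr (- (2 * \<alpha>))"
    by (intro mult_left_mono) auto
  then have "1 \<le> 3 powr (2 * \<alpha>) * (1 + d / R) powr (- (2 * \<alpha>))"
    by (simp add: powr_add [symmetric])
  then show ?thesis using logistic_le_1 order_trans by blast
next
  case False
  have l: "1 / 2 \<le> ln R"
  proof -
    have "ln 2 \<le> ln R" using R by simp
    then show ?thesis using ln2_ge_two_thirds by linarith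
  qed
  have "logistic (16 * \<alpha> * ln R / R * (d - c)) \<le> exp (- (16 * \<alpha> * ln R / R * (d - c)))"
    by (rule logistic_le_exp)
  also have "\<dots> \<le> exp (- (2 * \<alpha> * (d / R)))"
  proof -
    have "2 * \<alpha> * (d / R) \<le> 16 * \<alpha> * (1 / 2) / R * (d / 2)"
      using R d \<alpha>_gt by (simp add: field_simps)
    also have "\<dots> \<le> 16 * \<alpha> * ln R / R * (d - c)"
      using R d c l \<alpha>_gt False by (intro mult_mono divide_right_mono mult_left_mono) auto
    finally show ?thesis by simp
  qed
  also have "\<dots> \<le> (1 + d / R) powr (- (2 * \<alpha>))"
    using R d \<alpha>_gt by (intro exp_le_bracket_powr) auto
  also have "\<dots> \<le> 3 powr (2 * \<alpha>) * (1 + d / R) powr (- (2 * \<alpha>))"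
    using \<alpha>_gt ge_one_powr_ge_zero [of 3 "2 * \<alpha>"]
      mult_right_mono [of 1 "3 powr (2 * \<alpha>)" "(1 + d / R) powr (- (2 * \<alpha>))"] by simp
  finally show ?thesis .
qed

text \<open>From \<open>7 / 8 * R \<le> d\<close> follows \<open>d / 7 \<le> d - 3 / 4 * R\<close>.
  One half of this gap gives \<open>R powr (- \<alpha>)\<close>, with equality of exponents at
  \<open>d = 7 / 8 * R\<close>, which fixes the \<open>16\<close> in the slope; the other half gives
  the tail of \<open>point_weight\<close>, using \<open>1 / 2 \<le> ln R\<close>.\<close>

lemma logistic_weight_initial:
  assumes R: "2 \<le> R" and d: "7 / 8 * R \<le> d"
  shows "logistic (16 * \<alpha> * ln R / R * (d - 3 / 4 * R)) \<le> R powr (- \<alpha>) * (1 + d / R) powr (- (\<alpha> / 2))"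
proof -
  have l: "1 / 2 \<le> ln R"
  proof -
    have "ln 2 \<le> ln R" using R by simp
    then show ?thesis using ln2_ge_two_thirds by linarith
  qed
  have "logistic (16 * \<alpha> * ln R / R * (d - 3 / 4 * R)) \<le> exp (- (16 * \<alpha> * ln R / R * (d - 3 / 4 * R)))"
    by (rule logistic_le_exp)
  also have "\<dots> \<le> exp (- (\<alpha> * ln R) - \<alpha> / 2 * (d / R))"
  proof -
    have "\<alpha> * ln R + \<alpha> / 2 * (d / R) \<le> 16 * \<alpha> * ln R / R * (1 / 14 * d) + 16 * \<alpha> * ln R / R * (1 / 14 * d)"
    proof (rule add_mono)
      have "\<alpha> * ln R = 16 * \<alpha> * ln R / R * (1 / 14 * (7 / 8 * R))" using R by simp
      also have "\<dots> \<le> 16 * \<alpha> * ln R / R * (1 / 14 * d)"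
        using R l \<alpha>_gt d by (intro mult_left_mono) auto
      finally show "\<alpha> * ln R \<le> 16 * \<alpha> * ln R / R * (1 / 14 * d)" .
      have "\<alpha> / 2 * (d / R) \<le> 16 * \<alpha> * (1 / 2) / R * (1 / 14 * d)"
        using R d \<alpha>_gt by (simp add: field_simps)
      also have "\<dots> \<le> 16 * \<alpha> * ln R / R * (1 / 14 * d)"
        using R d l \<alpha>_gt by (intro mult_right_mono divide_right_mono mult_left_mono) auto
      finally show "\<alpha> / 2 * (d / R) \<le> 16 * \<alpha> * ln R / R * (1 / 14 * d)" .
    qed
    also have "\<dots> = 16 * \<alpha> * ln R / R * (d / 7)" by (simp add: algebra_simps)
    also have "\<dots> \<le> 16 * \<alpha> * ln R / R * (d - 3 / 4 * R)"
      using R l \<alpha>_gt d by (intro mult_left_mono) auto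
    finally show ?thesis by simp
  qed
  also have "\<dots> = exp (- \<alpha> * ln R) * exp (- (\<alpha> / 2 * (d / R)))"
    by (simp add: exp_add [symmetric])
  also have "\<dots> \<le> R powr (- \<alpha>) * (1 + d / R) powr (- (\<alpha> / 2))"
    using R d \<alpha>_gt by (intro mult_mono exp_le_bracket_powr) (auto simp: powr_def)
  finally show ?thesis .
qed

text \<open>The front starts at distance \<open>3 / 4 * R\<close> from \<open>x\<close>, which
  leaves a gap of \<open>R / 8\<close> to the initial particles, and moves towards \<open>x\<close>,
  where it cannot arrive before the time \<open>R / v\<close>. What remains are long hops, of
  strength \<open>\<eta>\<close> per unit of time. The norm is thus of order
  \<open>R * \<eta>\<close> times the a priori density.\<close>

lemma propagation:
  fixes V :: "real ^ 'd \<Rightarrow> real ^ 'd \<Rightarrow> real"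
  defines "U \<equiv> time_evol (hamiltonian J V L)"
  assumes x: "x \<in> L" and R: "2 \<le> R" and slow: "slow_tail \<alpha> CARD('d) K v R"
    and t: "0 \<le> t" "v * t \<le> R"
    and empty: "\<And>n i. n \<in> F M \<Longrightarrow> \<psi> n \<noteq> 0 \<Longrightarrow> i \<in> L \<Longrightarrow> n i \<noteq> 0 \<Longrightarrow> 7 / 8 * R \<le> dist i x"
    and B: "\<And>s. 0 \<le> s \<Longrightarrow> s \<le> t \<Longrightarrow> moment L M (point_weight \<alpha> R x) (U s \<psi>) \<le> B"
  shows "(nrm (F M) (occ x (U t \<psi>)))\<^sup>2
    \<le> spread_const \<alpha> CARD('d) K v * (R * (R ^ CARD('d) * R powr (- \<alpha>)))\<^sup>2 * B"
proof -
  define \<mu> where "\<mu> = 16 * \<alpha> * ln R / R"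
  define \<eta> where "\<eta> = R ^ CARD('d) * R powr (- \<alpha>)"
  \<comment> \<open>The two charges for long hops are balanced for a second-order result:
    \<open>\<tau> * \<eta> = 1 / R\<close> is a harmless growth rate, and the source
    \<open>\<eta> / \<tau> = R * \<eta>\<^sup>2\<close> adds up to order
    \<open>(R * \<eta>)\<^sup>2\<close> in time \<open>R / v\<close>. Equal charges would leave a
    source of first order in \<open>\<eta>\<close>, and the norm would only be its square
    root.\<close>
  define \<tau> where "\<tau> = 1 / (R * \<eta>)"
  define c1 where "c1 = long_const \<alpha> CARD('d) K"
  define c2 where "c2 = tail_const \<alpha> CARD('d) K"
  define w where "w s i = logistic (\<mu> * (dist i x - (3 / 4 * R - 3 * v / 4 * s)))" for s i
  define w' where "w' s i = - (w s i * (1 - w s i)) * (\<mu> * (3 * v / 4))" for s i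
  \<comment> \<open>A short hop is charged through the derivative of the profile, so the drift can
    pay for it. For a long hop between different weights the heavier end pays the small share
    \<open>\<tau>\<close> and the lighter one the share \<open>1 / \<tau>\<close>, both relative to
    the larger weight; between equal weights nothing has to be paid for.\<close>
  define p where "p s i j = (if dist i j \<le> R / (64 * \<alpha>)
      then cmod (J i j) * (w s i * (1 - w s i)) * (exp (\<mu> * dist i j / 2) - exp (- (\<mu> * dist i j) / 2))
      else if w s j \<le> w s i then cmod (J i j) * (\<tau> * w s i) else cmod (J i j) * (w s j / \<tau>))" for s i j
  define u where "u = point_weight \<alpha> R x"
  have \<mu>: "0 < \<mu>" unfolding \<mu>_def using R \<alpha>_gt by simp
  have \<eta>: "0 < \<eta>" unfolding \<eta>_def using R by simp
  have R\<eta>: "R * \<eta> \<le> 1"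
  proof -
    have "R * \<eta> = R powr (1 + real CARD('d) - \<alpha>)"
      unfolding \<eta>_def using R by (simp add: powr_realpow [symmetric] powr_diff powr_add powr_minus field_simps)
    also have "\<dots> \<le> R powr 0" using R \<alpha> D_ge_1 by (intro powr_mono) auto
    finally show ?thesis using R by simp
  qed
  have \<tau>: "0 < \<tau>" "\<tau> * \<eta> = 1 / R" "\<eta> / \<tau> = R * \<eta>\<^sup>2"
    unfolding \<tau>_def using R \<eta> by (simp_all add: power2_eq_square)
  have c1: "0 \<le> c1" and c2: "0 \<le> c2"
    unfolding c1_def c2_def by (rule long_const_nonneg, rule tail_const_nonneg)
  have w0: "0 < w s i" and w1: "w s i \<le> 1" for s i
    unfolding w_def by (rule logistic_pos, rule logistic_le_1)
  have h0: "0 \<le> w s i * (1 - w s i)" for s i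
    using w0 [of s i] w1 [of s i] by simp
  have \<sigma>0: "0 \<le> exp (\<mu> * dist i j / 2) - exp (- (\<mu> * dist i j) / 2)" for i j :: "real ^ 'd"
    using \<mu> by simp
  have u0: "0 \<le> u i" for i unfolding u_def using R point_weight_pos [of R \<alpha> x i] by simp
  have near: "\<bar>\<mu> * (dist i x - c) - \<mu> * (dist j x - c)\<bar> \<le> \<mu> * dist i j" for i j c
  proof -
    have "\<bar>dist i x - dist j x\<bar> \<le> dist i j" using dist_triangle [of i x j] dist_triangle [of j x i] by (simp add: dist_commute abs_le_iff)
    moreover have "\<mu> * (dist i x - c) - \<mu> * (dist j x - c) = \<mu> * (dist i x - dist j x)" by (simp add: algebra_simps)
    ultimately show ?thesis using \<mu> by (simp add: abs_mult)
  qed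
  have B0: "0 \<le> B" using B [of 0] t moment_nonneg [of L M "point_weight \<alpha> R x" "U 0 \<psi>"] by simp
  have growth: "moment L M (w t) (U t \<psi>)
      \<le> exp ((2 * c1 + c2) / R * t) * (moment L M (w 0) \<psi> + 2 * c2 * (R * \<eta>\<^sup>2) * B * t)"
    unfolding U_def
  proof (rule moment_growth [where w = w and w' = w' and p = p and u = u])
    show "0 \<le> w s i" for s i using w0 less_imp_le by blast
    show "((\<lambda>s. w s i) has_real_derivative w' s i) (at s)" for s i
      unfolding w'_def w_def
      by (rule DERIV_chain2 [OF logistic_deriv]) (auto intro!: derivative_eq_intros)
    show p0: "0 \<le> p s i j" for s i j
      unfolding p_def using h0 [of s i] \<sigma>0 [of i j] w0 [of s i] w0 [of s j] \<tau> by auto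
    show "(cmod (J i j) * (w s i - w s j))\<^sup>2 \<le> p s i j * p s j i" if ij: "i \<in> L" "j \<in> L" for s i j
    proof (cases "dist i j \<le> R / (64 * \<alpha>)")
      case True
      have "(w s i - w s j)\<^sup>2 \<le> (w s i * (1 - w s i)) * (w s j * (1 - w s j)) * (exp (\<mu> * dist i j / 2) - exp (- (\<mu> * dist i j) / 2))\<^sup>2"
        unfolding w_def by (rule logistic_diff [OF near])
      then have "(cmod (J i j))\<^sup>2 * (w s i - w s j)\<^sup>2 \<le> (cmod (J i j))\<^sup>2 *
          ((w s i * (1 - w s i)) * (w s j * (1 - w s j)) * (exp (\<mu> * dist i j / 2) - exp (- (\<mu> * dist i j) / 2))\<^sup>2)"
        by (intro mult_left_mono) auto
      then show ?thesis
        using True unfolding p_def J_sym [OF ij] dist_commute [of j i] by (simp add: power2_eq_square mult_ac)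
    next
      case far: False
      show ?thesis
      proof (cases "w s i = w s j")
        case True
        then show ?thesis using p0 [of s i j] p0 [of s j i] by simp
      next
        case False
        define m where "m = max (w s i) (w s j)"
        have "p s i j * p s j i = (cmod (J i j) * m)\<^sup>2"
          using far False \<tau> unfolding p_def J_sym [OF ij] dist_commute [of j i] m_def
          by (auto simp: max_def power2_eq_square)
        moreover have "(cmod (J i j) * (w s i - w s j))\<^sup>2 \<le> (cmod (J i j) * m)\<^sup>2"
        proof (rule power2_le_iff_abs_le [THEN iffD2])
          have "\<bar>w s i - w s j\<bar> \<le> m" using w0 [of s i] w0 [of s j] unfolding m_def by linarith
          then show "\<bar>cmod (J i j) * (w s i - w s j)\<bar> \<le> cmod (J i j) * m"
            by (simp add: abs_mult mult_left_mono)
        qed (use w0 [of s i] in \<open>auto simp: m_def less_imp_le\<close>)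
        ultimately show ?thesis by simp
      qed
    qed
    show "2 * wnum L (w s) n * wnum L (w' s) n
        + (\<Sum>i\<in>L. real (n i) * (\<Sum>j\<in>L. p s i j * (2 * wnum L (w s) n - w s i + w s j)))
      \<le> (2 * c1 + c2) / R * (wnum L (w s) n)\<^sup>2 + 2 * c2 * (R * \<eta>\<^sup>2) * (wnum L u n)\<^sup>2"
      if s: "0 \<le> s" "s \<le> t" for s n
    proof -
      let ?N = "wnum L (w s) n" and ?P = "wnum L u n"
      let ?h = "\<lambda>i. w s i * (1 - w s i)"
      let ?q = "\<lambda>i. bracket R i x powr (- \<alpha>)"
      let ?\<sigma> = "\<lambda>i j :: real ^ 'd. exp (\<mu> * dist i j / 2) - exp (- (\<mu> * dist i j) / 2)"
      have N0: "0 \<le> ?N" by (intro wnum_nonneg less_imp_le w0)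
      have P0: "0 \<le> ?P" by (intro wnum_nonneg u0)
      have site: "real (n i) * (\<Sum>j\<in>L. p s i j * (2 * ?N - w s i + w s j))
          \<le> 2 * ?N * (\<mu> * (3 * v / 4)) * (?h i * real (n i)) + 2 * ?N * (c1 / R) * (w s i * real (n i))
            + c2 * (R * \<eta>\<^sup>2) * (2 * ?N + 1) * (real (n i) * ?q i)" if i: "i \<in> L" for i
      proof (cases "n i = 0")
        case False
        have wN: "w s i \<le> ?N" using w0 less_imp_le False by (intro wnum_ge_weight [OF L i]) auto
        let ?near = "{j \<in> L. dist i j \<le> R / (64 * \<alpha>)}" and ?far = "{j \<in> L. R / (64 * \<alpha>) < dist i j}"
        have "(\<Sum>j\<in>L. p s i j * (2 * ?N - w s i + w s j))
            = (\<Sum>j\<in>?near. p s i j * (2 * ?N - w s i + w s j)) + (\<Sum>j\<in>?far. p s i j * (2 * ?N - w s i + w s j))"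
          using L by (subst sum.union_disjoint [symmetric]) (auto intro!: sum.cong)
        moreover have "(\<Sum>j\<in>?near. p s i j * (2 * ?N - w s i + w s j)) \<le> 2 * ?N * (\<mu> * (3 * v / 4)) * ?h i"
        proof -
          have "(\<Sum>j\<in>?near. p s i j * (2 * ?N - w s i + w s j))
              \<le> (\<Sum>j\<in>?near. 2 * ?N * ?h i * (cmod (J i j) * ?\<sigma> i j * exp (\<mu> * dist i j)))"
          proof (rule sum_mono)
            fix j assume j: "j \<in> ?near"
            define E where "E = exp (\<mu> * dist i j)"
            have E: "1 \<le> E" unfolding E_def using \<mu> by simp
            have "w s j \<le> E * w s i"
              unfolding w_def E_def by (rule logistic_ratio [OF near])
            \<comment> \<open>Since site \<open>i\<close> is occupied, its weight is at most
              \<open>?N\<close>, and the change of weight along the hop costs the factor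
              \<open>E\<close>. This is the third exponential in \<open>near_sum\<close>.\<close>
            then have "2 * ?N - w s i + w s j \<le> 2 * ?N + (E - 1) * w s i" by (simp add: algebra_simps)
            also have "\<dots> \<le> 2 * ?N + (E - 1) * (2 * ?N)"
              using E wN N0 by (intro add_left_mono mult_left_mono) auto
            finally have "2 * ?N - w s i + w s j \<le> 2 * ?N * E" by (simp add: algebra_simps)
            then have "cmod (J i j) * ?h i * ?\<sigma> i j * (2 * ?N - w s i + w s j) \<le> cmod (J i j) * ?h i * ?\<sigma> i j * (2 * ?N * E)"
              using h0 [of s i] \<sigma>0 [of i j] by (intro mult_left_mono) auto
            then show "p s i j * (2 * ?N - w s i + w s j) \<le> 2 * ?N * ?h i * (cmod (J i j) * ?\<sigma> i j * exp (\<mu> * dist i j))"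
              using j unfolding p_def E_def by (simp add: mult_ac)
          qed
          also have "\<dots> = 2 * ?N * ?h i * (\<Sum>j\<in>?near. cmod (J i j) * ?\<sigma> i j * exp (\<mu> * dist i j))"
            by (simp add: sum_distrib_left)
          also have "\<dots> \<le> 2 * ?N * ?h i * (\<mu> * (3 * v / 4))"
            unfolding \<mu>_def using N0 h0 [of s i] by (intro mult_left_mono near_sum i R slow) auto
          finally show ?thesis by (simp add: mult_ac)
        qed
        moreover have "(\<Sum>j\<in>?far. p s i j * (2 * ?N - w s i + w s j))
            \<le> 2 * ?N * (c1 / R) * w s i + c2 * (R * \<eta>\<^sup>2) * (2 * ?N + 1) * ?q i"
        proof -
          have "(\<Sum>j\<in>?far. p s i j * (2 * ?N - w s i + w s j))
              \<le> (\<Sum>j\<in>?far. \<tau> * w s i * (2 * ?N) * cmod (J i j) + (2 * ?N + 1) / \<tau> * (cmod (J i j) * w s j))"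
          proof (rule sum_mono)
            fix j assume j: "j \<in> ?far"
            have a: "0 \<le> \<tau> * w s i * (2 * ?N) * cmod (J i j)" "0 \<le> (2 * ?N + 1) / \<tau> * (cmod (J i j) * w s j)"
              using \<tau> N0 w0 [of s i] w0 [of s j] by auto
            show "p s i j * (2 * ?N - w s i + w s j)
                \<le> \<tau> * w s i * (2 * ?N) * cmod (J i j) + (2 * ?N + 1) / \<tau> * (cmod (J i j) * w s j)"
            proof (cases "w s j \<le> w s i")
              case True
              then have "cmod (J i j) * (\<tau> * w s i) * (2 * ?N - w s i + w s j) \<le> cmod (J i j) * (\<tau> * w s i) * (2 * ?N)"
                using \<tau> w0 [of s i] by (intro mult_left_mono) auto
              then have "p s i j * (2 * ?N - w s i + w s j) \<le> \<tau> * w s i * (2 * ?N) * cmod (J i j)"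
                using True j unfolding p_def by (simp add: mult_ac)
              then show ?thesis using a by linarith
            next
              case False
              have "cmod (J i j) * (w s j / \<tau>) * (2 * ?N - w s i + w s j) \<le> cmod (J i j) * (w s j / \<tau>) * (2 * ?N + 1)"
                using \<tau> w0 [of s i] w0 [of s j] w1 [of s j] by (intro mult_left_mono) auto
              then have "p s i j * (2 * ?N - w s i + w s j) \<le> (2 * ?N + 1) / \<tau> * (cmod (J i j) * w s j)"
                using False j unfolding p_def by (simp add: mult_ac)
              then show ?thesis using a by linarith
            qed
          qed
          also have "\<dots> = \<tau> * w s i * (2 * ?N) * (\<Sum>j\<in>?far. cmod (J i j)) + (2 * ?N + 1) / \<tau> * (\<Sum>j\<in>?far. cmod (J i j) * w s j)"
            by (simp add: sum.distrib sum_distrib_left)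
          also have "\<dots> \<le> \<tau> * w s i * (2 * ?N) * (c1 * \<eta>) + (2 * ?N + 1) / \<tau> * (c2 * \<eta> * ?q i)"
          proof (intro add_mono mult_left_mono)
            show "(\<Sum>j\<in>?far. cmod (J i j)) \<le> c1 * \<eta>"
              unfolding c1_def \<eta>_def using R by (intro far_sum J_le i) auto
            show "(\<Sum>j\<in>?far. cmod (J i j) * w s j) \<le> c2 * \<eta> * ?q i"
              unfolding c2_def tail_const_def \<eta>_def
            proof (rule far_sum_weighted [OF J_le [OF i] i x])
              fix j
              have "0 \<le> 3 * v / 4 * s" using s v by simp
              then have "3 / 4 * R - 3 * v / 4 * s \<le> R" using R by linarith
              then show "w s j \<le> 3 powr (2 * \<alpha>) * bracket R j x powr (- (2 * \<alpha>))"
                unfolding w_def \<mu>_def bracket_def by (intro logistic_weight_tail R) auto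
            qed (use R w0 less_imp_le in auto)
          qed (use \<tau> N0 w0 [of s i] in auto)
          also have "\<dots> = 2 * ?N * (c1 * (\<tau> * \<eta>)) * w s i + c2 * (\<eta> / \<tau>) * (2 * ?N + 1) * ?q i"
            by (simp add: mult_ac)
          finally show ?thesis unfolding \<tau>(2,3) by simp
        qed
        ultimately have "(\<Sum>j\<in>L. p s i j * (2 * ?N - w s i + w s j))
            \<le> 2 * ?N * (\<mu> * (3 * v / 4)) * ?h i + (2 * ?N * (c1 / R) * w s i + c2 * (R * \<eta>\<^sup>2) * (2 * ?N + 1) * ?q i)"
          by linarith
        from mult_left_mono [OF this of_nat_0_le_iff [of "n i"]] show ?thesis
          by (simp only: distrib_left distrib_right mult_ac add_ac)
      qed simp
      have "(\<Sum>i\<in>L. real (n i) * (\<Sum>j\<in>L. p s i j * (2 * ?N - w s i + w s j)))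
          \<le> (\<Sum>i\<in>L. 2 * ?N * (\<mu> * (3 * v / 4)) * (?h i * real (n i)) + 2 * ?N * (c1 / R) * (w s i * real (n i))
            + c2 * (R * \<eta>\<^sup>2) * (2 * ?N + 1) * (real (n i) * ?q i))"
        by (rule sum_mono [OF site])
      also have "\<dots> = 2 * ?N * (\<mu> * (3 * v / 4)) * (\<Sum>i\<in>L. ?h i * real (n i)) + 2 * ?N * (c1 / R) * ?N
            + c2 * (R * \<eta>\<^sup>2) * ((2 * ?N + 1) * (\<Sum>i\<in>L. real (n i) * ?q i))"
        unfolding sum.distrib sum_distrib_left [symmetric] wnum_def [symmetric] by (simp only: mult.assoc)
      also have "\<dots> \<le> 2 * ?N * (\<mu> * (3 * v / 4)) * (\<Sum>i\<in>L. ?h i * real (n i)) + 2 * ?N * (c1 / R) * ?N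
            + c2 * (R * \<eta>\<^sup>2) * (?N\<^sup>2 + 2 * ?P\<^sup>2)"
      proof (intro add_left_mono mult_left_mono)
        have q: "?q i = (u i)\<^sup>2" for i unfolding u_def using R by (simp add: point_weight_square)
        have u1: "u i \<le> 1" for i unfolding u_def using R \<alpha>_gt by (intro point_weight_le_1) auto
        \<comment> \<open>The sum has two bounds: \<open>?P\<close>, because \<open>u\<close> is at
          most \<open>1\<close>, and \<open>?P\<^sup>2\<close>, because a natural number is at most
          its square. The first goes with the factor \<open>2 * ?N\<close>; the second handles the
          summand \<open>1\<close> left over from \<open>w s j \<le> 1\<close>, so that everything
          is quadratic in particle numbers.\<close>
        have 1: "(\<Sum>i\<in>L. real (n i) * ?q i) \<le> ?P"
          unfolding q wnum_def
        proof (rule sum_mono)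
          fix i
          have "(u i)\<^sup>2 \<le> u i" using u0 [of i] u1 [of i] by (simp add: power2_eq_square mult_left_le)
          then show "real (n i) * (u i)\<^sup>2 \<le> u i * real (n i)"
            using mult_left_mono [of "(u i)\<^sup>2" "u i" "real (n i)"] by (simp add: mult.commute)
        qed
        have 2: "(\<Sum>i\<in>L. real (n i) * ?q i) \<le> ?P\<^sup>2"
        proof -
          have "(\<Sum>i\<in>L. real (n i) * ?q i) \<le> (\<Sum>i\<in>L. (u i * real (n i)) * ?P)"
          proof (rule sum_mono)
            fix i assume i: "i \<in> L"
            have "real (n i) \<le> (real (n i))\<^sup>2" by (cases "n i") (auto simp: power2_eq_square)
            then have "real (n i) * ?q i \<le> (u i * real (n i)) * (u i * real (n i))"
              unfolding q using mult_right_mono [of "real (n i)" "(real (n i))\<^sup>2" "(u i)\<^sup>2"]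
              by (simp add: power2_eq_square mult_ac)
            also have "\<dots> \<le> (u i * real (n i)) * ?P"
              using u0 i by (intro mult_left_mono wnum_ge L) auto
            finally show "real (n i) * ?q i \<le> (u i * real (n i)) * ?P" .
          qed
          also have "\<dots> = ?P\<^sup>2" by (simp add: sum_distrib_right [symmetric] wnum_def power2_eq_square)
          finally show ?thesis .
        qed
        have "(2 * ?N + 1) * (\<Sum>i\<in>L. real (n i) * ?q i) \<le> 2 * ?N * ?P + ?P\<^sup>2"
          using 2 mult_left_mono [OF 1, of "2 * ?N"] N0 by (simp add: distrib_right)
        also have "\<dots> \<le> ?N\<^sup>2 + 2 * ?P\<^sup>2"
          using sum_squares_bound [of ?N ?P] by simp
        finally show "(2 * ?N + 1) * (\<Sum>i\<in>L. real (n i) * ?q i) \<le> ?N\<^sup>2 + 2 * ?P\<^sup>2" .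
      qed (use c2 R in auto)
      \<comment> \<open>The front moves with exactly the speed at which its drift balances the
        charges for short hops.\<close>
      also have "\<dots> = - (2 * ?N * wnum L (w' s) n) + (2 * c1 / R * ?N\<^sup>2 + c2 * (R * \<eta>\<^sup>2) * ?N\<^sup>2 + 2 * c2 * (R * \<eta>\<^sup>2) * ?P\<^sup>2)"
      proof -
        have "wnum L (w' s) n = - (\<mu> * (3 * v / 4)) * (\<Sum>i\<in>L. ?h i * real (n i))"
          unfolding wnum_def w'_def sum_distrib_left by (intro sum.cong refl) simp
        then show ?thesis by (simp add: algebra_simps power2_eq_square)
      qed
      also have "\<dots> \<le> - (2 * ?N * wnum L (w' s) n) + ((2 * c1 + c2) / R * ?N\<^sup>2 + 2 * c2 * (R * \<eta>\<^sup>2) * ?P\<^sup>2)"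
      proof -
        \<comment> \<open>Because \<open>R * \<eta> \<le> 1\<close>, the part of the source
          proportional to \<open>?N\<^sup>2\<close> has a rate below \<open>c2 / R\<close> and joins
          the growth rate; only the \<open>?P\<^sup>2\<close> part has to keep its small
          factor.\<close>
        have "R * \<eta>\<^sup>2 = (R * \<eta>) * (R * \<eta>) / R" using R by (simp add: power2_eq_square)
        also have "\<dots> \<le> 1 / R" using R R\<eta> \<eta> mult_mono [of "R * \<eta>" 1 "R * \<eta>" 1]
          by (intro divide_right_mono) (auto simp del: mult_less_cancel_left mult_le_cancel_left)
        finally have "c2 * (R * \<eta>\<^sup>2) * ?N\<^sup>2 \<le> c2 * (1 / R) * ?N\<^sup>2"
          using c2 by (intro mult_right_mono mult_left_mono) auto
        then show ?thesis by (simp add: add_divide_distrib distrib_right)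
      qed
      finally show ?thesis by simp
    qed
    show "moment L M u (time_evol (hamiltonian J V L) s \<psi>) \<le> B" if "0 \<le> s" "s \<le> t" for s
      using B [OF that] unfolding u_def U_def .
  qed (use t c1 c2 R in auto)
  have init: "moment L M (w 0) \<psi> \<le> (R * \<eta>)\<^sup>2 * B"
  proof -
    have Ra: "R powr (- \<alpha>) \<le> R * \<eta>"
    proof -
      have "1 * R powr (- \<alpha>) \<le> (R * R ^ CARD('d)) * R powr (- \<alpha>)"
        using R by (intro mult_right_mono) (auto simp: mult_ge1_I one_le_power)
      then show ?thesis by (simp add: \<eta>_def mult.assoc)
    qed
    have "moment L M (w 0) \<psi> \<le> (\<Sum>n\<in>F M. (R * \<eta>)\<^sup>2 * ((wnum L u n)\<^sup>2 * (cmod (\<psi> n))\<^sup>2))"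
      unfolding moment_def
    proof (rule sum_mono)
      fix n assume n: "n \<in> F M"
      show "(wnum L (w 0) n)\<^sup>2 * (cmod (\<psi> n))\<^sup>2 \<le> (R * \<eta>)\<^sup>2 * ((wnum L u n)\<^sup>2 * (cmod (\<psi> n))\<^sup>2)"
      proof (cases "\<psi> n = 0")
        case False
        have "wnum L (w 0) n \<le> (\<Sum>i\<in>L. R * \<eta> * (u i * real (n i)))"
          unfolding wnum_def
        proof (rule sum_mono)
          fix i assume i: "i \<in> L"
          show "w 0 i * real (n i) \<le> R * \<eta> * (u i * real (n i))"
          proof (cases "n i = 0")
            case False
            have "w 0 i \<le> R powr (- \<alpha>) * u i"
              unfolding w_def u_def point_weight_def \<mu>_def bracket_def
              using logistic_weight_initial [OF R empty [OF n \<open>\<psi> n \<noteq> 0\<close> i False]] by simp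
            also have "\<dots> \<le> R * \<eta> * u i" by (intro mult_right_mono Ra u0)
            finally show ?thesis by (simp add: mult_right_mono mult.assoc [symmetric])
          qed simp
        qed
        also have "\<dots> = R * \<eta> * wnum L u n" by (simp add: wnum_def sum_distrib_left)
        finally have "(wnum L (w 0) n)\<^sup>2 \<le> (R * \<eta> * wnum L u n)\<^sup>2"
          using w0 less_imp_le by (intro power_mono wnum_nonneg) auto
        then have "(wnum L (w 0) n)\<^sup>2 * (cmod (\<psi> n))\<^sup>2 \<le> (R * \<eta> * wnum L u n)\<^sup>2 * (cmod (\<psi> n))\<^sup>2"
          by (intro mult_right_mono) auto
        then show ?thesis by (simp add: power_mult_distrib mult.assoc)
      qed simp
    qed
    also have "\<dots> = (R * \<eta>)\<^sup>2 * moment L M u \<psi>"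
      by (simp add: moment_def sum_distrib_left)
    also have "\<dots> \<le> (R * \<eta>)\<^sup>2 * B"
      using B [of 0] t by (intro mult_left_mono) (auto simp: U_def u_def time_evol_0)
    finally show ?thesis .
  qed
  have tv: "t / R \<le> 1 / v" using t R v by (simp add: field_simps)
  have "(nrm (F M) (occ x (U t \<psi>)))\<^sup>2 \<le> 4 * moment L M (w t) (U t \<psi>)"
    unfolding nrm_square moment_def sum_distrib_left
  proof (rule sum_mono)
    fix n
    \<comment> \<open>The front is still at the nonnegative distance
      \<open>3 / 4 * (R - v * t)\<close> from \<open>x\<close>.\<close>
    have "1 / 2 \<le> w t x"
      unfolding w_def using \<mu> t v by (intro logistic_ge_half) (simp add: mult_le_0_iff mult.commute [of t v])
    then have "1 / 2 * real (n x) \<le> w t x * real (n x)" by (intro mult_right_mono) auto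
    also have "\<dots> \<le> wnum L (w t) n" using w0 less_imp_le x by (intro wnum_ge L) auto
    finally have "real (n x) \<le> 2 * wnum L (w t) n" by simp
    then have "(real (n x))\<^sup>2 \<le> (2 * wnum L (w t) n)\<^sup>2" by (intro power_mono) auto
    then have "(real (n x))\<^sup>2 * (cmod (U t \<psi> n))\<^sup>2 \<le> (2 * wnum L (w t) n)\<^sup>2 * (cmod (U t \<psi> n))\<^sup>2"
      by (intro mult_right_mono) auto
    then show "(cmod (occ x (U t \<psi>) n))\<^sup>2 \<le> 4 * ((wnum L (w t) n)\<^sup>2 * (cmod (U t \<psi> n))\<^sup>2)"
      by (simp add: occ_def norm_mult power_mult_distrib)
  qed
  also have "\<dots> \<le> 4 * (exp ((2 * c1 + c2) / R * t) * (moment L M (w 0) \<psi> + 2 * c2 * (R * \<eta>\<^sup>2) * B * t))"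
    using growth by simp
  also have "\<dots> \<le> 4 * (exp ((2 * c1 + c2) / v) * ((R * \<eta>)\<^sup>2 * B + 2 * c2 / v * ((R * \<eta>)\<^sup>2 * B)))"
  proof (rule mult_left_mono, rule mult_mono, rule_tac [2] add_mono, rule_tac [2] init)
    have "(2 * c1 + c2) * (t / R) \<le> (2 * c1 + c2) * (1 / v)" using c1 c2 tv by (intro mult_left_mono) auto
    then show "exp ((2 * c1 + c2) / R * t) \<le> exp ((2 * c1 + c2) / v)" by simp
    have "2 * c2 * (R * \<eta>\<^sup>2) * B * t = 2 * c2 * ((R * \<eta>)\<^sup>2 * B) * (t / R)"
      using R by (simp add: power2_eq_square)
    also have "\<dots> \<le> 2 * c2 * ((R * \<eta>)\<^sup>2 * B) * (1 / v)"
      using c2 B0 tv by (intro mult_left_mono) auto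
    finally show "2 * c2 * (R * \<eta>\<^sup>2) * B * t \<le> 2 * c2 / v * ((R * \<eta>)\<^sup>2 * B)" by simp
  qed (use moment_nonneg [of L M "w 0" \<psi>] c2 R B0 t in auto)
  also have "\<dots> = spread_const \<alpha> CARD('d) K v * (R * \<eta>)\<^sup>2 * B"
    unfolding spread_const_def c1_def c2_def by (simp add: algebra_simps)
  finally show ?thesis unfolding \<eta>_def .
qed

end

section \<open>Terms across the boundary of the truncation region\<close>

lemma nrm_cre:
  assumes "finite L" "i \<in> L"
  shows "(nrm (sectors L (Suc M)) (cre i \<Psi>))\<^sup>2 = (\<Sum>m\<in>sectors L M. real (m i + 1) * (cmod (\<Psi> m))\<^sup>2)"
proof -
  have e: "ann i (cre i \<Psi>) m = of_nat (m i + 1) * \<Psi> m" for m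
    using ccr [of i i \<Psi> m] cre_ann [of i \<Psi> m] by (simp add: algebra_simps)
  have "complex_of_real ((nrm (sectors L (Suc M)) (cre i \<Psi>))\<^sup>2)
      = (\<Sum>n\<in>sectors L (Suc M). 1 * (cnj (cre i \<Psi> n) * cre i \<Psi> n))"
    unfolding inn_self [symmetric] inn_def by simp
  also have "\<dots> = (\<Sum>m\<in>sectors L M. 1 * (cnj (ann i (cre i \<Psi>) m) * \<Psi> m))"
    by (rule cre_adjoint [OF assms])
  also have "\<dots> = complex_of_real (\<Sum>m\<in>sectors L M. real (m i + 1) * (cmod (\<Psi> m))\<^sup>2)"
    unfolding e by (simp add: complex_norm_square mult_ac del: of_real_power)
  finally show ?thesis by (simp only: of_real_eq_iff)
qed

text \<open>The squared norm is the expectation of \<open>n j * (n i + 1)\<close>, and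
  \<open>n j \<le> (n j)\<^sup>2\<close> on natural numbers, so it is at most that of the squared
  sum of both occupations.\<close>

lemma nrm_hop:
  assumes L: "finite L" and ij: "i \<in> L" "j \<in> L" "i \<noteq> j"
  shows "nrm (sectors L (Suc M)) (cre i (ann j \<phi>)) \<le> nrm (sectors L (Suc M)) (occ i \<phi>) + nrm (sectors L (Suc M)) (occ j \<phi>)"
proof -
  let ?F = "sectors L (Suc M)"
  have "(nrm ?F (cre i (ann j \<phi>)))\<^sup>2 = (\<Sum>m\<in>sectors L M. real ((m(j := Suc (m j))) i + 1) * (cmod (ann j \<phi> m))\<^sup>2)"
    unfolding nrm_cre [OF L ij(1)] using ij by simp
  also have "\<dots> = (\<Sum>n\<in>?F. real (n j) * real (n i + 1) * (cmod (\<phi> n))\<^sup>2)"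
    by (rule ann_moment [OF L ij(2), where G = "\<lambda>n. real (n i + 1)"])
  also have "\<dots> \<le> (\<Sum>n\<in>?F. (real (n i) + real (n j))\<^sup>2 * (cmod (\<phi> n))\<^sup>2)"
  proof (intro sum_mono mult_right_mono)
    fix n :: "'a conf"
    have "real (n j) \<le> real (n j) * real (n j)" by (cases "n j") auto
    then show "real (n j) * real (n i + 1) \<le> (real (n i) + real (n j))\<^sup>2"
      by (simp add: power2_eq_square algebra_simps add_increasing)
  qed simp
  also have "\<dots> = (nrm ?F (\<lambda>n. occ i \<phi> n + occ j \<phi> n))\<^sup>2"
  proof -
    have "occ i \<phi> n + occ j \<phi> n = complex_of_real (real (n i) + real (n j)) * \<phi> n" for n
      by (simp add: occ_def distrib_right)
    then show ?thesis unfolding nrm_square by (simp add: norm_mult power_mult_distrib del: of_real_add)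
  qed
  finally have "nrm ?F (cre i (ann j \<phi>)) \<le> nrm ?F (\<lambda>n. occ i \<phi> n + occ j \<phi> n)"
    by (rule power2_le_imp_le) (rule nrm_nonneg)
  then show ?thesis using nrm_add order_trans by blast
qed

lemma nrm_occ_le_wnum:
  assumes "finite L" "x \<in> L" "\<And>i. i \<in> L \<Longrightarrow> 0 \<le> w i" "1 \<le> w x"
  shows "(nrm (sectors L (Suc M)) (occ x \<phi>))\<^sup>2 \<le> moment L M w \<phi>"
  unfolding moment_eq
proof (intro power_mono nrm_mono nrm_nonneg)
  fix n
  have "1 * real (n x) \<le> w x * real (n x)" using assms by (intro mult_right_mono) auto
  also have "\<dots> \<le> wnum L w n" using assms by (intro wnum_ge) auto
  finally show "cmod (occ x \<phi> n) \<le> cmod (complex_of_real (wnum L w n) * \<phi> n)"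
    by (simp add: occ_def norm_mult mult_right_mono)
qed

text \<open>Minkowski's inequality over the sites: second moments at single sites suffice, and no
  correlation between sites enters.\<close>

lemma moment_initial:
  assumes L: "finite L" and w: "\<And>i. i \<in> L \<Longrightarrow> 0 \<le> w i"
    and lam: "\<And>i. i \<in> L \<Longrightarrow> nrm (sectors L (Suc M)) (occ i \<psi>) \<le> lam"
  shows "moment L M w \<psi> \<le> (lam * sum w L)\<^sup>2"
proof -
  let ?F = "sectors L (Suc M)"
  have "nrm ?F (\<lambda>n. complex_of_real (wnum L w n) * \<psi> n) = nrm ?F (\<lambda>n. \<Sum>i\<in>L. complex_of_real (w i) * occ i \<psi> n)"
    by (simp add: wnum_def occ_def sum_distrib_right mult.assoc)
  also have "\<dots> \<le> (\<Sum>i\<in>L. nrm ?F (\<lambda>n. complex_of_real (w i) * occ i \<psi> n))" by (rule nrm_sum)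
  also have "\<dots> \<le> (\<Sum>i\<in>L. w i * lam)"
    unfolding nrm_scale using w lam by (intro sum_mono) (auto intro: mult_left_mono)
  also have "\<dots> = lam * sum w L" by (simp add: sum_distrib_left mult.commute)
  finally show ?thesis
    unfolding moment_eq by (intro power_mono nrm_nonneg)
qed

definition density_const :: "real \<Rightarrow> nat \<Rightarrow> real \<Rightarrow> real \<Rightarrow> real \<Rightarrow> real" where
  "density_const \<alpha> D K v lam =
    exp (3 * (\<alpha> / 2) * K * lattice_const D (\<alpha> / 2 - 1) / v) * (lam * lattice_const D (\<alpha> / 2))"

definition shell_const :: "real \<Rightarrow> nat \<Rightarrow> real \<Rightarrow> real \<Rightarrow> real \<Rightarrow> real \<Rightarrow> real" where
  "shell_const \<alpha> D K v lam R0 = density_const \<alpha> D K v lam * (sqrt (spread_const \<alpha> D K v) + R0 powr \<alpha>)"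

context lattice_hopping
begin

lemma lattice_consts_ge_1:
  "1 \<le> lattice_const CARD('d) \<alpha>" "1 \<le> lattice_const CARD('d) (\<alpha> / 2)" "1 \<le> lattice_const CARD('d) (\<alpha> / 2 - 1)"
  by (rule lattice_const_ge_1, use \<alpha> D_ge_1 in linarith)+

lemma density_bound:
  fixes V :: "real ^ 'd \<Rightarrow> real ^ 'd \<Rightarrow> real"
  assumes x: "x \<in> L" and R: "1 \<le> R" and t: "0 \<le> t" "v * t \<le> R" and lam: "0 \<le> lam"
    and \<psi>: "\<And>i. i \<in> L \<Longrightarrow> nrm (F M) (occ i \<psi>) \<le> lam"
  shows "moment L M (point_weight \<alpha> R x) (time_evol (hamiltonian J V L) t \<psi>)
    \<le> (density_const \<alpha> CARD('d) K v lam * R ^ CARD('d))\<^sup>2"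
proof -
  define a where "a = 3 * (\<alpha> / 2) * K * lattice_const CARD('d) (\<alpha> / 2 - 1)"
  have a: "0 \<le> a" unfolding a_def using K \<alpha>_gt lattice_consts_ge_1 by simp
  have "moment L M (point_weight \<alpha> R x) \<psi> \<le> (lam * sum (point_weight \<alpha> R x) L)\<^sup>2"
    using R by (intro moment_initial L \<psi> less_imp_le [OF point_weight_pos]) auto
  also have "\<dots> \<le> (lam * (lattice_const CARD('d) (\<alpha> / 2) * R ^ CARD('d)))\<^sup>2"
  proof (intro power_mono mult_left_mono lam)
    have "sum (point_weight \<alpha> R x) L = (\<Sum>i\<in>L. bracket R x i powr (- (\<alpha> / 2)))"
      by (simp add: point_weight_def bracket_commute)
    also have "\<dots> \<le> lattice_const CARD('d) (\<alpha> / 2) * R ^ CARD('d)"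
      using x lattice \<alpha> D_ge_1 by (intro lattice_sum L R) auto
    finally show "sum (point_weight \<alpha> R x) L \<le> lattice_const CARD('d) (\<alpha> / 2) * R ^ CARD('d)" .
    show "0 \<le> lam * sum (point_weight \<alpha> R x) L"
      using R lam by (intro mult_nonneg_nonneg sum_nonneg less_imp_le [OF point_weight_pos]) auto
  qed
  finally have 1: "moment L M (point_weight \<alpha> R x) \<psi> \<le> (lam * (lattice_const CARD('d) (\<alpha> / 2) * R ^ CARD('d)))\<^sup>2" .
  have "a / R * t \<le> a / v"
    using t R v a mult_left_mono [of "v * t" R a] by (simp add: field_simps)
  \<comment> \<open>The exponent is doubled on purpose, to make the bound the square of
    \<open>density_const * R ^ D\<close>.\<close>
  then have "a / R * t \<le> a / v + a / v" using divide_nonneg_pos [OF a v] by linarith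
  then have 2: "exp (a / R * t) \<le> exp (a / v) ^ 2"
    unfolding power2_eq_square exp_add [symmetric] by simp
  have "moment L M (point_weight \<alpha> R x) (time_evol (hamiltonian J V L) t \<psi>)
      \<le> exp (a / R * t) * moment L M (point_weight \<alpha> R x) \<psi>"
    unfolding a_def by (rule apriori_moment [OF R t(1)])
  also have "\<dots> \<le> exp (a / v) ^ 2 * (lam * (lattice_const CARD('d) (\<alpha> / 2) * R ^ CARD('d)))\<^sup>2"
    by (intro mult_mono 1 2 moment_nonneg) auto
  also have "\<dots> = (density_const \<alpha> CARD('d) K v lam * R ^ CARD('d))\<^sup>2"
    unfolding density_const_def a_def by (simp add: power_mult_distrib mult_ac)
  finally show ?thesis .
qed

lemma density_const_nonneg: "0 \<le> lam \<Longrightarrow> 0 \<le> density_const \<alpha> CARD('d) K v lam"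
  unfolding density_const_def using lattice_consts_ge_1 by auto

lemma spread_const_nonneg: "0 \<le> spread_const \<alpha> CARD('d) K v"
  unfolding spread_const_def using tail_const_nonneg v by simp

lemma shell_const_nonneg: "0 \<le> lam \<Longrightarrow> 0 \<le> shell_const \<alpha> CARD('d) K v lam R0"
  unfolding shell_const_def using density_const_nonneg spread_const_nonneg by simp

lemma occ_bound:
  fixes V :: "real ^ 'd \<Rightarrow> real ^ 'd \<Rightarrow> real"
  assumes x: "x \<in> L" and R: "1 \<le> R" and t: "0 \<le> t" "v * t \<le> R" and lam: "0 \<le> lam"
    and \<psi>: "\<And>i. i \<in> L \<Longrightarrow> nrm (F M) (occ i \<psi>) \<le> lam"
  shows "nrm (F M) (occ x (time_evol (hamiltonian J V L) t \<psi>)) \<le> density_const \<alpha> CARD('d) K v lam * R ^ CARD('d)"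
proof (rule power2_le_imp_le)
  have "(nrm (F M) (occ x (time_evol (hamiltonian J V L) t \<psi>)))\<^sup>2
      \<le> moment L M (point_weight \<alpha> R x) (time_evol (hamiltonian J V L) t \<psi>)"
    using R point_weight_pos [of R \<alpha> x] by (intro nrm_occ_le_wnum L x) (auto simp: point_weight_def less_imp_le)
  also have "\<dots> \<le> (density_const \<alpha> CARD('d) K v lam * R ^ CARD('d))\<^sup>2"
    by (rule density_bound [OF x R t lam \<psi>])
  finally show "(nrm (F M) (occ x (time_evol (hamiltonian J V L) t \<psi>)))\<^sup>2
      \<le> (density_const \<alpha> CARD('d) K v lam * R ^ CARD('d))\<^sup>2" .
  show "0 \<le> density_const \<alpha> CARD('d) K v lam * R ^ CARD('d)"
    using density_const_nonneg [OF lam] R by simp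
qed

text \<open>Above the threshold \<open>R0\<close> this is the propagation estimate. Below it
  \<open>R\<close> ranges over a bounded set, so the a priori bound is good enough at the price of
  the constant \<open>R0 powr \<alpha>\<close>.\<close>

lemma shell_occ_bound:
  fixes V :: "real ^ 'd \<Rightarrow> real ^ 'd \<Rightarrow> real"
  assumes x: "x \<in> L" and R: "2 \<le> R" and t: "0 \<le> t" "v * t \<le> R" and lam: "0 \<le> lam"
    and \<psi>: "\<And>i. i \<in> L \<Longrightarrow> nrm (F M) (occ i \<psi>) \<le> lam"
    and empty: "\<And>n i. n \<in> F M \<Longrightarrow> \<psi> n \<noteq> 0 \<Longrightarrow> i \<in> L \<Longrightarrow> n i \<noteq> 0 \<Longrightarrow> 7 / 8 * R \<le> dist i x"
    and R0: "\<And>r. R0 \<le> r \<Longrightarrow> slow_tail \<alpha> CARD('d) K v r"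
  shows "nrm (F M) (occ x (time_evol (hamiltonian J V L) t \<psi>))
    \<le> shell_const \<alpha> CARD('d) K v lam R0 * (R * (R ^ CARD('d) * R ^ CARD('d) * R powr (- \<alpha>)))"
proof -
  let ?b = "density_const \<alpha> CARD('d) K v lam" and ?D = "R ^ CARD('d)" and ?s = "spread_const \<alpha> CARD('d) K v"
  let ?e = "R * (?D * ?D * R powr (- \<alpha>))"
  have b: "0 \<le> ?b" by (rule density_const_nonneg [OF lam])
  have e: "0 \<le> ?e" using R by simp
  show ?thesis
  proof (cases "R0 \<le> R")
    case True
    have "(nrm (F M) (occ x (time_evol (hamiltonian J V L) t \<psi>)))\<^sup>2
        \<le> ?s * (R * (?D * R powr (- \<alpha>)))\<^sup>2 * (?b * ?D)\<^sup>2"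
    proof (rule propagation [OF x R R0 [OF True] t empty])
      fix s assume s: "0 \<le> s" "s \<le> t"
      then have "v * s \<le> v * t" using v by simp
      then have "v * s \<le> R" using t by linarith
      with s show "moment L M (point_weight \<alpha> R x) (time_evol (hamiltonian J V L) s \<psi>) \<le> (?b * ?D)\<^sup>2"
        using R by (intro density_bound x s lam \<psi>) auto
    qed auto
    also have "\<dots> = (?b * sqrt ?s * ?e)\<^sup>2"
      using spread_const_nonneg by (simp add: power_mult_distrib mult_ac)
    finally have "nrm (F M) (occ x (time_evol (hamiltonian J V L) t \<psi>)) \<le> ?b * sqrt ?s * ?e"
      by (rule power2_le_imp_le) (use b e spread_const_nonneg in simp)
    also have "\<dots> \<le> shell_const \<alpha> CARD('d) K v lam R0 * ?e"
      unfolding shell_const_def using b e by (intro mult_right_mono mult_left_mono) auto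
    finally show ?thesis .
  next
    case False
    have "nrm (F M) (occ x (time_evol (hamiltonian J V L) t \<psi>)) \<le> ?b * ?D"
      using R by (intro occ_bound x t lam \<psi>) auto
    also have "\<dots> \<le> ?b * (R0 powr \<alpha> * ?e)"
    proof (intro mult_left_mono b)
      have "?D = R powr \<alpha> * (R powr (- \<alpha>) * ?D)" using R by (simp add: mult.assoc [symmetric] powr_add [symmetric])
      also have "\<dots> \<le> R0 powr \<alpha> * (R powr (- \<alpha>) * ?D)"
        using R False \<alpha>_gt by (intro mult_right_mono powr_mono2) auto
      also have "\<dots> \<le> R0 powr \<alpha> * ((R * ?D) * (R powr (- \<alpha>) * ?D))"
        using R mult_right_mono [of 1 "R * ?D" "R powr (- \<alpha>) * ?D"] mult_mono [of 1 R 1 ?D]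
        by (intro mult_left_mono) (auto simp: one_le_power)
      finally show "?D \<le> R0 powr \<alpha> * ?e" by (simp add: mult_ac)
    qed
    also have "\<dots> \<le> shell_const \<alpha> CARD('d) K v lam R0 * ?e"
      unfolding shell_const_def mult.assoc [symmetric] using b e R spread_const_nonneg by (intro mult_right_mono mult_left_mono) auto
    finally show ?thesis .
  qed
qed

end

text \<open>The first line collects the hops, near and far; the other two are the density pairs,
  near and far. \<open>b\<close> is the a priori density and \<open>c\<close> the constant of the
  small density close to the boundary.\<close>

definition cross_const :: "real \<Rightarrow> nat \<Rightarrow> real \<Rightarrow> real \<Rightarrow> real \<Rightarrow> real" where
  "cross_const \<alpha> D K b c =
    3 powr \<alpha> * lattice_const D \<alpha> * (4 * (c * (K * lattice_const D \<alpha>) + b * long_const \<alpha> D K))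
    + (3 powr \<alpha> * lattice_const D \<alpha> * (K * lattice_const D \<alpha>) * c\<^sup>2
       + 3 powr \<alpha> * 3 powr (\<alpha> / 2) * long_const \<alpha> D K * b\<^sup>2)"

context lattice_hopping
begin

lemma coeff_total:
  assumes c: "\<And>j. j \<in> L \<Longrightarrow> c j \<le> K * bracket 1 i j powr (- \<alpha>)" and i: "i \<in> L"
  shows "sum c L \<le> K * lattice_const CARD('d) \<alpha>"
proof -
  have "(\<Sum>j\<in>L. c j * bracket 1 i j powr 0) \<le> K * lattice_const CARD('d) (\<alpha> - 0)"
    by (rule coeff_sum [OF c i]) (use \<alpha> D_ge_1 in linarith)+
  moreover have "bracket 1 i j powr 0 = 1" for j using bracket_pos [of 1 i j] by simp
  ultimately show ?thesis by simp
qed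

text \<open>A short pair has small occupation norms at both ends, a long pair has a small coupling
  and a priori norms. In either case a site of \<open>I\<close> contributes order
  \<open>R * R ^ D * R ^ D * R powr (- \<alpha>)\<close>, and \<open>I\<close> has order
  \<open>R ^ D\<close> sites.\<close>

lemma cross_bound:
  fixes V :: "real ^ 'd \<Rightarrow> real ^ 'd \<Rightarrow> real"
  assumes R: "2 \<le> R" and b: "0 \<le> b" and c: "0 \<le> c"
    and V_le: "\<And>i j. i \<in> L \<Longrightarrow> j \<in> L \<Longrightarrow> \<bar>V i j\<bar> \<le> K * bracket 1 i j powr (- \<alpha>)"
    and I: "I \<subseteq> L" and x: "x \<in> L" and Ix: "\<And>i. i \<in> I \<Longrightarrow> dist i x \<le> 2 * R"
    and dens: "\<And>y. y \<in> L \<Longrightarrow> moment L M (point_weight \<alpha> R y) \<phi> \<le> (b * R ^ CARD('d))\<^sup>2"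
    and shell: "\<And>i j. i \<in> I \<Longrightarrow> j \<in> L - I \<Longrightarrow> dist i j \<le> R / (64 * \<alpha>) \<Longrightarrow>
      nrm (F M) (occ i \<phi>) \<le> c * (R * (R ^ CARD('d) * R ^ CARD('d) * R powr (- \<alpha>))) \<and>
      nrm (F M) (occ j \<phi>) \<le> c * (R * (R ^ CARD('d) * R ^ CARD('d) * R powr (- \<alpha>)))"
  shows "boundary_terms J V I (L - I) (F M) \<phi>
    \<le> cross_const \<alpha> CARD('d) K b c * (R * (R ^ CARD('d) * R ^ CARD('d) * R ^ CARD('d) * R powr (- \<alpha>)))"
proof -
  define Q where "Q = R ^ CARD('d)"
  define e where "e = R * (Q * Q * R powr (- \<alpha>))"
  define l where "l = lattice_const CARD('d) \<alpha>"
  define lc where "lc = long_const \<alpha> CARD('d) K"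
  define \<nu> where "\<nu> j = nrm (F M) (occ j \<phi>)" for j
  define near where "near i j \<longleftrightarrow> dist i j \<le> R / (64 * \<alpha>)" for i j :: "real ^ 'd"
  have fin: "finite I" "finite (L - I)" using L I finite_subset by auto
  have R1: "1 \<le> R" "0 < R" using R by auto
  have Q: "1 \<le> Q" unfolding Q_def using R1 by (simp add: one_le_power)
  have l: "1 \<le> l" unfolding l_def by (rule lattice_consts_ge_1)
  have lc: "0 \<le> lc" unfolding lc_def by (rule long_const_nonneg)
  have e0: "0 \<le> e" unfolding e_def using R1 Q by simp
  have Re: "Q * R powr (- \<alpha>) * Q \<le> e"
    unfolding e_def using mult_right_mono [of 1 R "Q * Q * R powr (- \<alpha>)"] R1 Q by (simp add: mult_ac)
  \<comment> \<open>For density pairs near the boundary both norms are of order \<open>e\<close>;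
    this reduces \<open>e * e\<close> to the order of the other terms.\<close>
  have e1: "e \<le> 1"
  proof -
    have "e = R powr 1 * (R powr real CARD('d) * R powr real CARD('d) * R powr (- \<alpha>))"
      unfolding e_def Q_def using R1 by (simp add: powr_realpow)
    also have "\<dots> = R powr (1 + (real CARD('d) + real CARD('d) + - \<alpha>))" by (simp only: powr_add)
    also have "\<dots> \<le> R powr 0" using R1 \<alpha> D_ge_1 by (intro powr_mono) auto
    finally show ?thesis using R1 by simp
  qed
  have \<nu>0: "0 \<le> \<nu> j" for j unfolding \<nu>_def by (rule nrm_nonneg)
  have \<nu>b: "\<nu> j \<le> b * Q" if "j \<in> L" for j
  proof (rule power2_le_imp_le)
    have "(\<nu> j)\<^sup>2 \<le> moment L M (point_weight \<alpha> R j) \<phi>"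
      unfolding \<nu>_def using R1 point_weight_pos [of R \<alpha> j] that
      by (intro nrm_occ_le_wnum L) (auto simp: point_weight_def less_imp_le)
    then show "(\<nu> j)\<^sup>2 \<le> (b * Q)\<^sup>2" using dens [OF that] unfolding Q_def by linarith
    show "0 \<le> b * Q" using b Q by simp
  qed
  have \<nu>c: "\<nu> i \<le> c * e \<and> \<nu> j \<le> c * e" if "i \<in> I" "j \<in> L - I" "near i j" for i j
    using shell [OF that(1,2)] that(3) unfolding \<nu>_def e_def Q_def near_def by simp
  have far_bracket_le: "bracket 1 i j powr (- \<alpha>) \<le> far_const \<alpha> * R powr (- \<alpha>) * bracket R i j powr (- \<alpha>)"
    if "\<not> near i j" for i j :: "real ^ 'd"
    using that \<alpha>_gt R1 unfolding near_def by (intro far_bracket) auto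
  \<comment> \<open>\<open>I\<close> lies within \<open>2 * R\<close> of \<open>x\<close>, where the
    bracket is at most \<open>3\<close>. So summable weights centred at \<open>x\<close> can count
    the sites of \<open>I\<close>.\<close>
  have bI: "1 \<le> 3 powr \<alpha> * bracket R x i powr (- \<alpha>)" if "i \<in> I" for i
  proof -
    have "bracket R x i \<le> 3" using Ix [OF that] R1 by (simp add: bracket_def dist_commute field_simps)
    then have "3 powr (- \<alpha>) \<le> bracket R x i powr (- \<alpha>)"
      using R1 \<alpha>_gt bracket_pos [of R x i] by (intro powr_mono2') auto
    then have "3 powr \<alpha> * 3 powr (- \<alpha>) \<le> 3 powr \<alpha> * bracket R x i powr (- \<alpha>)" by (intro mult_left_mono) auto
    then show ?thesis by (simp add: powr_add [symmetric])
  qed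
  have cardI: "real (card I) \<le> 3 powr \<alpha> * l * Q"
  proof -
    have "real (card I) \<le> (\<Sum>i\<in>I. 3 powr \<alpha> * bracket R x i powr (- \<alpha>))"
      using sum_mono [of I "\<lambda>_. 1" "\<lambda>i. 3 powr \<alpha> * bracket R x i powr (- \<alpha>)"] bI by simp
    also have "\<dots> \<le> (\<Sum>i\<in>L. 3 powr \<alpha> * bracket R x i powr (- \<alpha>))"
      using L I by (intro sum_mono2) auto
    also have "\<dots> = 3 powr \<alpha> * (\<Sum>i\<in>L. bracket R x i powr (- \<alpha>))" by (simp add: sum_distrib_left)
    also have "\<dots> \<le> 3 powr \<alpha> * (l * Q)"
      unfolding l_def Q_def using x lattice \<alpha> D_ge_1 by (intro mult_left_mono lattice_sum L R1) auto
    finally show ?thesis by (simp add: mult.assoc)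
  qed
  have hop: "(\<Sum>i\<in>I. \<Sum>j\<in>L - I. cmod (J i j) * (nrm (F M) (cre i (ann j \<phi>)) + nrm (F M) (cre j (ann i \<phi>))))
      \<le> 3 powr \<alpha> * l * (4 * (c * (K * l) + b * lc)) * (e * Q)"
  proof -
    have "(\<Sum>i\<in>I. \<Sum>j\<in>L - I. cmod (J i j) * (nrm (F M) (cre i (ann j \<phi>)) + nrm (F M) (cre j (ann i \<phi>))))
        \<le> (\<Sum>i\<in>I. 4 * (c * (K * l) + b * lc) * e)"
    proof (rule sum_mono)
      fix i assume i: "i \<in> I"
      then have iL: "i \<in> L" using I by auto
      have "(\<Sum>j\<in>L - I. cmod (J i j) * (nrm (F M) (cre i (ann j \<phi>)) + nrm (F M) (cre j (ann i \<phi>))))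
          \<le> (\<Sum>j\<in>L - I. 4 * c * e * cmod (J i j) + 4 * b * Q * (if near i j then 0 else cmod (J i j)))"
      proof (rule sum_mono)
        fix j assume j: "j \<in> L - I"
        then have "j \<in> L" "i \<noteq> j" "j \<noteq> i" using i by auto
        then have "nrm (F M) (cre i (ann j \<phi>)) + nrm (F M) (cre j (ann i \<phi>)) \<le> 2 * (\<nu> i + \<nu> j)"
          using nrm_hop [OF L iL, of j M \<phi>] nrm_hop [OF L _ iL, of j M \<phi>] unfolding \<nu>_def by simp
        also have "\<dots> \<le> 4 * c * e + 4 * b * Q * (if near i j then 0 else 1)"
          using \<nu>c [OF i j] \<nu>b [OF iL] \<nu>b [of j] j mult_nonneg_nonneg [OF c e0] mult_nonneg_nonneg [of b Q] b Q
          by (cases "near i j") (auto simp: mult.assoc)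
        finally have "cmod (J i j) * (nrm (F M) (cre i (ann j \<phi>)) + nrm (F M) (cre j (ann i \<phi>)))
            \<le> cmod (J i j) * (4 * c * e + 4 * b * Q * (if near i j then 0 else 1))"
          by (intro mult_left_mono) auto
        then show "cmod (J i j) * (nrm (F M) (cre i (ann j \<phi>)) + nrm (F M) (cre j (ann i \<phi>)))
            \<le> 4 * c * e * cmod (J i j) + 4 * b * Q * (if near i j then 0 else cmod (J i j))"
          by (auto simp: algebra_simps split: if_splits)
      qed
      also have "\<dots> \<le> (\<Sum>j\<in>L. 4 * c * e * cmod (J i j) + 4 * b * Q * (if near i j then 0 else cmod (J i j)))"
        using L b c e0 Q by (intro sum_mono2) auto
      also have "\<dots> = 4 * c * e * (\<Sum>j\<in>L. cmod (J i j)) + 4 * b * Q * (\<Sum>j\<in>{j \<in> L. R / (64 * \<alpha>) < dist i j}. cmod (J i j))"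
      proof -
        have "(\<Sum>j\<in>L. if near i j then 0 else cmod (J i j)) = (\<Sum>j\<in>{j \<in> L. R / (64 * \<alpha>) < dist i j}. cmod (J i j))"
          unfolding near_def by (subst sum.inter_filter [OF L]) (auto intro!: sum.cong)
        then show ?thesis by (simp add: sum.distrib sum_distrib_left [symmetric])
      qed
      also have "\<dots> \<le> 4 * c * e * (K * l) + 4 * b * Q * (lc * (Q * R powr (- \<alpha>)))"
        unfolding l_def lc_def Q_def using b c e0 R1
        by (intro add_mono mult_left_mono coeff_total [OF J_le [OF iL] iL] far_sum [OF J_le [OF iL] iL]) auto
      also have "\<dots> \<le> 4 * c * e * (K * l) + 4 * b * lc * e"
        using mult_left_mono [OF Re, of "4 * b * lc"] b lc by (simp add: mult_ac)
      finally show "(\<Sum>j\<in>L - I. cmod (J i j) * (nrm (F M) (cre i (ann j \<phi>)) + nrm (F M) (cre j (ann i \<phi>))))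
          \<le> 4 * (c * (K * l) + b * lc) * e"
        by (simp add: algebra_simps)
    qed
    also have "\<dots> = real (card I) * (4 * (c * (K * l) + b * lc) * e)" by simp
    also have "\<dots> \<le> 3 powr \<alpha> * l * Q * (4 * (c * (K * l) + b * lc) * e)"
      using b c K l lc e0 by (intro mult_right_mono cardI) auto
    finally show ?thesis by (simp add: mult_ac)
  qed
  have dens_pair: "(\<Sum>j\<in>L - I. \<nu> j * nrm (F M) (\<lambda>n. (\<Sum>i\<in>I. complex_of_real (V i j) * of_nat (n i)) * \<phi> n))
      \<le> 3 powr \<alpha> * l * (K * l) * c\<^sup>2 * (e * Q) + 3 powr \<alpha> * 3 powr (\<alpha> / 2) * lc * b\<^sup>2 * (e * Q)"
  proof -
    define A where "A = K * far_const \<alpha> * R powr (- \<alpha>) * 3 powr \<alpha> * 3 powr (\<alpha> / 2)"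
    have A0: "0 \<le> A" unfolding A_def far_const_def using K by simp
    \<comment> \<open>Near pairs are treated site by site with the boundary density. The far ones
      stay inside one norm, where they are dominated by the weighted particle number centred at
      \<open>x\<close>.\<close>
    define S where "S i j = (if near i j then \<bar>V i j\<bar> else 0)" for i j
    have y: "nrm (F M) (\<lambda>n. (\<Sum>i\<in>I. complex_of_real (V i j) * of_nat (n i)) * \<phi> n)
        \<le> (\<Sum>i\<in>I. S i j * \<nu> i) + A * bracket R x j powr (- \<alpha>) * (b * Q)" if j: "j \<in> L - I" for j
    proof -
      define T where "T i = (if near i j then 0 else V i j)" for i
      have "nrm (F M) (\<lambda>n. (\<Sum>i\<in>I. complex_of_real (V i j) * of_nat (n i)) * \<phi> n)
          = nrm (F M) (\<lambda>n. (\<Sum>i\<in>I. complex_of_real (if near i j then V i j else 0) * occ i \<phi> n)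
            + complex_of_real (\<Sum>i\<in>I. T i * real (n i)) * \<phi> n)"
      proof (rule nrm_cong)
        fix n
        have "(\<Sum>i\<in>I. complex_of_real (V i j) * of_nat (n i)) * \<phi> n
            = (\<Sum>i\<in>I. complex_of_real (if near i j then V i j else 0) * occ i \<phi> n + complex_of_real (T i * real (n i)) * \<phi> n)"
          unfolding sum_distrib_right T_def by (intro sum.cong refl) (auto simp: occ_def)
        then show "(\<Sum>i\<in>I. complex_of_real (V i j) * of_nat (n i)) * \<phi> n
            = (\<Sum>i\<in>I. complex_of_real (if near i j then V i j else 0) * occ i \<phi> n)
              + complex_of_real (\<Sum>i\<in>I. T i * real (n i)) * \<phi> n"
          by (simp add: sum.distrib sum_distrib_right)
      qed
      also have "\<dots> \<le> nrm (F M) (\<lambda>n. \<Sum>i\<in>I. complex_of_real (if near i j then V i j else 0) * occ i \<phi> n)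
          + nrm (F M) (\<lambda>n. complex_of_real (\<Sum>i\<in>I. T i * real (n i)) * \<phi> n)"
        by (rule nrm_add)
      also have "nrm (F M) (\<lambda>n. \<Sum>i\<in>I. complex_of_real (if near i j then V i j else 0) * occ i \<phi> n) \<le> (\<Sum>i\<in>I. S i j * \<nu> i)"
        by (rule order_trans [OF nrm_sum]) (simp add: nrm_scale S_def \<nu>_def sum_mono)
      also have "nrm (F M) (\<lambda>n. complex_of_real (\<Sum>i\<in>I. T i * real (n i)) * \<phi> n)
          \<le> nrm (F M) (\<lambda>n. complex_of_real (A * bracket R x j powr (- \<alpha>)) * (complex_of_real (wnum L (point_weight \<alpha> R x) n) * \<phi> n))"
      proof (rule nrm_mono)
        fix n
        have "\<bar>\<Sum>i\<in>I. T i * real (n i)\<bar> \<le> (\<Sum>i\<in>I. A * bracket R x j powr (- \<alpha>) * (point_weight \<alpha> R x i * real (n i)))"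
        proof (rule order_trans [OF sum_abs], rule sum_mono)
          fix i assume i: "i \<in> I"
          have p: "1 \<le> 3 powr (\<alpha> / 2) * point_weight \<alpha> R x i"
          proof (rule power2_le_imp_le)
            have "1 \<le> 3 powr \<alpha> * bracket R x i powr (- \<alpha>)" by (rule bI [OF i])
            also have "\<dots> = (3 powr (\<alpha> / 2) * point_weight \<alpha> R x i)\<^sup>2"
              unfolding power_mult_distrib point_weight_square [OF R1(2)]
              by (simp add: power2_eq_square powr_add [symmetric] bracket_commute)
            finally show "1\<^sup>2 \<le> (3 powr (\<alpha> / 2) * point_weight \<alpha> R x i)\<^sup>2" by simp
          qed (use point_weight_pos [OF R1(2), of \<alpha> x i] in simp)
          have "\<bar>T i\<bar> \<le> K * far_const \<alpha> * R powr (- \<alpha>) * 3 powr \<alpha> * bracket R x j powr (- \<alpha>)"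
          proof (cases "near i j")
            case True
            then show ?thesis using K by (simp add: T_def far_const_def)
          next
            case False
            \<comment> \<open>This moves the decay from the pair \<open>i\<close>, \<open>j\<close>
              to the pair \<open>x\<close>, \<open>j\<close>, uniformly for \<open>i\<close> in
              \<open>I\<close>, so that it can be taken out of the sum over
              \<open>i\<close>.\<close>
            have bb: "bracket R x j \<le> 3 * bracket R i j"
            proof -
              have "bracket R x i \<le> 3" using Ix [OF i] R1 by (simp add: bracket_def dist_commute field_simps)
              then have "bracket R x i * bracket R i j \<le> 3 * bracket R i j"
                using bracket_pos [OF R1(2), of i j] by (intro mult_right_mono) auto
              then show ?thesis using bracket_triangle [OF R1(2), of x j i] by linarith
            qed
            have "\<bar>T i\<bar> \<le> K * bracket 1 i j powr (- \<alpha>)"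
              using False V_le [of i j] i j I by (auto simp: T_def)
            also have "\<dots> \<le> K * (far_const \<alpha> * R powr (- \<alpha>) * bracket R i j powr (- \<alpha>))"
              using far_bracket_le [OF False] K by (rule mult_left_mono)
            also have "\<dots> \<le> K * (far_const \<alpha> * R powr (- \<alpha>) * (bracket R x j / 3) powr (- \<alpha>))"
              using bb bracket_pos [OF R1(2), of x j] K \<alpha>_gt
              by (intro mult_left_mono powr_mono2') (auto simp: far_const_def)
            also have "(bracket R x j / 3) powr (- \<alpha>) = 3 powr \<alpha> * bracket R x j powr (- \<alpha>)"
              using bracket_pos [OF R1(2), of x j] by (simp add: powr_divide powr_minus field_simps)
            finally show ?thesis by (simp add: mult_ac)
          qed
          then have "\<bar>T i\<bar> * 1 \<le> K * far_const \<alpha> * R powr (- \<alpha>) * 3 powr \<alpha> * bracket R x j powr (- \<alpha>)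
              * (3 powr (\<alpha> / 2) * point_weight \<alpha> R x i)"
            using p K by (intro mult_mono) (auto simp: far_const_def)
          then have "\<bar>T i\<bar> * real (n i) \<le> K * far_const \<alpha> * R powr (- \<alpha>) * 3 powr \<alpha> * bracket R x j powr (- \<alpha>)
              * (3 powr (\<alpha> / 2) * point_weight \<alpha> R x i) * real (n i)"
            by (intro mult_right_mono) auto
          then show "\<bar>T i * real (n i)\<bar> \<le> A * bracket R x j powr (- \<alpha>) * (point_weight \<alpha> R x i * real (n i))"
            by (simp add: abs_mult A_def mult_ac)
        qed
        also have "\<dots> \<le> (\<Sum>i\<in>L. A * bracket R x j powr (- \<alpha>) * (point_weight \<alpha> R x i * real (n i)))"
          using L I A0 point_weight_pos [OF R1(2), of \<alpha> x] by (intro sum_mono2) (auto simp: less_imp_le)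
        also have "\<dots> = A * bracket R x j powr (- \<alpha>) * wnum L (point_weight \<alpha> R x) n"
          by (simp add: wnum_def sum_distrib_left)
        finally have 1: "\<bar>\<Sum>i\<in>I. T i * real (n i)\<bar> \<le> A * bracket R x j powr (- \<alpha>) * wnum L (point_weight \<alpha> R x) n" .
        also have "\<dots> \<le> \<bar>A * bracket R x j powr (- \<alpha>) * wnum L (point_weight \<alpha> R x) n\<bar>" by simp
        finally have "\<bar>\<Sum>i\<in>I. T i * real (n i)\<bar> * cmod (\<phi> n)
            \<le> \<bar>A * bracket R x j powr (- \<alpha>) * wnum L (point_weight \<alpha> R x) n\<bar> * cmod (\<phi> n)"
          by (intro mult_right_mono) auto
        then show "cmod (complex_of_real (\<Sum>i\<in>I. T i * real (n i)) * \<phi> n)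
            \<le> cmod (complex_of_real (A * bracket R x j powr (- \<alpha>)) * (complex_of_real (wnum L (point_weight \<alpha> R x) n) * \<phi> n))"
          by (simp only: norm_mult norm_of_real abs_mult mult.assoc)
      qed
      also have "\<dots> = A * bracket R x j powr (- \<alpha>) * nrm (F M) (\<lambda>n. complex_of_real (wnum L (point_weight \<alpha> R x) n) * \<phi> n)"
        unfolding nrm_scale using A0 by (simp only: norm_of_real abs_of_nonneg powr_ge_zero mult_nonneg_nonneg)
      also have "\<dots> \<le> A * bracket R x j powr (- \<alpha>) * (b * Q)"
      proof (rule mult_left_mono, rule power2_le_imp_le)
        show "(nrm (F M) (\<lambda>n. complex_of_real (wnum L (point_weight \<alpha> R x) n) * \<phi> n))\<^sup>2 \<le> (b * Q)\<^sup>2"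
          unfolding moment_eq [symmetric] Q_def by (rule dens [OF x])
      qed (use A0 b Q in auto)
      finally show ?thesis by simp
    qed
    have "(\<Sum>j\<in>L - I. \<nu> j * nrm (F M) (\<lambda>n. (\<Sum>i\<in>I. complex_of_real (V i j) * of_nat (n i)) * \<phi> n))
        \<le> (\<Sum>j\<in>L - I. \<nu> j * ((\<Sum>i\<in>I. S i j * \<nu> i) + A * bracket R x j powr (- \<alpha>) * (b * Q)))"
      by (intro sum_mono mult_left_mono y \<nu>0)
    also have "\<dots> = (\<Sum>j\<in>L - I. \<Sum>i\<in>I. S i j * (\<nu> i * \<nu> j)) + (\<Sum>j\<in>L - I. \<nu> j * (A * bracket R x j powr (- \<alpha>) * (b * Q)))"
      by (simp add: distrib_left sum.distrib sum_distrib_left mult_ac)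
    also have "(\<Sum>j\<in>L - I. \<Sum>i\<in>I. S i j * (\<nu> i * \<nu> j)) \<le> 3 powr \<alpha> * l * (K * l) * c\<^sup>2 * (e * Q)"
    proof -
      have "(\<Sum>j\<in>L - I. \<Sum>i\<in>I. S i j * (\<nu> i * \<nu> j)) = (\<Sum>i\<in>I. \<Sum>j\<in>L - I. S i j * (\<nu> i * \<nu> j))"
        by (rule sum.swap)
      also have "\<dots> \<le> (\<Sum>i\<in>I. \<Sum>j\<in>L - I. \<bar>V i j\<bar> * (c\<^sup>2 * e))"
      proof (intro sum_mono)
        fix i j assume ij: "i \<in> I" "j \<in> L - I"
        show "S i j * (\<nu> i * \<nu> j) \<le> \<bar>V i j\<bar> * (c\<^sup>2 * e)"
        proof (cases "near i j")
          case True
          have "\<nu> i * \<nu> j \<le> (c * e) * (c * e)"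
            using \<nu>c [OF ij True] \<nu>0 c e0 by (intro mult_mono) auto
          also have "\<dots> = c\<^sup>2 * (e * e)" by (simp add: power2_eq_square mult_ac)
          also have "\<dots> \<le> c\<^sup>2 * e" using e0 e1 by (intro mult_left_mono) (auto simp: mult_left_le)
          finally show ?thesis using True by (simp add: S_def mult_left_mono)
        next
          case False
          then show ?thesis using e0 by (simp add: S_def)
        qed
      qed
      also have "\<dots> \<le> (\<Sum>i\<in>I. K * l * (c\<^sup>2 * e))"
      proof (rule sum_mono)
        fix i assume "i \<in> I"
        then have i: "i \<in> L" using I by auto
        have "(\<Sum>j\<in>L - I. \<bar>V i j\<bar> * (c\<^sup>2 * e)) \<le> (\<Sum>j\<in>L. \<bar>V i j\<bar> * (c\<^sup>2 * e))"
          using L e0 by (intro sum_mono2) auto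
        also have "\<dots> = (\<Sum>j\<in>L. \<bar>V i j\<bar>) * (c\<^sup>2 * e)" by (simp add: sum_distrib_right)
        also have "\<dots> \<le> K * l * (c\<^sup>2 * e)"
          unfolding l_def using e0 by (intro mult_right_mono coeff_total [OF V_le [OF i] i]) auto
        finally show "(\<Sum>j\<in>L - I. \<bar>V i j\<bar> * (c\<^sup>2 * e)) \<le> K * l * (c\<^sup>2 * e)" .
      qed
      also have "\<dots> = real (card I) * (K * l * (c\<^sup>2 * e))" by simp
      also have "\<dots> \<le> 3 powr \<alpha> * l * Q * (K * l * (c\<^sup>2 * e))"
        using K l e0 by (intro mult_right_mono cardI) auto
      finally show ?thesis by (simp add: mult_ac)
    qed
    also have "(\<Sum>j\<in>L - I. \<nu> j * (A * bracket R x j powr (- \<alpha>) * (b * Q)))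
        \<le> 3 powr \<alpha> * 3 powr (\<alpha> / 2) * lc * b\<^sup>2 * (e * Q)"
    proof -
      have "(\<Sum>j\<in>L - I. \<nu> j * (A * bracket R x j powr (- \<alpha>) * (b * Q)))
          \<le> (\<Sum>j\<in>L - I. (b * Q) * (A * bracket R x j powr (- \<alpha>) * (b * Q)))"
        using A0 b Q by (intro sum_mono mult_right_mono \<nu>b) auto
      also have "\<dots> \<le> (\<Sum>j\<in>L. (b * Q) * (A * bracket R x j powr (- \<alpha>) * (b * Q)))"
        using L A0 b Q by (intro sum_mono2) auto
      also have "\<dots> = (b * Q) * (A * (b * Q)) * (\<Sum>j\<in>L. bracket R x j powr (- \<alpha>))"
        by (simp add: sum_distrib_left mult_ac)
      also have "\<dots> \<le> (b * Q) * (A * (b * Q)) * (l * Q)"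
        unfolding l_def Q_def using x lattice \<alpha> D_ge_1 A0 b R1 by (intro mult_left_mono lattice_sum L R1) auto
      also have "\<dots> = 3 powr \<alpha> * 3 powr (\<alpha> / 2) * lc * b\<^sup>2 * Q * (Q * R powr (- \<alpha>) * Q)"
        unfolding A_def lc_def long_const_def l_def by (simp add: power2_eq_square mult_ac)
      also have "\<dots> \<le> 3 powr \<alpha> * 3 powr (\<alpha> / 2) * lc * b\<^sup>2 * Q * e"
        using lc b Q by (intro mult_left_mono Re) auto
      finally show ?thesis by (simp add: mult_ac)
    qed
    finally show ?thesis by simp
  qed
  have eQ: "e * Q = R * (R ^ CARD('d) * R ^ CARD('d) * R ^ CARD('d) * R powr (- \<alpha>))"
    unfolding e_def Q_def by (simp add: mult_ac)
  show ?thesis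
    using add_mono [OF hop dens_pair [unfolded \<nu>_def]]
    unfolding boundary_terms_def cross_const_def l_def [symmetric] lc_def [symmetric] eQ [symmetric] by (simp only: distrib_right)
qed

end

section \<open>Passage to the full Fock space\<close>

definition trunc :: "'s set \<Rightarrow> nat \<Rightarrow> 's wave \<Rightarrow> 's wave" where
  "trunc L M \<psi> = (\<lambda>n. if n \<in> sectors L (Suc M) then \<psi> n else 0)"

lemma fock_norm_nonneg: "0 \<le> fock_norm \<psi>"
  unfolding fock_norm_def by (intro real_sqrt_ge_zero infsum_nonneg) auto

lemma fock_vanish: "\<psi> \<in> fock L \<Longrightarrow> n \<notin> configs L \<Longrightarrow> \<psi> n = 0"
  by (simp add: fock_def)

lemma nrm_le_fock_norm:
  assumes "\<psi> \<in> fock L" "finite F"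
  shows "nrm F \<psi> \<le> fock_norm \<psi>"
  unfolding nrm_def L2_set_def fock_norm_def
  using assms by (intro real_sqrt_le_mono finite_sum_le_infsum) (auto simp: fock_def)

lemma configs_in_sectors:
  assumes "finite L" "finite G"
  shows "\<exists>M. G \<inter> configs L \<subseteq> sectors L (Suc M)"
proof
  show "G \<inter> configs L \<subseteq> sectors L (Suc (\<Sum>n\<in>G. sum n L))"
  proof
    fix n assume n: "n \<in> G \<inter> configs L"
    then have "sum n L \<le> (\<Sum>n\<in>G. sum n L)"
      using assms(2) by (intro member_le_sum [of n G "\<lambda>n. sum n L"]) auto
    then show "n \<in> sectors L (Suc (\<Sum>n\<in>G. sum n L))"
      using n by (auto simp: sectors_def)
  qed
qed

text \<open>The sectors exhaust the configurations on \<open>L\<close>: every finite partial sum of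
  squares is contained in one of them, so a bound uniform in \<open>M\<close> passes to the infinite
  sum.\<close>

lemma fockI:
  assumes L: "finite L" and v: "\<And>n. n \<notin> configs L \<Longrightarrow> \<psi> n = 0"
    and c: "\<And>M. nrm (sectors L (Suc M)) \<psi> \<le> c"
  shows "\<psi> \<in> fock L" and "fock_norm \<psi> \<le> c"
proof -
  have b: "(\<Sum>n\<in>G. (cmod (\<psi> n))\<^sup>2) \<le> c\<^sup>2" if G: "finite G" for G
  proof -
    obtain M where M: "G \<inter> configs L \<subseteq> sectors L (Suc M)"
      using configs_in_sectors [OF L G] by blast
    have "(\<Sum>n\<in>G. (cmod (\<psi> n))\<^sup>2) = (\<Sum>n\<in>G \<inter> configs L. (cmod (\<psi> n))\<^sup>2)"
      using G v by (intro sum.mono_neutral_right) auto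
    also have "\<dots> \<le> (nrm (sectors L (Suc M)) \<psi>)\<^sup>2"
      unfolding nrm_square by (intro sum_mono2 finite_sectors L M) auto
    also have "\<dots> \<le> c\<^sup>2" by (intro power_mono c nrm_nonneg)
    finally show ?thesis .
  qed
  have s: "(\<lambda>n. (cmod (\<psi> n))\<^sup>2) summable_on UNIV"
    by (rule nonneg_bdd_above_summable_on) (auto intro!: bdd_aboveI [of _ "c\<^sup>2"] b)
  then show "\<psi> \<in> fock L" using v by (simp add: fock_def)
  have "0 \<le> c" using c [of 0] nrm_nonneg order_trans by blast
  moreover have "(\<Sum>\<^sub>\<infinity>n. (cmod (\<psi> n))\<^sup>2) \<le> c\<^sup>2"
    by (rule infsum_le_finite_sums [OF s]) (rule b)
  ultimately show "fock_norm \<psi> \<le> c"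
    unfolding fock_norm_def by (intro real_le_lsqrt infsum_nonneg) auto
qed

lemma fock_add:
  assumes L: "finite L" and "\<phi> \<in> fock L" "\<psi> \<in> fock L"
  shows "(\<lambda>n. \<phi> n + \<psi> n) \<in> fock L"
proof (rule fockI(1) [OF L])
  fix M
  show "nrm (sectors L (Suc M)) (\<lambda>n. \<phi> n + \<psi> n) \<le> fock_norm \<phi> + fock_norm \<psi>"
    by (rule order_trans [OF nrm_add add_mono])
       (rule nrm_le_fock_norm [OF _ finite_sectors [OF L]], rule assms)+
qed (use assms in \<open>auto simp: fock_def\<close>)

lemma fock_scale:
  assumes L: "finite L" and "\<phi> \<in> fock L"
  shows "(\<lambda>n. c * \<phi> n) \<in> fock L"
proof (rule fockI(1) [OF L])
  fix M
  show "nrm (sectors L (Suc M)) (\<lambda>n. c * \<phi> n) \<le> cmod c * fock_norm \<phi>"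
    unfolding nrm_scale by (intro mult_left_mono nrm_le_fock_norm [OF assms(2)] L finite_sectors) auto
qed (use assms in \<open>auto simp: fock_def\<close>)

lemma wave_space_fock: "finite L \<Longrightarrow> wave_space (\<lambda>\<phi>. \<phi> \<in> fock L)"
  by unfold_locales (simp add: fock_def, rule fock_add, assumption+, rule fock_scale)

lemma fock_diff:
  assumes "finite L" "\<phi> \<in> fock L" "\<psi> \<in> fock L"
  shows "(\<lambda>n. \<phi> n - \<psi> n) \<in> fock L"
  using fock_add [OF assms(1,2) fock_scale [OF assms(1,3), of "-1"]] by simp

lemma fock_inner_abs_summable:
  assumes "\<phi> \<in> fock L" "\<xi> \<in> fock L"
  shows "(\<lambda>n. norm (cnj (\<phi> n) * \<xi> n)) summable_on UNIV"
    and "cmod (fock_inner \<phi> \<xi>) \<le> fock_norm \<phi> * fock_norm \<xi>"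
proof -
  have b: "(\<Sum>n\<in>G. norm (cnj (\<phi> n) * \<xi> n)) \<le> fock_norm \<phi> * fock_norm \<xi>" if G: "finite G" for G
  proof -
    have "(\<Sum>n\<in>G. norm (cnj (\<phi> n) * \<xi> n)) = (\<Sum>n\<in>G. \<bar>cmod (\<phi> n)\<bar> * \<bar>cmod (\<xi> n)\<bar>)"
      by (simp add: norm_mult)
    also have "\<dots> \<le> nrm G \<phi> * nrm G \<xi>"
      unfolding nrm_def by (rule L2_set_mult_ineq)
    also have "\<dots> \<le> fock_norm \<phi> * fock_norm \<xi>"
      by (intro mult_mono nrm_le_fock_norm [OF assms(1) G] nrm_le_fock_norm [OF assms(2) G] fock_norm_nonneg nrm_nonneg)
    finally show ?thesis .
  qed
  show s: "(\<lambda>n. norm (cnj (\<phi> n) * \<xi> n)) summable_on UNIV"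
    by (rule nonneg_bdd_above_summable_on) (auto intro!: bdd_aboveI [of _ "fock_norm \<phi> * fock_norm \<xi>"] b)
  show "cmod (fock_inner \<phi> \<xi>) \<le> fock_norm \<phi> * fock_norm \<xi>"
    unfolding fock_inner_def
    by (rule order_trans [OF norm_infsum_bound [OF s]], rule infsum_le_finite_sums [OF s]) (rule b)
qed

lemma fock_inner_add_left:
  assumes "\<phi> \<in> fock L" "\<phi>' \<in> fock L" "\<xi> \<in> fock L"
  shows "fock_inner (\<lambda>n. \<phi> n + \<phi>' n) \<xi> = fock_inner \<phi> \<xi> + fock_inner \<phi>' \<xi>"
  unfolding fock_inner_def
  using infsum_add [OF abs_summable_summable [OF fock_inner_abs_summable(1) [OF assms(1,3)]]
      abs_summable_summable [OF fock_inner_abs_summable(1) [OF assms(2,3)]]]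
  by (simp add: distrib_right)

lemma fock_inner_add_right:
  assumes "\<phi> \<in> fock L" "\<xi> \<in> fock L" "\<xi>' \<in> fock L"
  shows "fock_inner \<phi> (\<lambda>n. \<xi> n + \<xi>' n) = fock_inner \<phi> \<xi> + fock_inner \<phi> \<xi>'"
  unfolding fock_inner_def
  using infsum_add [OF abs_summable_summable [OF fock_inner_abs_summable(1) [OF assms(1,2)]]
      abs_summable_summable [OF fock_inner_abs_summable(1) [OF assms(1,3)]]]
  by (simp add: distrib_left)

lemma fock_inner_finite:
  assumes "finite F" "\<And>n. n \<notin> F \<Longrightarrow> \<phi> n = 0 \<or> \<xi> n = 0"
  shows "fock_inner \<phi> \<xi> = inn F \<phi> \<xi>"
proof -
  have "fock_inner \<phi> \<xi> = (\<Sum>\<^sub>\<infinity>n\<in>F. cnj (\<phi> n) * \<xi> n)"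
    unfolding fock_inner_def using assms(2) by (intro infsum_cong_neutral) auto
  then show ?thesis using assms(1) by (simp add: inn_def)
qed

lemma finite_wave_fock:
  assumes "\<And>n. n \<notin> configs L \<Longrightarrow> \<psi> n = 0" "finite {n. \<psi> n \<noteq> 0}"
  shows "\<psi> \<in> fock L"
proof -
  have "{n \<in> UNIV. (cmod (\<psi> n))\<^sup>2 \<noteq> 0} = {n. \<psi> n \<noteq> 0}" by auto
  then have "(\<lambda>n. (cmod (\<psi> n))\<^sup>2) summable_on UNIV"
    using assms(2) by (intro finite_nonzero_values_imp_summable_on) simp
  then show ?thesis using assms(1) by (simp add: fock_def)
qed

lemma trunc_finite: "finite L \<Longrightarrow> finite {n. trunc L M \<psi> n \<noteq> 0}"
  by (rule finite_subset [OF _ finite_sectors [of L "Suc M"]]) (auto simp: trunc_def)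

lemma trunc_fock: "finite L \<Longrightarrow> trunc L M \<psi> \<in> fock L"
  by (rule finite_wave_fock [OF _ trunc_finite]) (auto simp: trunc_def sectors_def)

lemma trunc_outside: "n \<notin> sectors L (Suc M) \<Longrightarrow> trunc L M \<psi> n = 0"
  by (simp add: trunc_def)

lemma trunc_inside: "n \<in> sectors L (Suc M) \<Longrightarrow> trunc L M \<psi> n = \<psi> n"
  by (simp add: trunc_def)

lemma trunc_id: "(\<And>n. n \<notin> sectors L (Suc M) \<Longrightarrow> \<psi> n = 0) \<Longrightarrow> trunc L M \<psi> = \<psi>"
  by (auto simp: trunc_def)

lemma fock_norm_trunc:
  assumes L: "finite L"
  shows "fock_norm (trunc L M \<psi>) = nrm (sectors L (Suc M)) \<psi>"
proof -
  have "(\<Sum>\<^sub>\<infinity>n. (cmod (trunc L M \<psi> n))\<^sup>2) = (\<Sum>\<^sub>\<infinity>n\<in>sectors L (Suc M). (cmod (\<psi> n))\<^sup>2)"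
    by (intro infsum_cong_neutral) (auto simp: trunc_def)
  also have "\<dots> = (\<Sum>n\<in>sectors L (Suc M). (cmod (\<psi> n))\<^sup>2)"
    using finite_sectors [OF L] by simp
  finally show ?thesis unfolding fock_norm_def nrm_def L2_set_def by simp
qed

lemma trunc_tendsto:
  assumes L: "finite L" and \<psi>: "\<psi> \<in> fock L"
  shows "(\<lambda>M. fock_norm (\<lambda>n. \<psi> n - trunc L M \<psi> n)) \<longlonglongrightarrow> 0"
proof (rule LIMSEQ_I)
  fix r :: real assume r: "0 < r"
  let ?g = "\<lambda>n. (cmod (\<psi> n))\<^sup>2"
  have s: "?g summable_on UNIV" using \<psi> by (simp add: fock_def)
  have "0 < (r / 2)\<^sup>2" using r by simp
  then obtain G where G: "finite G" "dist (sum ?g G) (infsum ?g UNIV) \<le> (r / 2)\<^sup>2"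
    using infsum_finite_approximation [OF s] by blast
  obtain M0 where M0: "G \<inter> configs L \<subseteq> sectors L (Suc M0)"
    using configs_in_sectors [OF L G(1)] by blast
  have "fock_norm (\<lambda>n. \<psi> n - trunc L M \<psi> n) \<le> r / 2" if M: "M0 \<le> M" for M
  proof (rule fockI(2) [OF L])
    fix K
    let ?F = "sectors L (Suc M)" and ?F' = "sectors L (Suc K)"
    have "(nrm ?F' (\<lambda>n. \<psi> n - trunc L M \<psi> n))\<^sup>2 = (\<Sum>n\<in>?F' - ?F. ?g n)"
      unfolding nrm_square using finite_sectors [OF L]
      by (intro sum.mono_neutral_cong_right) (auto simp: trunc_def)
    also have "\<dots> = sum ?g (?F' \<union> ?F) - sum ?g ?F"
      using finite_sectors [OF L] by (simp add: sum_diff [of "?F' \<union> ?F" ?F, symmetric] Un_Diff)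
    also have "\<dots> \<le> infsum ?g UNIV - sum ?g G"
    proof (rule diff_mono)
      show "sum ?g (?F' \<union> ?F) \<le> infsum ?g UNIV"
        using finite_sectors [OF L] by (intro finite_sum_le_infsum s) auto
      have "sum ?g G = sum ?g (G \<inter> configs L)"
        using G(1) \<psi> by (intro sum.mono_neutral_right) (auto simp: fock_def)
      also have "\<dots> \<le> sum ?g ?F"
        using M0 sectors_mono [of "Suc M0" "Suc M" L] M by (intro sum_mono2 finite_sectors L) auto
      finally show "sum ?g G \<le> sum ?g ?F" .
    qed
    also have "\<dots> \<le> (r / 2)\<^sup>2" using G(2) by (simp add: dist_real_def)
    finally show "nrm ?F' (\<lambda>n. \<psi> n - trunc L M \<psi> n) \<le> r / 2"
      by (rule power2_le_imp_le) (use r in simp)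
  qed (use \<psi> in \<open>auto simp: fock_def trunc_def\<close>)
  moreover have "r / 2 < r" using r by simp
  ultimately have "fock_norm (\<lambda>n. \<psi> n - trunc L M \<psi> n) < r" if "M0 \<le> M" for M
    using that order_le_less_trans by blast
  then show "\<exists>M0. \<forall>M\<ge>M0. norm (fock_norm (\<lambda>n. \<psi> n - trunc L M \<psi> n) - 0) < r"
    by (intro exI [of _ M0]) (auto simp: abs_of_nonneg [OF fock_norm_nonneg])
qed

context hermitian_hopping
begin

context
  fixes V :: "'s \<Rightarrow> 's \<Rightarrow> real" and S :: "'s set"
  assumes S: "S \<subseteq> L"
begin

lemma evol_fock:
  assumes \<psi>: "\<psi> \<in> fock L"
  shows "time_evol (hamiltonian J V S) t \<psi> \<in> fock L"
    and "fock_norm (time_evol (hamiltonian J V S) t \<psi>) \<le> fock_norm \<psi>"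
proof -
  have v: "time_evol (hamiltonian J V S) t \<psi> n = 0" if "n \<notin> configs L" for n
    by (rule evol_configs [OF S fock_vanish [OF \<psi>] that])
  have n: "nrm (F M) (time_evol (hamiltonian J V S) t \<psi>) \<le> fock_norm \<psi>" for M
    unfolding evol_nrm [OF S] by (rule nrm_le_fock_norm [OF \<psi> finite_F])
  show "time_evol (hamiltonian J V S) t \<psi> \<in> fock L"
    by (rule fockI(1) [OF L v n])
  show "fock_norm (time_evol (hamiltonian J V S) t \<psi>) \<le> fock_norm \<psi>"
    by (rule fockI(2) [OF L v n])
qed

lemma evol_linear: "linear_on (\<lambda>\<phi>. \<phi> \<in> fock L) (time_evol (hamiltonian J V S) t)"
  unfolding linear_on_def
proof (intro conjI allI impI ext)
  let ?U = "time_evol (hamiltonian J V S) t"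
  \<comment> \<open>Each coefficient is computed in the sector bounded by its own particle number,
    where the evolution is a finite matrix.\<close>
  have mem: "n \<in> F (sum n L)" if "n \<in> configs L" for n using that by (simp add: sectors_def)
  show "?U (\<lambda>n. \<phi> n + \<psi> n) n = ?U \<phi> n + ?U \<psi> n" if \<phi>: "\<phi> \<in> fock L" and \<psi>: "\<psi> \<in> fock L" for \<phi> \<psi> n
  proof (cases "n \<in> configs L")
    case True
    have "?U (\<lambda>n. \<phi> n + \<psi> n) n
        = (\<Sum>m\<in>F (sum n L). ?U (ket m) n * \<phi> m) + (\<Sum>m\<in>F (sum n L). ?U (ket m) n * \<psi> m)"
      by (rule trans [OF evol_ket [OF S mem [OF True]]]) (simp add: distrib_left sum.distrib)
    then show ?thesis
      by (simp only: evol_ket [OF S mem [OF True], symmetric])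
  next
    case False
    then show ?thesis
      using fock_vanish [OF evol_fock(1) [OF \<phi>]] fock_vanish [OF evol_fock(1) [OF \<psi>]]
        fock_vanish [OF evol_fock(1) [OF fock_add [OF L \<phi> \<psi>]]] by simp
  qed
  show "?U (\<lambda>n. c * \<phi> n) n = c * ?U \<phi> n" if \<phi>: "\<phi> \<in> fock L" for c \<phi> n
  proof (cases "n \<in> configs L")
    case True
    have "?U (\<lambda>n. c * \<phi> n) n = c * (\<Sum>m\<in>F (sum n L). ?U (ket m) n * \<phi> m)"
      by (rule trans [OF evol_ket [OF S mem [OF True]]]) (simp add: sum_distrib_left mult.left_commute)
    then show ?thesis
      by (simp only: evol_ket [OF S mem [OF True], symmetric])
  next
    case False
    then show ?thesis
      using fock_vanish [OF evol_fock(1) [OF \<phi>]] fock_vanish [OF evol_fock(1) [OF fock_scale [OF L \<phi>]]] by simp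
  qed
qed

end

end

section \<open>Bounded observables and their locality\<close>

lemma bounded_op_linear: "bounded_op L A \<Longrightarrow> linear_on (\<lambda>\<phi>. \<phi> \<in> fock L) A"
  by (simp add: bounded_op_def linear_on_def)

lemma bounded_op_fock: "bounded_op L A \<Longrightarrow> \<psi> \<in> fock L \<Longrightarrow> A \<psi> \<in> fock L"
  by (simp add: bounded_op_def)

lemma op_norm_contraction:
  assumes A: "bounded_op L A" and n: "op_norm L A \<le> 1" and \<psi>: "\<psi> \<in> fock L"
  shows "fock_norm (A \<psi>) \<le> fock_norm \<psi>"
proof -
  obtain K where K: "\<And>\<phi>. \<phi> \<in> fock L \<Longrightarrow> fock_norm (A \<phi>) \<le> K * fock_norm \<phi>"
    using A unfolding bounded_op_def by blast
  show ?thesis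
  proof (cases "fock_norm \<psi> = 0")
    case True
    then show ?thesis using K [OF \<psi>] by simp
  next
    case False
    then have p: "0 < fock_norm \<psi>" using fock_norm_nonneg [of \<psi>] by simp
    \<comment> \<open>The supremum in \<open>op_norm\<close> dominates its terms only if the
      quotients are bounded above; vectors of norm \<open>0\<close> contribute \<open>0\<close> by
      the convention for division.\<close>
    have "bdd_above ((\<lambda>\<phi>. fock_norm (A \<phi>) / fock_norm \<phi>) ` fock L)"
    proof (rule bdd_aboveI2)
      fix \<phi> assume \<phi>: "\<phi> \<in> fock L"
      show "fock_norm (A \<phi>) / fock_norm \<phi> \<le> \<bar>K\<bar>"
      proof (cases "fock_norm \<phi> = 0")
        case False
        then have q: "0 < fock_norm \<phi>" using fock_norm_nonneg [of \<phi>] by simp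
        have "K * fock_norm \<phi> \<le> \<bar>K\<bar> * fock_norm \<phi>" using q by (intro mult_right_mono) auto
        then have "fock_norm (A \<phi>) \<le> \<bar>K\<bar> * fock_norm \<phi>" using K [OF \<phi>] by linarith
        then show ?thesis using q by (simp add: divide_le_eq)
      qed simp
    qed
    then have "fock_norm (A \<psi>) / fock_norm \<psi> \<le> op_norm L A"
      unfolding op_norm_def by (rule cSUP_upper [OF \<psi>])
    then have "fock_norm (A \<psi>) / fock_norm \<psi> \<le> 1" using n by linarith
    then show ?thesis using p by (simp add: divide_le_eq)
  qed
qed

text \<open>A domain inside the Fock space that \<open>ann\<close> and \<open>cre\<close> leave
  invariant, as the whole Fock space is not. It contains all truncated states.\<close>

definition finite_wave :: "'s set \<Rightarrow> 's wave \<Rightarrow> bool" where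
  "finite_wave L \<phi> \<longleftrightarrow> (\<forall>n. n \<notin> configs L \<longrightarrow> \<phi> n = 0) \<and> finite {n. \<phi> n \<noteq> 0}"

lemma wave_space_finite_wave: "wave_space (finite_wave L)"
proof
  show "finite_wave L (\<lambda>n. 0)" by (simp add: finite_wave_def)
  show "finite_wave L (\<lambda>n. \<phi> n + \<psi> n)" if "finite_wave L \<phi>" "finite_wave L \<psi>" for \<phi> \<psi>
  proof -
    have "{n. \<phi> n + \<psi> n \<noteq> 0} \<subseteq> {n. \<phi> n \<noteq> 0} \<union> {n. \<psi> n \<noteq> 0}" by auto
    moreover have "finite ({n. \<phi> n \<noteq> 0} \<union> {n. \<psi> n \<noteq> 0})" using that by (simp add: finite_wave_def)
    ultimately have "finite {n. \<phi> n + \<psi> n \<noteq> 0}" by (rule finite_subset)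
    then show ?thesis using that by (simp add: finite_wave_def)
  qed
  show "finite_wave L (\<lambda>n. c * \<phi> n)" if "finite_wave L \<phi>" for c \<phi>
    using that by (cases "c = 0") (auto simp: finite_wave_def)
qed

lemma finite_wave_in_fock: "finite_wave L \<phi> \<Longrightarrow> \<phi> \<in> fock L"
  unfolding finite_wave_def by (rule finite_wave_fock) auto

lemma finite_wave_trunc: "finite L \<Longrightarrow> finite_wave L (trunc L M \<psi>)"
  using trunc_finite [of L M \<psi>] trunc_fock [of L M \<psi>] by (simp add: finite_wave_def fock_def)

lemma finite_wave_ann:
  assumes "k \<in> L" "finite_wave L \<phi>"
  shows "finite_wave L (ann k \<phi>)"
proof -
  have "{n. ann k \<phi> n \<noteq> 0} \<subseteq> (\<lambda>m. m(k := m k - 1)) ` {n. \<phi> n \<noteq> 0}"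
  proof
    fix n assume "n \<in> {n. ann k \<phi> n \<noteq> 0}"
    then have "\<phi> (n(k := n k + 1)) \<noteq> 0" by (auto simp: ann_def)
    moreover have "n = (\<lambda>m. m(k := m k - 1)) (n(k := n k + 1))" by simp
    ultimately show "n \<in> (\<lambda>m. m(k := m k - 1)) ` {n. \<phi> n \<noteq> 0}" by blast
  qed
  then have "finite {n. ann k \<phi> n \<noteq> 0}"
    using assms(2) finite_subset by (auto simp: finite_wave_def)
  moreover have "ann k \<phi> n = 0" if "n \<notin> configs L" for n
  proof -
    have "n(k := n k + 1) \<notin> configs L" using that assms(1) by (auto simp: configs_def)
    then show ?thesis using assms(2) by (simp add: finite_wave_def ann_def)
  qed
  ultimately show ?thesis by (simp add: finite_wave_def)
qed

lemma finite_wave_cre: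
  assumes "k \<in> L" "finite_wave L \<phi>"
  shows "finite_wave L (cre k \<phi>)"
proof -
  have "{n. cre k \<phi> n \<noteq> 0} \<subseteq> (\<lambda>m. m(k := m k + 1)) ` {n. \<phi> n \<noteq> 0}"
  proof
    fix n assume "n \<in> {n. cre k \<phi> n \<noteq> 0}"
    then have "\<phi> (n(k := n k - 1)) \<noteq> 0" "n k \<noteq> 0" by (auto simp: cre_def)
    moreover have "n = (\<lambda>m. m(k := m k + 1)) (n(k := n k - 1))" using \<open>n k \<noteq> 0\<close> by auto
    ultimately show "n \<in> (\<lambda>m. m(k := m k + 1)) ` {n. \<phi> n \<noteq> 0}" by blast
  qed
  then have "finite {n. cre k \<phi> n \<noteq> 0}"
    using assms(2) finite_subset by (auto simp: finite_wave_def)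
  moreover have "cre k \<phi> n = 0" if "n \<notin> configs L" for n
  proof -
    have "n(k := n k - 1) \<notin> configs L" using that assms(1) by (auto simp: configs_def)
    then show ?thesis using assms(2) by (simp add: finite_wave_def cre_def)
  qed
  ultimately show ?thesis by (simp add: finite_wave_def)
qed

definition slice :: "'s set \<Rightarrow> 's wave \<Rightarrow> 's conf \<Rightarrow> 's wave" where
  "slice X \<psi> n = (\<lambda>m. if m \<in> configs X then \<psi> (\<lambda>x. if x \<in> X then m x else n x) else 0)"

lemma ampliation_slice: "ampliation X A \<psi> n = A (slice X \<psi> n) (\<lambda>x. if x \<in> X then n x else 0)"
  by (simp add: ampliation_def slice_def)

lemma slice_fock:
  assumes "finite_wave L \<phi>"
  shows "slice X \<phi> n \<in> fock X"
proof (rule finite_wave_fock)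
  let ?g = "\<lambda>m x. if x \<in> X then m x else n x"
  \<comment> \<open>The support of a slice embeds into the support of the wave, and is therefore
    finite.\<close>
  have "inj_on ?g (configs X)"
  proof (rule inj_onI)
    fix m m' assume m: "m \<in> configs X" "m' \<in> configs X" "?g m = ?g m'"
    show "m = m'"
    proof
      fix y show "m y = m' y"
        using m fun_cong [OF m(3), of y] by (cases "y \<in> X") (auto simp: configs_def)
    qed
  qed
  moreover have "{m. slice X \<phi> n m \<noteq> 0} \<subseteq> configs X" by (auto simp: slice_def)
  ultimately have "inj_on ?g {m. slice X \<phi> n m \<noteq> 0}" by (rule inj_on_subset)
  moreover have "?g ` {m. slice X \<phi> n m \<noteq> 0} \<subseteq> {n. \<phi> n \<noteq> 0}"
    by (auto simp: slice_def split: if_splits)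
  then have "finite (?g ` {m. slice X \<phi> n m \<noteq> 0})"
    using assms finite_subset by (auto simp: finite_wave_def)
  ultimately show "finite {m. slice X \<phi> n m \<noteq> 0}" by (rule finite_imageD [rotated])
qed (simp add: slice_def)

lemma supported_commute:
  assumes A: "supported_on L X A" and k: "k \<in> L" "k \<notin> X" and \<phi>: "finite_wave L \<phi>"
  shows "A (ann k \<phi>) = ann k (A \<phi>)" and "A (cre k \<phi>) = cre k (A \<phi>)"
proof -
  obtain B where B: "bounded_op X B" "\<And>\<psi>. \<psi> \<in> fock L \<Longrightarrow> A \<psi> = ampliation X B \<psi>"
    using A by (auto simp: supported_on_def)
  have s: "B (\<lambda>m. c * slice X \<phi> n m) m = c * B (slice X \<phi> n) m" for c n m
    using linear_on_scale [OF bounded_op_linear [OF B(1)], OF slice_fock [OF \<phi>]] by simp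
  have "A (ann k \<phi>) n = ann k (A \<phi>) n" for n
  proof -
    let ?c = "complex_of_real (sqrt (real (n k + 1)))" and ?n = "n(k := n k + 1)"
    have h1: "slice X (ann k \<phi>) n = (\<lambda>m. ?c * slice X \<phi> ?n m)"
    proof
      fix m
      have a: "(if k \<in> X then m k else n k) = n k" using k by simp
      have b: "(\<lambda>x. if x \<in> X then m x else n x)(k := n k + 1) = (\<lambda>x. if x \<in> X then m x else ?n x)"
        using k by auto
      show "slice X (ann k \<phi>) n m = ?c * slice X \<phi> ?n m"
        unfolding slice_def ann_def a b by simp
    qed
    have h2: "(\<lambda>x. if x \<in> X then n x else 0) = (\<lambda>x. if x \<in> X then ?n x else 0)"
      using k by auto
    have "A (ann k \<phi>) n = B (slice X (ann k \<phi>) n) (\<lambda>x. if x \<in> X then n x else 0)"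
      by (simp only: B(2) [OF finite_wave_in_fock [OF finite_wave_ann [OF k(1) \<phi>]]] ampliation_slice)
    also have "\<dots> = ?c * B (slice X \<phi> ?n) (\<lambda>x. if x \<in> X then ?n x else 0)"
      unfolding h1 s h2 ..
    also have "\<dots> = ann k (A \<phi>) n"
      by (simp only: ann_def B(2) [OF finite_wave_in_fock [OF \<phi>]] ampliation_slice)
    finally show ?thesis .
  qed
  then show "A (ann k \<phi>) = ann k (A \<phi>)" by blast
  have "A (cre k \<phi>) n = cre k (A \<phi>) n" for n
  proof -
    let ?c = "complex_of_real (sqrt (real (n k)))" and ?n = "n(k := n k - 1)"
    have h1: "slice X (cre k \<phi>) n = (\<lambda>m. ?c * slice X \<phi> ?n m)"
    proof
      fix m
      have a: "(if k \<in> X then m k else n k) = n k" using k by simp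
      have b: "(\<lambda>x. if x \<in> X then m x else n x)(k := n k - 1) = (\<lambda>x. if x \<in> X then m x else ?n x)"
        using k by auto
      show "slice X (cre k \<phi>) n m = ?c * slice X \<phi> ?n m"
        unfolding slice_def cre_def a b by simp
    qed
    have h2: "(\<lambda>x. if x \<in> X then n x else 0) = (\<lambda>x. if x \<in> X then ?n x else 0)"
      using k by auto
    have "A (cre k \<phi>) n = B (slice X (cre k \<phi>) n) (\<lambda>x. if x \<in> X then n x else 0)"
      by (simp only: B(2) [OF finite_wave_in_fock [OF finite_wave_cre [OF k(1) \<phi>]]] ampliation_slice)
    also have "\<dots> = ?c * B (slice X \<phi> ?n) (\<lambda>x. if x \<in> X then ?n x else 0)"
      unfolding h1 s h2 ..
    also have "\<dots> = cre k (A \<phi>) n"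
      by (simp only: cre_def B(2) [OF finite_wave_in_fock [OF \<phi>]] ampliation_slice)
    finally show ?thesis .
  qed
  then show "A (cre k \<phi>) = cre k (A \<phi>)" by blast
qed

lemma trunc_eq_sum_ket:
  assumes "finite L"
  shows "trunc L M \<phi> = (\<lambda>n. \<Sum>m\<in>sectors L (Suc M). \<phi> m * ket m n)"
  using finite_sectors [OF assms, of "Suc M"] by (intro ext) (simp add: trunc_def ket_def mult_delta_right)

context hermitian_hopping
begin

lemma inn_trunc: "inn (F M) \<phi> \<xi> = fock_inner (trunc L M \<phi>) \<xi>"
proof -
  have "fock_inner (trunc L M \<phi>) \<xi> = inn (F M) (trunc L M \<phi>) \<xi>"
    by (rule fock_inner_finite [OF finite_F]) (simp add: trunc_outside)
  also have "\<dots> = inn (F M) \<phi> \<xi>" by (rule inn_cong) (simp_all add: trunc_inside)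
  finally show ?thesis by simp
qed

lemma inn_trunc_right: "inn (F M) \<phi> \<xi> = fock_inner \<phi> (trunc L M \<xi>)"
proof -
  have "fock_inner \<phi> (trunc L M \<xi>) = inn (F M) \<phi> (trunc L M \<xi>)"
    by (rule fock_inner_finite [OF finite_F]) (simp add: trunc_outside)
  also have "\<dots> = inn (F M) \<phi> \<xi>" by (rule inn_cong) (simp_all add: trunc_inside)
  finally show ?thesis by simp
qed

context
  fixes A :: "'s oper" and M :: nat
  assumes A: "bounded_op L A"
begin

text \<open>The observable may change the particle number. Applied to a truncated wave and read on
  \<open>F M\<close> only, it becomes its compression to the sectors, which inherits hermiticity,
  the norm bound and locality, as the next lemmas verify.\<close>

lemma observable_matrix: "matrix_on (F M) (\<lambda>\<phi>. A (trunc L M \<phi>)) (\<lambda>n m. A (ket m) n)"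
  unfolding matrix_on_def
proof (intro allI ballI)
  fix \<phi> n
  interpret fs: wave_space "\<lambda>\<phi>. \<phi> \<in> fock L" by (rule wave_space_fock [OF L])
  have k: "ket m \<in> fock L" if "m \<in> F M" for m
    using that by (intro finite_wave_fock) (auto simp: ket_def sectors_def)
  have "A (trunc L M \<phi>) = (\<lambda>n. \<Sum>m\<in>F M. A (\<lambda>n. \<phi> m * ket m n) n)"
    unfolding trunc_eq_sum_ket [OF L]
    by (rule fs.linear_on_sum [OF bounded_op_linear [OF A]]) (rule fock_scale [OF L k])
  also have "\<dots> = (\<lambda>n. \<Sum>m\<in>F M. \<phi> m * A (ket m) n)"
    using linear_on_scale [OF bounded_op_linear [OF A], OF k] by (simp cong: sum.cong)
  finally show "A (trunc L M \<phi>) n = (\<Sum>m\<in>F M. A (ket m) n * \<phi> m)"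
    by (simp add: mult.commute)
qed

lemma observable_hermitian:
  assumes "selfadjoint_op L A"
  shows "inn (F M) \<phi> (A (trunc L M \<psi>)) = inn (F M) (A (trunc L M \<phi>)) \<psi>"
  unfolding inn_trunc [of M \<phi>] inn_trunc_right [of M _ \<psi>]
  using assms trunc_fock [OF L] by (simp add: selfadjoint_op_def)

lemma observable_bound:
  assumes "op_norm L A \<le> 1"
  shows "cmod (inn (F M) \<phi> (A (trunc L M \<psi>))) \<le> nrm (F M) \<phi> * nrm (F M) \<psi>"
proof -
  have t: "trunc L M \<psi> \<in> fock L" by (rule trunc_fock [OF L])
  have "cmod (inn (F M) \<phi> (A (trunc L M \<psi>))) \<le> nrm (F M) \<phi> * nrm (F M) (A (trunc L M \<psi>))"
    by (rule inn_bound)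
  also have "\<dots> \<le> nrm (F M) \<phi> * fock_norm (A (trunc L M \<psi>))"
    by (intro mult_left_mono nrm_le_fock_norm [OF bounded_op_fock [OF A t]] finite_F nrm_nonneg)
  also have "\<dots> \<le> nrm (F M) \<phi> * fock_norm (trunc L M \<psi>)"
    by (intro mult_left_mono op_norm_contraction [OF A assms t] nrm_nonneg)
  finally show ?thesis unfolding fock_norm_trunc [OF L] .
qed

text \<open>The Hamiltonian leaves the sectors invariant and hence commutes with the truncation; on
  finite waves the observable passes through each \<open>ann\<close> and \<open>cre\<close> outside
  \<open>X\<close>.\<close>

lemma observable_commute:
  assumes X: "supported_on L X A" and S: "S \<subseteq> L" "S \<inter> X = {}"
  shows "A (trunc L M (hamiltonian J V S \<phi>)) = hamiltonian J V S (A (trunc L M \<phi>))"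
proof -
  interpret fw: wave_space "finite_wave L" by (rule wave_space_finite_wave)
  have lin: "linear_on (finite_wave L) A"
    using bounded_op_linear [OF A] by (auto simp: linear_on_def finite_wave_in_fock)
  obtain h where h: "matrix_on (F M) (hamiltonian J V S) h"
    using matrix_on_hamiltonian_sectors [OF L S(1)] by blast
  have "trunc L M (hamiltonian J V S \<phi>) n = hamiltonian J V S (trunc L M \<phi>) n" for n
  proof (cases "n \<in> F M")
    case True
    then show ?thesis using h by (simp add: matrix_on_def trunc_def)
  next
    case False
    then show ?thesis
      using hamiltonian_support [OF L S(1) trunc_outside False] by (simp add: trunc_def)
  qed
  then have e: "trunc L M (hamiltonian J V S \<phi>) = hamiltonian J V S (trunc L M \<phi>)" by blast
  show ?thesis
    unfolding e
  proof (rule fw.commute_hamiltonian [OF lin finite_wave_trunc [OF L]])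
    fix k \<psi> assume k: "k \<in> S" and \<psi>: "finite_wave L \<psi>"
    have kL: "k \<in> L" "k \<notin> X" using k S by auto
    show "finite_wave L (ann k \<psi>)" by (rule finite_wave_ann [OF kL(1) \<psi>])
    show "finite_wave L (cre k \<psi>)" by (rule finite_wave_cre [OF kL(1) \<psi>])
    show "A (ann k \<psi>) = ann k (A \<psi>)" by (rule supported_commute(1) [OF X kL \<psi>])
    show "A (cre k \<psi>) = cre k (A \<psi>)" by (rule supported_commute(2) [OF X kL \<psi>])
  qed
qed

lemma observable_commute_occ:
  assumes X: "supported_on L X A" and j: "j \<in> L" "j \<notin> X"
  shows "A (trunc L M (occ j \<phi>)) = occ j (A (trunc L M \<phi>))"
proof -
  have o: "occ j \<psi> = cre j (ann j \<psi>)" for \<psi> :: "'s wave"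
    by (simp add: occ_def cre_ann fun_eq_iff)
  have "trunc L M (occ j \<phi>) = cre j (ann j (trunc L M \<phi>))"
    unfolding o [symmetric] by (auto simp: trunc_def occ_def)
  then show ?thesis
    by (simp only: o supported_commute(1) [OF X j finite_wave_trunc [OF L]]
        supported_commute(2) [OF X j finite_wave_ann [OF j(1) finite_wave_trunc [OF L]]])
qed

end

text \<open>The Heisenberg evolution \<open>Y\<close> of the observable is a linear contraction, so
  replacing the state in each of its two places costs one norm of the difference, whatever
  \<open>t\<close> is.\<close>

lemma expectation_approx:
  fixes V :: "'s \<Rightarrow> 's \<Rightarrow> real"
  defines "U \<equiv> \<lambda>S. time_evol (hamiltonian J V S)"
  assumes S: "S \<subseteq> L" and A: "bounded_op L A" "op_norm L A \<le> 1" and \<psi>: "\<psi> \<in> fock L" "fock_norm \<psi> = 1"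
  shows "cmod (fock_inner \<psi> (U S (- t) (A (U S t \<psi>)))
      - inn (F M) (U S t (trunc L M \<psi>)) (A (trunc L M (U S t (trunc L M \<psi>)))))
    \<le> 2 * fock_norm (\<lambda>n. \<psi> n - trunc L M \<psi> n)"
proof -
  define Y where "Y \<phi> = U S (- t) (A (U S t \<phi>))" for \<phi>
  let ?\<psi> = "trunc L M \<psi>"
  let ?\<delta> = "\<lambda>n. \<psi> n - ?\<psi> n"
  have f: "?\<psi> \<in> fock L" by (rule trunc_fock [OF L])
  have d: "?\<delta> \<in> fock L" by (rule fock_diff [OF L \<psi>(1) f])
  have Yf: "Y \<phi> \<in> fock L" and Yn: "fock_norm (Y \<phi>) \<le> fock_norm \<phi>" if "\<phi> \<in> fock L" for \<phi>
  proof -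
    note 1 = evol_fock [OF S that, of V t]
    note 2 = bounded_op_fock [OF A(1) 1(1)]
    note 3 = evol_fock [OF S 2, of V "- t"]
    show "Y \<phi> \<in> fock L" unfolding Y_def U_def by (rule 3(1))
    show "fock_norm (Y \<phi>) \<le> fock_norm \<phi>"
      unfolding Y_def U_def using 3(2) op_norm_contraction [OF A 1(1)] 1(2) by linarith
  qed
  have Y: "Y \<psi> = (\<lambda>n. Y ?\<psi> n + Y ?\<delta> n)"
  proof -
    have 1: "U S t \<psi> = (\<lambda>n. U S t ?\<psi> n + U S t ?\<delta> n)"
      unfolding U_def using linear_on_add [OF evol_linear [OF S], OF f d] by simp
    have 2: "U S t ?\<psi> \<in> fock L" "U S t ?\<delta> \<in> fock L"
      unfolding U_def by (rule evol_fock(1) [OF S f], rule evol_fock(1) [OF S d])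
    have 3: "A (U S t \<psi>) = (\<lambda>n. A (U S t ?\<psi>) n + A (U S t ?\<delta>) n)"
      unfolding 1 by (rule linear_on_add [OF bounded_op_linear [OF A(1)], OF 2])
    show ?thesis
      unfolding Y_def unfolding 3 unfolding U_def
      by (rule linear_on_add [OF evol_linear [OF S], OF bounded_op_fock [OF A(1) 2(1), unfolded U_def]
            bounded_op_fock [OF A(1) 2(2), unfolded U_def]])
  qed
  \<comment> \<open>The evolution conserves particles, so the truncated state stays in its sectors
    and the second truncation changes nothing.\<close>
  have tU: "trunc L M (U S t ?\<psi>) = U S t ?\<psi>"
    unfolding U_def by (rule trunc_id, rule evol_support [OF S], rule trunc_outside)
  have "inn (F M) (U S t ?\<psi>) (A (trunc L M (U S t ?\<psi>))) = inn (F M) ?\<psi> (Y ?\<psi>)"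
    unfolding tU Y_def unfolding U_def by (rule evol_adjoint [OF S, symmetric])
  also have "\<dots> = fock_inner ?\<psi> (Y ?\<psi>)"
  proof -
    have "trunc L M ?\<psi> = ?\<psi>" by (rule trunc_id) (rule trunc_outside)
    then show ?thesis by (simp add: inn_trunc)
  qed
  finally have g: "inn (F M) (U S t ?\<psi>) (A (trunc L M (U S t ?\<psi>))) = fock_inner ?\<psi> (Y ?\<psi>)" .
  have "fock_inner \<psi> (Y \<psi>) = fock_inner ?\<psi> (Y \<psi>) + fock_inner ?\<delta> (Y \<psi>)"
    using fock_inner_add_left [OF f d Yf [OF \<psi>(1)]] by simp
  also have "fock_inner ?\<psi> (Y \<psi>) = fock_inner ?\<psi> (Y ?\<psi>) + fock_inner ?\<psi> (Y ?\<delta>)"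
    unfolding Y by (rule fock_inner_add_right [OF f Yf [OF f] Yf [OF d]])
  finally have diff: "fock_inner \<psi> (Y \<psi>) - fock_inner ?\<psi> (Y ?\<psi>) = fock_inner ?\<psi> (Y ?\<delta>) + fock_inner ?\<delta> (Y \<psi>)"
    by simp
  have "cmod (fock_inner ?\<psi> (Y ?\<delta>) + fock_inner ?\<delta> (Y \<psi>)) \<le> fock_norm ?\<psi> * fock_norm (Y ?\<delta>) + fock_norm ?\<delta> * fock_norm (Y \<psi>)"
    by (rule order_trans [OF norm_triangle_ineq add_mono [OF fock_inner_abs_summable(2) [OF f Yf [OF d]]
          fock_inner_abs_summable(2) [OF d Yf [OF \<psi>(1)]]]])
  also have "\<dots> \<le> 1 * fock_norm ?\<delta> + fock_norm ?\<delta> * 1"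
  proof (intro add_mono mult_mono fock_norm_nonneg Yn [OF d])
    show "fock_norm ?\<psi> \<le> 1"
      unfolding fock_norm_trunc [OF L] using nrm_le_fock_norm [OF \<psi>(1) finite_F [of M]] \<psi>(2) by simp
    show "fock_norm (Y \<psi>) \<le> 1" using Yn [OF \<psi>(1)] \<psi>(2) by simp
  qed auto
  finally show ?thesis unfolding g Y_def [symmetric] diff by simp
qed

text \<open>The expectations in the truncated states are finite sums of continuous functions and
  converge uniformly in time. Continuity makes the integrals genuine and lets their difference be
  taken under the integral sign.\<close>

lemma expectation_continuous:
  fixes V :: "'s \<Rightarrow> 's \<Rightarrow> real"
  defines "U \<equiv> \<lambda>S. time_evol (hamiltonian J V S)"
  assumes S: "S \<subseteq> L" and A: "bounded_op L A" "op_norm L A \<le> 1" and \<psi>: "\<psi> \<in> fock L" "fock_norm \<psi> = 1"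
  shows "continuous_on T (\<lambda>t. fock_inner \<psi> (U S (- t) (A (U S t \<psi>))))"
proof (rule uniform_limit_theorem)
  let ?g = "\<lambda>M t. inn (F M) (U S t (trunc L M \<psi>)) (A (trunc L M (U S t (trunc L M \<psi>))))"
  have c: "continuous_on T (\<lambda>t. U S t \<phi> n)" for \<phi> n
    unfolding U_def
    by (intro continuous_at_imp_continuous_on ballI
        has_vector_derivative_continuous [OF schroedinger_equation [OF finite_S [OF S]]])
  have "continuous_on T (?g M)" for M
  proof -
    have e: "?g M = (\<lambda>t. \<Sum>n\<in>F M. cnj (U S t (trunc L M \<psi>) n) * (\<Sum>m\<in>F M. A (ket m) n * U S t (trunc L M \<psi>) m))"
      using observable_matrix [OF A(1), of M] by (simp add: inn_def matrix_on_def fun_eq_iff)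
    show ?thesis unfolding e by (intro continuous_intros c)
  qed
  then show "\<forall>\<^sub>F M in sequentially. continuous_on T (?g M)" by simp
  show "uniform_limit T ?g (\<lambda>t. fock_inner \<psi> (U S (- t) (A (U S t \<psi>)))) sequentially"
  proof (rule uniform_limitI)
    fix e :: real assume "0 < e"
    then have "\<forall>\<^sub>F M in sequentially. fock_norm (\<lambda>n. \<psi> n - trunc L M \<psi> n) < e / 2"
      using order_tendstoD(2) [OF trunc_tendsto [OF L \<psi>(1)], of "e / 2"] by simp
    then show "\<forall>\<^sub>F M in sequentially. \<forall>t\<in>T. dist (?g M t) (fock_inner \<psi> (U S (- t) (A (U S t \<psi>)))) < e"
    proof eventually_elim
      case (elim M)
      show ?case
      proof
        fix t
        have "dist (?g M t) (fock_inner \<psi> (U S (- t) (A (U S t \<psi>)))) \<le> 2 * fock_norm (\<lambda>n. \<psi> n - trunc L M \<psi> n)"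
          unfolding U_def dist_commute [of "inn _ _ _"] unfolding dist_norm by (rule expectation_approx [OF S A \<psi>])
        then show "dist (?g M t) (fock_inner \<psi> (U S (- t) (A (U S t \<psi>)))) < e" using elim by simp
      qed
    qed
  qed
qed simp

text \<open>The bound \<open>E\<close> holds for all cutoffs \<open>M\<close> at once, so the
  comparison on the sectors survives the limit; the error \<open>4 * ?d M\<close> is
  \<open>2 * ?d M\<close> for each of the two evolutions.\<close>

lemma expectation_compare:
  fixes V :: "'s \<Rightarrow> 's \<Rightarrow> real"
  defines "U \<equiv> \<lambda>S. time_evol (hamiltonian J V S)"
  assumes I: "I \<subseteq> L" and V: "\<And>i j. i \<in> L \<Longrightarrow> j \<in> L \<Longrightarrow> V j i = V i j"
    and A: "bounded_op L A" "op_norm L A \<le> 1" "selfadjoint_op L A" "supported_on L X A" and X: "X \<subseteq> I"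
    and \<psi>: "\<psi> \<in> fock L" "fock_norm \<psi> = 1" and t: "0 \<le> t"
    and E: "\<And>M s. 0 \<le> s \<Longrightarrow> s \<le> t \<Longrightarrow> boundary_terms J V I (L - I) (F M) (U L s (trunc L M \<psi>)) \<le> E"
  shows "cmod (fock_inner \<psi> (U L (- t) (A (U L t \<psi>))) - fock_inner \<psi> (U I (- t) (A (U I t \<psi>)))) \<le> 2 * E * t"
proof -
  let ?d = "\<lambda>M. fock_norm (\<lambda>n. \<psi> n - trunc L M \<psi> n)"
  let ?g = "\<lambda>M S. inn (F M) (U S t (trunc L M \<psi>)) (A (trunc L M (U S t (trunc L M \<psi>))))"
  let ?f = "\<lambda>S. fock_inner \<psi> (U S (- t) (A (U S t \<psi>)))"
  have "cmod (?f L - ?f I) \<le> 2 * E * t + 4 * ?d M" for M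
  proof -
    have n: "nrm (F M) (trunc L M \<psi>) \<le> 1"
      using nrm_le_fock_norm [OF \<psi>(1) finite_F [of M]] nrm_cong [of "F M" "trunc L M \<psi>" \<psi>] \<psi>(2)
      by (simp add: trunc_def)
    have "cmod (?g M L - ?g M I) \<le> 2 * E * t"
      unfolding U_def
    proof (rule interaction_picture_bound [where B = "\<lambda>\<phi>. A (trunc L M \<phi>)", OF I _ observable_matrix [OF A(1)]
            observable_hermitian [OF A(1,3)] observable_bound [OF A(1,2)] _ _ n t])
      show "V j i = V i j" if "i \<in> L" "j \<in> L" for i j by (rule V [OF that])
      show "A (trunc L M (hamiltonian J V (L - I) \<phi>)) n = hamiltonian J V (L - I) (A (trunc L M \<phi>)) n" for \<phi> n
      proof -
        have "L - I \<subseteq> L" "(L - I) \<inter> X = {}" using X by blast+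
        then show ?thesis by (simp only: observable_commute [OF A(1,4)])
      qed
      show "A (trunc L M (occ j \<phi>)) n = occ j (A (trunc L M \<phi>)) n" if "j \<in> L - I" for j \<phi> n
      proof -
        have "j \<in> L" "j \<notin> X" using X that by blast+
        then show ?thesis by (rule fun_cong [OF observable_commute_occ [OF A(1,4)]])
      qed
    qed (rule E [unfolded U_def])
    moreover have "cmod (?f L - ?g M L) \<le> 2 * ?d M"
      unfolding U_def by (rule expectation_approx [OF subset_refl A(1,2) \<psi>])
    moreover have "cmod (?f I - ?g M I) \<le> 2 * ?d M"
      unfolding U_def by (rule expectation_approx [OF I A(1,2) \<psi>])
    moreover have "?f L - ?f I = (?g M L - ?g M I) + ((?f L - ?g M L) - (?f I - ?g M I))" by simp
    ultimately show ?thesis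
      using norm_triangle_ineq [of "?g M L - ?g M I" "(?f L - ?g M L) - (?f I - ?g M I)"]
        norm_triangle_ineq4 [of "?f L - ?g M L" "?f I - ?g M I"] by simp
  qed
  moreover have "(\<lambda>M. 2 * E * t + 4 * ?d M) \<longlonglongrightarrow> 2 * E * t + 4 * 0"
    by (intro tendsto_intros trunc_tendsto [OF L \<psi>(1)])
  ultimately have "cmod (?f L - ?f I) \<le> 2 * E * t + 4 * 0"
    by (intro LIMSEQ_le_const) auto
  then show ?thesis by simp
qed

lemma time_integral_compare:
  fixes V :: "'s \<Rightarrow> 's \<Rightarrow> real"
  defines "U \<equiv> \<lambda>S. time_evol (hamiltonian J V S)"
  assumes I: "I \<subseteq> L" and V: "\<And>i j. i \<in> L \<Longrightarrow> j \<in> L \<Longrightarrow> V j i = V i j"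
    and A: "bounded_op L A" "op_norm L A \<le> 1" "selfadjoint_op L A" "supported_on L X A" and X: "X \<subseteq> I"
    and \<psi>: "\<psi> \<in> fock L" "fock_norm \<psi> = 1" and T: "0 \<le> T"
    and E: "\<And>M s. 0 \<le> s \<Longrightarrow> s \<le> T \<Longrightarrow> boundary_terms J V I (L - I) (F M) (U L s (trunc L M \<psi>)) \<le> E"
    and E0: "0 \<le> E"
  shows "cmod (time_integral \<psi> (hamiltonian J V L) T A - time_integral \<psi> (hamiltonian J V I) T A) \<le> 2 * E * T\<^sup>2"
proof -
  let ?f = "\<lambda>S t. fock_inner \<psi> (U S (- t) (A (U S t \<psi>)))"
  have c: "continuous_on {0..T} (?f S)" if "S \<subseteq> L" for S
    unfolding U_def by (rule expectation_continuous [OF that A(1,2) \<psi>])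
  have "time_integral \<psi> (hamiltonian J V L) T A - time_integral \<psi> (hamiltonian J V I) T A
      = integral {0..T} (\<lambda>t. ?f L t - ?f I t)"
    unfolding time_integral_def U_def
    by (rule Henstock_Kurzweil_Integration.integral_diff [symmetric])
       (rule integrable_continuous_interval, rule c [unfolded U_def], rule I subset_refl)+
  also have "cmod \<dots> \<le> 2 * E * T * (T - 0)"
  proof (rule integral_bound [OF T])
    show "continuous_on {0..T} (\<lambda>t. ?f L t - ?f I t)"
      using c [of L] c [OF I] by (intro continuous_on_diff) auto
    fix t assume t: "t \<in> {0..T}"
    have "cmod (?f L t - ?f I t) \<le> 2 * E * t"
      unfolding U_def
    proof (rule expectation_compare [OF I _ A X \<psi>])
      show "V j i = V i j" if "i \<in> L" "j \<in> L" for i j by (rule V [OF that])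
      show "0 \<le> t" using t by simp
    qed (rule E [unfolded U_def], use t in auto)
    also have "\<dots> \<le> 2 * E * T" using t E0 by (intro mult_left_mono) auto
    finally show "cmod (?f L t - ?f I t) \<le> 2 * E * T" .
  qed
  finally show ?thesis by (simp add: power2_eq_square mult.assoc)
qed

end

section \<open>The truncation error\<close>

lemma slow_tail_eventually:
  assumes "0 < v"
  shows "\<exists>R0. \<forall>r\<ge>R0. slow_tail \<alpha> D K v r"
proof -
  have "((\<lambda>r. ln r / sqrt r) \<longlongrightarrow> 0) at_top" by real_asymp
  then have "((\<lambda>r. 32 * \<alpha> * K * lattice_const D (\<alpha> - 2) * (ln r / sqrt r)) \<longlongrightarrow> 0) at_top"
    by (rule tendsto_mult_right_zero)
  then have "\<forall>\<^sub>F r in at_top. 32 * \<alpha> * K * lattice_const D (\<alpha> - 2) * (ln r / sqrt r) < v / 4"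
    using assms by (intro order_tendstoD) auto
  then show ?thesis
    unfolding eventually_at_top_linorder slow_tail_def by (meson less_imp_le)
qed

definition comparison_const :: "real \<Rightarrow> nat \<Rightarrow> real \<Rightarrow> real \<Rightarrow> real \<Rightarrow> real \<Rightarrow> real" where
  "comparison_const \<alpha> D K v lam R0 =
    cross_const \<alpha> D K (density_const \<alpha> D K v lam) (shell_const \<alpha> D K v lam R0)"

lemma beta_le: "3 * real D + 1 < \<alpha> \<Longrightarrow> real (beta D \<alpha>) \<le> \<alpha> - 3 * real D - 1"
  unfolding beta_def by (simp add: of_nat_nat)

lemma powr_le_inverse_power_beta:
  assumes R: "1 \<le> R" and \<alpha>: "3 * real D + 1 < \<alpha>"
  shows "R * (R ^ D * R ^ D * R ^ D * R powr (- \<alpha>)) \<le> 1 / R ^ beta D \<alpha>"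
proof -
  have "R * (R ^ D * R ^ D * R ^ D * R powr (- \<alpha>)) = R powr (1 + (real D + real D + real D + - \<alpha>))"
    unfolding powr_add using R by (simp add: powr_realpow)
  also have "\<dots> \<le> R powr (- real (beta D \<alpha>))"
    using R beta_le [OF \<alpha>] by (intro powr_mono) auto
  also have "\<dots> = 1 / R ^ beta D \<alpha>"
    using R by (simp add: powr_minus powr_realpow divide_inverse)
  finally show ?thesis .
qed

context bose_setup
begin

text \<open>One constant for hopping and interaction. The factor \<open>2 powr \<alpha>\<close> pays
  for replacing distances by brackets, and the absolute values make it nonnegative whatever the
  signs of the two constants.\<close>

definition coupling_const :: real where "coupling_const = 2 powr \<alpha> * max \<bar>C\<^sub>J\<bar> \<bar>C\<^sub>V\<bar>"

lemma decay_bound: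
  assumes "0 \<le> \<alpha>" "i \<in> L" "j \<in> L" "z \<le> C * decay \<alpha> i j" "\<bar>C\<bar> \<le> max \<bar>C\<^sub>J\<bar> \<bar>C\<^sub>V\<bar>"
  shows "z \<le> coupling_const * bracket 1 i j powr (- \<alpha>)"
proof -
  have d: "0 \<le> decay \<alpha> i j" by (simp add: decay_def)
  have "C * decay \<alpha> i j \<le> max \<bar>C\<^sub>J\<bar> \<bar>C\<^sub>V\<bar> * decay \<alpha> i j"
    using assms(5) d by (intro mult_right_mono) linarith
  also have "\<dots> \<le> max \<bar>C\<^sub>J\<bar> \<bar>C\<^sub>V\<bar> * (2 powr \<alpha> * bracket 1 i j powr (- \<alpha>))"
    using assms L_lattice by (intro mult_left_mono decay_le_bracket) auto
  finally show ?thesis using assms(4) by (simp add: coupling_const_def mult_ac)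
qed

lemma lattice_hopping:
  assumes \<alpha>: "3 * real CARD('d) + 1 < \<alpha>" and v: "0 < v"
  shows "lattice_hopping L J \<alpha> coupling_const v"
proof
  show "finite L" by (rule L_finite)
  show "J j i = cnj (J i j)" if "i \<in> L" "j \<in> L" for i j by (rule J_hermitian [OF that])
  show "L \<subseteq> int_lattice" by (rule L_lattice)
  show "3 * real CARD('d) + 1 < \<alpha>" by (rule \<alpha>)
  show "0 \<le> coupling_const" by (simp add: coupling_const_def)
  show "0 < v" by (rule v)
  show "cmod (J i j) \<le> coupling_const * bracket 1 i j powr (- \<alpha>)" if "i \<in> L" "j \<in> L" for i j
    using \<alpha> by (intro decay_bound [OF _ that J_decay [OF that]]) auto
  show "2 * (\<Sum>j\<in>L. cmod (J i j) * dist i j) \<le> v" if "i \<in> L" for i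
  proof -
    have "(\<Sum>j\<in>L. cmod (J i j) * dist i j) \<le> (SUP x\<in>L. \<Sum>y\<in>L. cmod (J x y) * dist x y)"
      by (rule cSUP_upper [OF that]) (simp add: L_finite)
    then show ?thesis using v_gt by linarith
  qed
qed

text \<open>The ball of radius \<open>1\<close> about \<open>i\<close> contains \<open>i\<close>, so
  (C1) with \<open>p = 2\<close> on this ball dominates the second moment of the occupation at
  \<open>i\<close>. Summability, part of \<open>expectation_le\<close>, is what allows partial sums
  to be compared with the full one.\<close>

lemma initial_occ:
  assumes i: "i \<in> L" and lam: "0 < lam"
  shows "nrm (sectors L (Suc M)) (occ i \<psi>) \<le> lam"
proof (rule power2_le_imp_le)
  let ?B = "L \<inter> cball i 1" and ?F = "sectors L (Suc M)"
  define g where "g n = (real (sum n ?B))\<^sup>2 * (cmod (\<psi> n))\<^sup>2" for n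
  have e: "cnj (\<psi> n) * (number_op ?B ^^ 2) \<psi> n = complex_of_real (g n)" for n
  proof -
    have "(number_op ?B ^^ 2) \<psi> n = of_nat (sum n ?B) * (of_nat (sum n ?B) * \<psi> n)"
      by (simp only: numeral_2_eq_2 funpow.simps o_apply id_apply number_op_eq)
    moreover have "complex_of_real ((real k)\<^sup>2) = of_nat k * of_nat k" for k
      by (simp add: power2_eq_square)
    ultimately show ?thesis
      unfolding g_def of_real_mult complex_norm_square by (simp add: mult_ac del: of_real_power of_nat_sum)
  qed
  have "expectation_le \<psi> (number_op ?B ^^ 2) ((lam * 1 ^ CARD('d)) ^ 2)"
    by (rule C1 [OF i]) auto
  then have s: "(\<lambda>n. complex_of_real (g n)) summable_on UNIV" and b: "Re (\<Sum>\<^sub>\<infinity>n. complex_of_real (g n)) \<le> lam\<^sup>2"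
    unfolding expectation_le_def fock_inner_def e by auto
  have gs: "g summable_on UNIV" using summable_on_Re [OF s] by simp
  have "(nrm ?F (occ i \<psi>))\<^sup>2 \<le> sum g ?F"
    unfolding nrm_square
  proof (rule sum_mono)
    fix n :: "(real ^ 'd) conf"
    have "n i \<le> sum n ?B" using i L_finite by (intro member_le_sum [of i ?B n]) auto
    then have "(real (n i))\<^sup>2 \<le> (real (sum n ?B))\<^sup>2" by (intro power_mono) (simp_all del: of_nat_sum)
    then show "(cmod (occ i \<psi> n))\<^sup>2 \<le> g n"
      unfolding g_def occ_def by (simp add: norm_mult power_mult_distrib mult_right_mono del: of_nat_sum)
  qed
  also have "\<dots> \<le> infsum g UNIV"
    using finite_sectors [OF L_finite] by (intro finite_sum_le_infsum gs) (auto simp: g_def)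
  also have "\<dots> = Re (\<Sum>\<^sub>\<infinity>n. complex_of_real (g n))"
    using infsum_Re [OF s] by simp
  also have "\<dots> \<le> lam\<^sup>2" by (rule b)
  finally show "(nrm ?F (occ i \<psi>))\<^sup>2 \<le> lam\<^sup>2" .
qed (use lam in simp)

lemma vacuum:
  assumes "\<psi> n \<noteq> 0" "k \<in> nbhd L X (2 * R)" "k \<notin> X"
  shows "n k = 0"
proof -
  let ?S = "nbhd L X (2 * R) - X"
  have "finite ?S" using L_finite by (simp add: nbhd_def)
  moreover have "of_nat (\<Sum>i\<in>?S. n i) * \<psi> n = 0"
    using fun_cong [OF C2, of n] unfolding number_op_eq .
  then have "(\<Sum>i\<in>?S. n i) = 0" using assms(1) by (simp del: of_nat_sum)
  ultimately show ?thesis using assms by (auto simp: sum_eq_0_iff)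
qed

text \<open>Both ends of a short pair across the boundary are between \<open>R - d\<close> and
  \<open>R + d\<close> away from \<open>X\<close>, while particles sit in \<open>X\<close> or beyond
  \<open>2 * R\<close>. In both cases the distance is at least \<open>R - d\<close>, which exceeds
  \<open>7 / 8 * R\<close>.\<close>

lemma boundary_far_from_particles:
  assumes d: "0 \<le> d" "d \<le> R / 16" and i: "i \<in> nbhd L X R" and j: "j \<in> L - nbhd L X R" and ij: "dist i j \<le> d"
    and n: "\<psi> n \<noteq> 0" "k \<in> L" "n k \<noteq> 0"
  shows "7 / 8 * R \<le> dist k i" and "7 / 8 * R \<le> dist k j"
proof -
  have X: "X \<noteq> {}" and Ri: "infdist i X \<le> R" using i by (auto simp: nbhd_def)
  have Rj: "R < infdist j X" using j X by (auto simp: nbhd_def)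
  have far: "7 / 8 * R \<le> dist k y" if y: "R - d \<le> infdist y X" "infdist y X \<le> R + d" for y
  proof (cases "k \<in> X")
    case True
    have "infdist y X \<le> dist y k" by (rule infdist_le [OF True])
    then show ?thesis using y d by (simp add: dist_commute)
  next
    case False
    have "2 * R < infdist k X"
    proof (rule ccontr)
      assume "\<not> 2 * R < infdist k X"
      then have "k \<in> nbhd L X (2 * R)" using n(2) X by (simp add: nbhd_def)
      then show False using vacuum [OF n(1) _ False] n(3) by simp
    qed
    then show ?thesis using infdist_triangle [of k X y] y d by linarith
  qed
  have "infdist j X \<le> infdist i X + dist i j" using infdist_triangle [of j X i] by (simp add: dist_commute)
  then have "R - d \<le> infdist i X" "infdist i X \<le> R + d" "R - d \<le> infdist j X" "infdist j X \<le> R + d"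
    using Ri Rj ij d by linarith+
  then show "7 / 8 * R \<le> dist k i" "7 / 8 * R \<le> dist k j" using far by auto
qed

lemma time_integral_bound:
  assumes \<alpha>: "3 * real CARD('d) + 1 < \<alpha>" and v: "0 < v" and lam: "0 < lam"
    and T: "0 \<le> T" "v * T \<le> R" and R0: "\<And>r. R0 \<le> r \<Longrightarrow> slow_tail \<alpha> CARD('d) coupling_const v r"
  shows "cmod (time_integral \<psi> (hamiltonian J V L) T A - time_integral \<psi> (hamiltonian J V (nbhd L X R)) T A)
    \<le> 2 * comparison_const \<alpha> CARD('d) coupling_const v lam R0 * (T\<^sup>2 / R ^ beta CARD('d) \<alpha>)"
proof -
  interpret lattice_hopping L J \<alpha> coupling_const v by (rule lattice_hopping [OF \<alpha> v])
  let ?I = "nbhd L X R" and ?K = "comparison_const \<alpha> CARD('d) coupling_const v lam R0"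
  let ?b = "density_const \<alpha> CARD('d) coupling_const v lam" and ?c = "shell_const \<alpha> CARD('d) coupling_const v lam R0"
  let ?e = "R * (R ^ CARD('d) * R ^ CARD('d) * R ^ CARD('d) * R powr (- \<alpha>))"
  have R: "2 \<le> R" "1 \<le> R" using R_ge by auto
  have lam0: "0 \<le> lam" using lam by simp
  have b: "0 \<le> ?b" and c: "0 \<le> ?c"
    by (rule density_const_nonneg [OF lam0], rule shell_const_nonneg [OF lam0])
  have I: "?I \<subseteq> L" by (auto simp: nbhd_def)
  have XI: "X \<subseteq> ?I" using X_subset R by (auto simp: nbhd_def infdist_zero)
  have V_le: "\<bar>V i j\<bar> \<le> coupling_const * bracket 1 i j powr (- \<alpha>)" if "i \<in> L" "j \<in> L" for i j
    using \<alpha>_gt by (intro decay_bound [OF _ that V_decay [OF that]]) auto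
  have K0: "0 \<le> ?K"
    unfolding comparison_const_def cross_const_def
    using b c K long_const_nonneg lattice_consts_ge_1 by (intro add_nonneg_nonneg mult_nonneg_nonneg) auto
  have E0: "0 \<le> ?K * ?e" using K0 R by simp
  let ?\<phi> = "\<lambda>M s. time_evol (hamiltonian J V L) s (trunc L M \<psi>)"
  have E: "boundary_terms J V ?I (L - ?I) (F M) (?\<phi> M s) \<le> ?K * ?e"
    if s: "0 \<le> s" "s \<le> T" for M s
  \<comment> \<open>Because \<open>X \<subseteq> ?I\<close>, this is the case of empty
    \<open>X\<close>, in which the truncated Hamiltonian has no terms and nothing couples across the
    boundary.\<close>
  proof (cases "?I = {}")
    case True
    have "nrm (F M) (\<lambda>n. 0) = 0" by (simp add: nrm_def L2_set_def)
    then show ?thesis using E0 unfolding True boundary_terms_def by simp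
  next
    case False
    then have X: "X \<noteq> {}" by (auto simp: nbhd_def)
    then obtain x where x: "x \<in> X" by blast
    have vs: "v * s \<le> R" using mult_left_mono [OF s(2), of v] v T by linarith
    have occ0: "nrm (F M) (occ i (trunc L M \<psi>)) \<le> lam" if "i \<in> L" for i
      using initial_occ [OF that lam, of M] nrm_cong [of "F M" "occ i (trunc L M \<psi>)" "occ i \<psi>"]
      by (simp add: occ_def trunc_inside)
    show ?thesis
      unfolding comparison_const_def
    proof (rule cross_bound [OF R(1) b c V_le I])
      show "x \<in> L" using x X_subset by auto
      \<comment> \<open>The assumption that \<open>R\<close> is at least the diameter of
        \<open>X\<close> lets a single site \<open>x\<close> serve as the centre of the whole
        region.\<close>
      show "dist i x \<le> 2 * R" if i: "i \<in> ?I" for i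
      proof -
        have fX: "finite X" using X_subset L_finite finite_subset by blast
        obtain y where y: "y \<in> X" "infdist i X = dist i y"
          using infdist_attains_inf [OF finite_imp_closed [OF fX] X] by blast
        have "dist y x \<le> diameter X"
          using diameter_bounded_bound [OF finite_imp_bounded [OF fX] y(1) x] .
        then have "dist y x \<le> R" using R_ge by simp
        moreover have "dist i y \<le> R" using i y by (simp add: nbhd_def)
        ultimately show ?thesis using dist_triangle [of i x y] by linarith
      qed
      show "moment L M (point_weight \<alpha> R y) (?\<phi> M s) \<le> (?b * R ^ CARD('d))\<^sup>2"
        if "y \<in> L" for y
        by (rule density_bound [OF that R(2) s(1) vs lam0 occ0])
      fix i j assume i: "i \<in> ?I" and j: "j \<in> L - ?I" and ij: "dist i j \<le> R / (64 * \<alpha>)"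
      have d: "0 \<le> R / (64 * \<alpha>)" "R / (64 * \<alpha>) \<le> R / 16"
        using R \<alpha>_gt by (simp, intro divide_left_mono) auto
      have vac: "7 / 8 * R \<le> dist k i" "7 / 8 * R \<le> dist k j"
        if "n \<in> F M" "trunc L M \<psi> n \<noteq> 0" "k \<in> L" "n k \<noteq> 0" for n k
      proof -
        have "\<psi> n \<noteq> 0" using that(2) by (auto simp: trunc_def split: if_splits)
        then show "7 / 8 * R \<le> dist k i" "7 / 8 * R \<le> dist k j"
          using boundary_far_from_particles [OF d i j ij, where n = n and k = k] that(3,4) by auto
      qed
      have iL: "i \<in> L" and jL: "j \<in> L" using i j I by auto
      let ?r = "?c * (R * (R ^ CARD('d) * R ^ CARD('d) * R powr (- \<alpha>)))"
      show "nrm (F M) (occ i (?\<phi> M s)) \<le> ?r \<and>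
          nrm (F M) (occ j (?\<phi> M s)) \<le> ?r"
      proof
        show "nrm (F M) (occ i (?\<phi> M s)) \<le> ?r"
          by (rule shell_occ_bound [OF iL R(1) s(1) vs lam0 occ0 vac(1) R0])
        show "nrm (F M) (occ j (?\<phi> M s)) \<le> ?r"
          by (rule shell_occ_bound [OF jL R(1) s(1) vs lam0 occ0 vac(2) R0])
      qed
    qed
  qed
  have "cmod (time_integral \<psi> (hamiltonian J V L) T A - time_integral \<psi> (hamiltonian J V ?I) T A) \<le> 2 * (?K * ?e) * T\<^sup>2"
  proof (rule time_integral_compare [OF I _ A_bounded A_norm A_selfadjoint A_supported XI psi_fock psi_normalized T(1)])
    show "V j i = V i j" if "i \<in> L" "j \<in> L" for i j by (rule V_symmetric [OF that])
  qed (rule E, assumption+, rule E0)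
  also have "\<dots> = 2 * ?K * T\<^sup>2 * ?e" by simp
  also have "\<dots> \<le> 2 * ?K * T\<^sup>2 * (1 / R ^ beta CARD('d) \<alpha>)"
    using K0 by (intro mult_left_mono powr_le_inverse_power_beta R \<alpha>) auto
  finally show ?thesis by simp
qed

end

section \<open>The uniform constant and the choice of the radius\<close>

theorem theorem9:
  fixes \<alpha> C\<^sub>J C\<^sub>V lam v :: real and X :: "(real ^ 'd) set"
  assumes "\<alpha> > 3 * real CARD('d) + 1" and "lam > 0" and "v > 0"
  shows "(\<exists>C. \<forall>L J V A R \<psi> T.
            bose_setup \<alpha> C\<^sub>J C\<^sub>V lam v X L J V A R \<psi> \<and> 0 \<le> T \<and> v * T \<le> R \<longrightarrow>
            cmod (time_integral \<psi> (hamiltonian J V L) T A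
                  - time_integral \<psi> (hamiltonian J V (nbhd L X R)) T A)
              \<le> C * (T\<^sup>2 / R ^ beta CARD('d) \<alpha>))
       \<and> (beta CARD('d) \<alpha> \<ge> 1 \<longrightarrow>
          (let scale = (\<lambda>(\<epsilon>, T). v * T + (T\<^sup>2 / \<epsilon>) powr (1 / real (beta CARD('d) \<alpha>))) in
           \<exists>R\<^sub>\<epsilon> :: real \<times> real \<Rightarrow> real.
             R\<^sub>\<epsilon> \<in> \<Theta>[principal {(\<epsilon>, T). 0 < \<epsilon> \<and> 0 \<le> T \<and> 1 \<le> scale (\<epsilon>, T)}](scale) \<and>
             (\<forall>\<epsilon> T. 0 < \<epsilon> \<and> 0 \<le> T \<longrightarrow> max 2 (diameter X) \<le> R\<^sub>\<epsilon> (\<epsilon>, T)) \<and>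
             (\<forall>L J V A R \<psi> \<epsilon> T.
                bose_setup \<alpha> C\<^sub>J C\<^sub>V lam v X L J V A R \<psi> \<and> 0 < \<epsilon> \<and> 0 \<le> T \<and> R\<^sub>\<epsilon> (\<epsilon>, T) \<le> R \<longrightarrow>
                cmod (time_integral \<psi> (hamiltonian J V L) T A
                      - time_integral \<psi> (hamiltonian J V (nbhd L X R)) T A) \<le> \<epsilon>)))"
proof -
  let ?\<beta> = "beta CARD('d) \<alpha>"
  \<comment> \<open>This is \<open>coupling_const\<close>, written out because it and
    \<open>R0\<close> have to be fixed before the lattice, the couplings and the state; hence the
    constant is uniform in them.\<close>
  define K where "K = 2 powr \<alpha> * max \<bar>C\<^sub>J\<bar> \<bar>C\<^sub>V\<bar>"
  obtain R0 where R0: "\<And>r. R0 \<le> r \<Longrightarrow> slow_tail \<alpha> CARD('d) K v r"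
    using slow_tail_eventually [OF assms(3)] by blast
  define C where "C = 2 * comparison_const \<alpha> CARD('d) K v lam R0"
  have C: "cmod (time_integral \<psi> (hamiltonian J V L) T A - time_integral \<psi> (hamiltonian J V (nbhd L X R)) T A)
      \<le> C * (T\<^sup>2 / R ^ ?\<beta>)"
    if "bose_setup \<alpha> C\<^sub>J C\<^sub>V lam v X L J V A R \<psi>" "0 \<le> T" "v * T \<le> R" for L J V A R \<psi> T
  proof -
    interpret bose_setup \<alpha> C\<^sub>J C\<^sub>V lam v X L J V A R \<psi> by (rule that(1))
    show ?thesis
      unfolding C_def K_def coupling_const_def [symmetric]
      by (rule time_integral_bound [OF assms(1,3,2) that(2,3)]) (simp add: coupling_const_def R0 [unfolded K_def])
  qed
  have second: "let scale = (\<lambda>(\<epsilon>, T). v * T + (T\<^sup>2 / \<epsilon>) powr (1 / real ?\<beta>)) in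
      \<exists>R\<^sub>\<epsilon> :: real \<times> real \<Rightarrow> real.
        R\<^sub>\<epsilon> \<in> \<Theta>[principal {(\<epsilon>, T). 0 < \<epsilon> \<and> 0 \<le> T \<and> 1 \<le> scale (\<epsilon>, T)}](scale) \<and>
        (\<forall>\<epsilon> T. 0 < \<epsilon> \<and> 0 \<le> T \<longrightarrow> max 2 (diameter X) \<le> R\<^sub>\<epsilon> (\<epsilon>, T)) \<and>
        (\<forall>L J V A R \<psi> \<epsilon> T.
          bose_setup \<alpha> C\<^sub>J C\<^sub>V lam v X L J V A R \<psi> \<and> 0 < \<epsilon> \<and> 0 \<le> T \<and> R\<^sub>\<epsilon> (\<epsilon>, T) \<le> R \<longrightarrow>
          cmod (time_integral \<psi> (hamiltonian J V L) T A
                - time_integral \<psi> (hamiltonian J V (nbhd L X R)) T A) \<le> \<epsilon>)"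
    if \<beta>: "1 \<le> ?\<beta>"
  proof -
    define scale where "scale = (\<lambda>(\<epsilon>, T). v * T + (T\<^sup>2 / \<epsilon>) powr (1 / real ?\<beta>))"
    \<comment> \<open>One factor covers the two lower bounds on the radius and absorbs the constant
      \<open>C\<close> of the first part.\<close>
    define m where "m = max 2 (max (diameter X) C)"
    \<comment> \<open>The summand \<open>1\<close> keeps the radius above \<open>m\<close> even
      where \<open>scale\<close> is small; where \<open>scale\<close> is at least \<open>1\<close>
      it costs only a factor of two.\<close>
    define Rc where "Rc p = m * (scale p + 1)" for p
    have m: "2 \<le> m" "diameter X \<le> m" "C \<le> m" by (auto simp: m_def)
    have scale0: "0 \<le> scale (\<epsilon>, T)" "v * T \<le> scale (\<epsilon>, T)" "(T\<^sup>2 / \<epsilon>) powr (1 / real ?\<beta>) \<le> scale (\<epsilon>, T)" if "0 \<le> T" for \<epsilon> T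
      using that assms(3) by (auto simp: scale_def)
    have Rc_ge: "m * scale (\<epsilon>, T) \<le> Rc (\<epsilon>, T)" "m \<le> Rc (\<epsilon>, T)" if "0 \<le> T" for \<epsilon> T
      using m scale0(1) [OF that, of \<epsilon>] by (auto simp: Rc_def distrib_left)
    have "Rc \<in> \<Theta>[principal {(\<epsilon>, T). 0 < \<epsilon> \<and> 0 \<le> T \<and> 1 \<le> scale (\<epsilon>, T)}](scale)"
    proof (rule bigthetaI)
      show "Rc \<in> O[principal {(\<epsilon>, T). 0 < \<epsilon> \<and> 0 \<le> T \<and> 1 \<le> scale (\<epsilon>, T)}](scale)"
      proof (rule bigoI [of _ "2 * m"])
        show "\<forall>\<^sub>F p in principal {(\<epsilon>, T). 0 < \<epsilon> \<and> 0 \<le> T \<and> 1 \<le> scale (\<epsilon>, T)}. norm (Rc p) \<le> 2 * m * norm (scale p)"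
          unfolding eventually_principal
        proof
          fix p assume "p \<in> {(\<epsilon>, T). 0 < \<epsilon> \<and> 0 \<le> T \<and> 1 \<le> scale (\<epsilon>, T)}"
          then have "1 \<le> scale p" by auto
          then have "m * (scale p + 1) \<le> m * (2 * scale p)" using m by (intro mult_left_mono) auto
          then show "norm (Rc p) \<le> 2 * m * norm (scale p)"
            using m \<open>1 \<le> scale p\<close> by (simp add: Rc_def)
        qed
      qed
      show "Rc \<in> \<Omega>[principal {(\<epsilon>, T). 0 < \<epsilon> \<and> 0 \<le> T \<and> 1 \<le> scale (\<epsilon>, T)}](scale)"
      proof (rule landau_omega.bigI [of 1])
        show "\<forall>\<^sub>F p in principal {(\<epsilon>, T). 0 < \<epsilon> \<and> 0 \<le> T \<and> 1 \<le> scale (\<epsilon>, T)}. norm (Rc p) \<ge> 1 * norm (scale p)"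
          unfolding eventually_principal
        proof
          fix p assume "p \<in> {(\<epsilon>, T). 0 < \<epsilon> \<and> 0 \<le> T \<and> 1 \<le> scale (\<epsilon>, T)}"
          then have "1 \<le> scale p" by auto
          then have "1 * scale p \<le> m * (scale p + 1)" using m by (intro mult_mono) auto
          then show "norm (Rc p) \<ge> 1 * norm (scale p)"
            using m \<open>1 \<le> scale p\<close> by (simp add: Rc_def)
        qed
      qed simp
    qed
    moreover have "\<forall>\<epsilon> T. 0 < \<epsilon> \<and> 0 \<le> T \<longrightarrow> max 2 (diameter X) \<le> Rc (\<epsilon>, T)"
      using Rc_ge(2) m by (metis max.bounded_iff order_trans)
    moreover have "cmod (time_integral \<psi> (hamiltonian J V L) T A
          - time_integral \<psi> (hamiltonian J V (nbhd L X R)) T A) \<le> \<epsilon>"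
      if b: "bose_setup \<alpha> C\<^sub>J C\<^sub>V lam v X L J V A R \<psi>" and \<epsilon>: "0 < \<epsilon>" and T: "0 \<le> T" and R: "Rc (\<epsilon>, T) \<le> R"
      for L J V A R \<psi> \<epsilon> T
    proof -
      let ?q = "(T\<^sup>2 / \<epsilon>) powr (1 / real ?\<beta>)"
      have mR: "m * scale (\<epsilon>, T) \<le> R" "m \<le> R" using Rc_ge [OF T, of \<epsilon>] R by linarith+
      have "1 * (v * T) \<le> m * scale (\<epsilon>, T)"
        using m scale0 [OF T, of \<epsilon>] assms(3) T by (intro mult_mono) auto
      then have "v * T \<le> R" using mR by linarith
      then have "cmod (time_integral \<psi> (hamiltonian J V L) T A - time_integral \<psi> (hamiltonian J V (nbhd L X R)) T A)
          \<le> C * (T\<^sup>2 / R ^ ?\<beta>)" by (rule C [OF b T])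
      also have "\<dots> \<le> m * (T\<^sup>2 / R ^ ?\<beta>)"
        using m mR by (intro mult_right_mono) auto
      also have "\<dots> \<le> \<epsilon>"
      proof -
        \<comment> \<open>For \<open>T = 0\<close> both sides are \<open>0\<close>:
          \<open>0 powr\<close> any exponent is \<open>0\<close>, and the power is positive.\<close>
        have q: "?q ^ ?\<beta> = T\<^sup>2 / \<epsilon>"
          using \<beta> \<epsilon> by (cases "T = 0") (simp_all add: powr_realpow [symmetric] powr_powr)
        \<comment> \<open>A linear factor \<open>m\<close> in the radius yields
          \<open>m ^ ?\<beta>\<close> in the error bound, and this is at least \<open>m\<close>,
          hence at least \<open>C\<close>, because \<open>?\<beta>\<close> is at least
          \<open>1\<close>.\<close>
        have "m * (T\<^sup>2 / \<epsilon>) \<le> m ^ ?\<beta> * (T\<^sup>2 / \<epsilon>)"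
          using m \<epsilon> \<beta> power_increasing [of 1 ?\<beta> m] by (intro mult_right_mono) auto
        also have "\<dots> = (m * ?q) ^ ?\<beta>" unfolding power_mult_distrib q ..
        also have "\<dots> \<le> R ^ ?\<beta>"
        proof (rule power_mono)
          have "m * ?q \<le> m * scale (\<epsilon>, T)" using m scale0(3) [OF T, of \<epsilon>] by (intro mult_left_mono) auto
          then show "m * ?q \<le> R" using mR by linarith
        qed (use m in simp)
        finally have "m * T\<^sup>2 \<le> \<epsilon> * R ^ ?\<beta>" using \<epsilon> by (simp add: field_simps)
        then show ?thesis using m mR by (simp add: divide_le_eq)
      qed
      finally show ?thesis .
    qed
    ultimately show ?thesis
      unfolding Let_def scale_def [symmetric] by (intro exI [of _ Rc]) blast
  qed
  show ?thesis using C second by blast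
qed

end
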